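(* For a real number $\Lambda>1$, let $\mathrm{DP}(\Lambda)$ denote the statement: for every (finite or infinite) packing $\mathcal{D}$ in the plane by circular disks of radius at most $1$, the set $\mathcal{D}'$ of disks obtained by enlarging each disk $D\in\mathcal{D}$ by the factor $\Lambda$ from its center covers no square of side length $4$. Suppose that $\mathrm{DP}(\Lambda)$ is true for some factor $\Lambda$ with $1<\Lambda\le 1.03$. Then the minimum geometric dilation $\Delta$ necessary to embed any finite set of points in the plane satisfies $$\Delta\;\ge\;\left(1+\left(\frac{\Lambda-1}{3}\right)^2\right)\frac{\pi}{2}.$$ In particular, if $\mathrm{DP}(1.00001)$ holds, then $\Delta\ge\left(1+\frac{10^{-10}}{9}\right)\frac{\pi}{2}>\left(1+10^{-11}\right)\frac{\pi}{2}$.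
   Context: A set of disks in the plane is a packing if the disks have pairwise disjoint interiors. Graphs $G$ are planar graphs embedded in $\mathbb{R}^2$ whose edges are piecewise continuously differentiable curves that do not intersect (except at common endpoints). $G$ is called finite if it has finitely many vertices. Points of $G$ are all points on its edges and its vertices. For points $p\ne q$ of $G$, $d_G(p,q)$ is the length of a shortest path in $G$ connecting $p$ and $q$ ($+\infty$ if there is none), $|pq|$ is the Euclidean distance, and the geometric dilation of $G$ is $\delta(G)=\sup_{p,q\in G,\,p\neq q} d_G(p,q)/|pq|$. The quantity $\Delta$ is defined by $$\Delta:=\sup_{P\subset\mathbb{R}^2,\ P\text{ finite}}\ \ \inf_{G\supset P,\ G\text{ finite}}\delta(G),$$ where the infimum is over all planar graphs $G$ embedded in $\mathbb{R}^2$ with finitely many vertices, whose edges are piecewise continuously differentiable curves that do not intersect (except at common endpoints), such that every point of $P$ is a point of $G$ (a vertex or a point on an edge). *)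

theory Defs
  imports "HOL-Analysis.Analysis"
begin

text \<open>The Euclidean plane is the type \<^typ>\<open>complex\<close>, as in the library's planar topology
  (Jordan curve theorem).\<close>


subsection \<open>Embedded planar graphs\<close>

text \<open>Textbook piecewise continuous differentiability: the derivative is one-sided at the
  breakpoints and continuous up to them on each closed piece.  The library's
  \<^term>\<open>g piecewise_C1_differentiable_on {0..1}\<close> is weaker: it says nothing about the derivative
  near the breakpoints, and so admits curves of infinite length.\<close>

definition piecewise_C1 :: "(real \<Rightarrow> complex) \<Rightarrow> bool" where
  "piecewise_C1 g \<longleftrightarrow>
     (\<exists>(n::nat) s. s 0 = 0 \<and> s n = 1 \<and>
        (\<forall>i<n. s i < s (Suc i) \<and>
           (\<exists>g'. continuous_on {s i..s (Suc i)} g' \<and>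
              (\<forall>t\<in>{s i..s (Suc i)}.
                 (g has_vector_derivative g' t) (at t within {s i..s (Suc i)})))))"

text \<open>An edge is represented by a parametrization over \<open>[0,1]\<close>.\<close>

record embedded_graph =
  verts :: "complex set"
  edges :: "(real \<Rightarrow> complex) set"

text \<open>Edges do not cross themselves or each other, and pass through vertices only at their
  endpoints.  Loops and parallel edges are allowed; placing additional vertices on them
  gives a simple graph with the same set of points.  The finiteness of the edge set, automatic
  for simple graphs, has to be required for that reason: uncountably many parallel edges
  between two vertices could fill a disk.\<close>

definition finite_plane_graph :: "embedded_graph \<Rightarrow> bool" where
  "finite_plane_graph G \<longleftrightarrow>
     finite (verts G) \<and> finite (edges G) \<and>
     (\<forall>g\<in>edges G. simple_path g \<and> piecewise_C1 g \<and>
        pathstart g \<in> verts G \<and> pathfinish g \<in> verts G \<and>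
        g ` {0<..<1} \<inter> verts G = {}) \<and>
     (\<forall>g\<in>edges G. \<forall>h\<in>edges G. g \<noteq> h \<longrightarrow>
        path_image g \<inter> path_image h \<subseteq>
          {pathstart g, pathfinish g} \<inter> {pathstart h, pathfinish h})"

definition graph_points :: "embedded_graph \<Rightarrow> complex set" where
  "graph_points G = verts G \<union> (\<Union>g\<in>edges G. path_image g)"


subsection \<open>Geometric dilation\<close>

text \<open>Arc length, as the supremum over inscribed polygonal lines.\<close>

definition curve_length :: "(real \<Rightarrow> complex) \<Rightarrow> ennreal" where
  "curve_length g =
     (SUP ts\<in>{ts. sorted ts \<and> set ts \<subseteq> {0..1}}.
        \<Sum>i<length ts - 1. ennreal (dist (g (ts ! i)) (g (ts ! Suc i))))"

definition graph_dist :: "embedded_graph \<Rightarrow> complex \<Rightarrow> complex \<Rightarrow> ennreal" where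
  "graph_dist G p q =
     (INF g\<in>{g. path g \<and> path_image g \<subseteq> graph_points G \<and> pathstart g = p \<and> pathfinish g = q}.
        curve_length g)"

definition dilation :: "embedded_graph \<Rightarrow> ennreal" where
  "dilation G =
     (SUP (p, q)\<in>{(p, q). p \<in> graph_points G \<and> q \<in> graph_points G \<and> p \<noteq> q}.
        graph_dist G p q / ennreal (dist p q))"

definition min_dilation :: ennreal ("\<Delta>") where
  "\<Delta> = (SUP P\<in>{P. finite P}.
          INF G\<in>{G. finite_plane_graph G \<and> P \<subseteq> graph_points G}. dilation G)"


subsection \<open>Disk packings\<close>

text \<open>A disk is represented by its center and radius.\<close>

definition disk_packing :: "(complex \<times> real) set \<Rightarrow> bool" where
  "disk_packing D \<longleftrightarrow>
     (\<forall>(c, r)\<in>D. 0 < r) \<and>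
     (\<forall>(c, r)\<in>D. \<forall>(c', r')\<in>D. (c, r) \<noteq> (c', r') \<longrightarrow>
        interior (cball c r) \<inter> interior (cball c' r') = {})"

text \<open>Closed squares in arbitrary position.\<close>

definition is_square :: "real \<Rightarrow> complex set \<Rightarrow> bool" where
  "is_square l S \<longleftrightarrow>
     (\<exists>a u v. norm u = 1 \<and> norm v = 1 \<and> inner u v = 0 \<and>
        S = {a + x *\<^sub>R u + y *\<^sub>R v | x y. x \<in> {0..l} \<and> y \<in> {0..l}})"

definition DP :: "real \<Rightarrow> bool" where
  "DP \<Lambda> \<longleftrightarrow>
     (\<forall>D. disk_packing D \<and> (\<forall>(c, r)\<in>D. r \<le> 1) \<longrightarrow>
        \<not> (\<exists>S. is_square 4 S \<and> S \<subseteq> (\<Union>(c, r)\<in>D. cball c (\<Lambda> * r))))"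

end

(* Take a graph G of dilation below (1 + e^2) pi/2, e = (Lambda - 1)/3, containing all vertices of
   the hexagons around the points of a fine grid.  Every point x of the square off G is then
   enclosed by a short cycle of G; let T be a shortest one.  A shortcut between two points halving T
   would give a shorter enclosing cycle, so all halving pairs of T are far apart.  Splitting the
   arc-length parametrization c(t) into (c(t) - c(t + 1/2))/2, which winds around a disk, and
   (c(t) + c(t + 1/2))/2, whose length is small because the squared lengths of the two parts add up
   to at most the squared length of c, shows that T lies in a thin annulus: the region it bounds
   contains a disk of radius rho and lies in the concentric disk of radius Lambda rho.
   Shortest cycles are minimum cuts of the edges of G, so by sub- and posimodularity of cuts the
   inclusion-minimal ones are pairwise nested or disjoint.  The inner disks of the maximal ones form
   a packing whose enlargements cover the square, contradicting DP(Lambda). *)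

theory Submission
  imports Defs "HOL-Complex_Analysis.Complex_Analysis"
begin

subsection \<open>Length of curves\<close>

text \<open>Graph distances are infima over arbitrary curves in the point set, which may stop inside
  edges and backtrack, while exchange arguments need sets of whole edges with additive weights. Two
  facts bridge the gap: a compact part of the graph that encloses a point still does so after all
  incompletely covered edges are dropped, and paths covering a set of edges are together at least as
  long as these edges. To enclose means to separate from one far point, so that Janiszewski's
  theorem applies. Constants: the six sides of a hexagon of side 1/2 are replaced by paths shorter
  than 1.6 / 2, so shortest cycles weigh at most 4.8 < 6 < 2 pi and their inner disks have radius at
  most 1. A half turn costs at least pi r out of a budget of pi r (1 + \<epsilon>^2); about sqrt 2
  pi \<epsilon> r is left for the second part of the curve, a deviation of at most 1.12 \<epsilon>
  r, and the first part oscillates by at most \<epsilon> r / 2. Both fit under the ratio 1 + 3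
  \<epsilon>, whence the third of \<Lambda> - 1. The bound 1.03 gives \<epsilon> \<le> 1/100, which
  controls the higher powers of \<epsilon>.\<close>

fun plen :: "(real \<Rightarrow> 'a::metric_space) \<Rightarrow> real list \<Rightarrow> real" where
  "plen g [] = 0"
| "plen g [x] = 0"
| "plen g (x # y # zs) = dist (g x) (g y) + plen g (y # zs)"

definition partitions :: "real \<Rightarrow> real \<Rightarrow> real list set" where
  "partitions a b = {ts. sorted ts \<and> set ts \<subseteq> {a..b}}"

text \<open>Real-valued, for ordinary arithmetic; the supremum is meaningful only if the inscribed
  lengths are bounded, hence the Lipschitz hypotheses that accompany \<open>len\<close>.\<close>

definition len :: "(real \<Rightarrow> 'a::metric_space) \<Rightarrow> real \<Rightarrow> real \<Rightarrow> real" where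
  "len g a b = (SUP ts\<in>partitions a b. plen g ts)"

lemma plen_nonneg: "0 \<le> plen g ts"
  by (induction g ts rule: plen.induct) auto

lemma plen_eq_sum: "plen g ts = (\<Sum>i<length ts - 1. dist (g (ts ! i)) (g (ts ! Suc i)))"
proof (induction g ts rule: plen.induct)
  case (3 g x y zs)
  then show ?case
    by (simp add: sum.lessThan_Suc_shift del: sum.lessThan_Suc)
qed auto

lemma plen_append: "plen g (xs @ b # ys) = plen g (xs @ [b]) + plen g (b # ys)"
proof (induction xs)
  case (Cons a xs)
  then show ?case by (cases xs) auto
qed simp

lemma plen_insert_le: "plen g (xs @ ys) \<le> plen g (xs @ b # ys)"
proof (induction xs)
  case Nil
  then show ?case by (cases ys) (auto simp: plen_nonneg)
next
  case (Cons a xs)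
  show ?case
  proof (cases xs)
    case Nil
    show ?thesis
    proof (cases ys)
      case (Cons y zs)
      then show ?thesis using Nil dist_triangle[of "g a" "g y" "g b"] by auto
    qed (use Nil in auto)
  next
    case (Cons c cs)
    then show ?thesis using Cons.IH by auto
  qed
qed

lemma plen_insort:
  assumes "sorted ts" shows "plen g ts \<le> plen g (insort x ts)"
proof -
  have "\<exists>xs ys. ts = xs @ ys \<and> insort x ts = xs @ x # ys"
  proof (induction ts)
    case (Cons a ts)
    show ?case
    proof (cases "x \<le> a")
      case True
      then show ?thesis by (intro exI[of _ "[]"] exI[of _ "a # ts"]) auto
    next
      case False
      then show ?thesis using Cons.IH by (metis append_Cons insort_key.simps(2))
    qed
  qed auto
  then show ?thesis using plen_insert_le by metis
qed

lemma plen_foldr_insort: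
  assumes "sorted ts"
  shows "sorted (foldr insort us ts) \<and> plen g ts \<le> plen g (foldr insort us ts)"
proof (induction us)
  case (Cons u us)
  then show ?case
    using plen_insort[of "foldr insort us ts" g u] by (auto simp: sorted_insort)
qed (use assms in auto)

lemma mset_foldr_insort: "mset (foldr insort us ts) = mset us + mset ts"
  by (induction us) auto

text \<open>Merging the two lists gives the same sorted list whichever is inserted into the other,
  and inserting a point never shortens an inscribed polygon. One refinement thus serves two
  different curves at once, as \<open>len_Pythagoras\<close> requires.\<close>

lemma common_refinement:
  assumes "ts \<in> partitions a b" "us \<in> partitions a b"
  obtains vs where "vs \<in> partitions a b" "\<And>g::real \<Rightarrow> 'a::metric_space. plen g ts \<le> plen g vs"
    "\<And>g::real \<Rightarrow> 'b::metric_space. plen g us \<le> plen g vs"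
proof -
  have s: "sorted ts" "sorted us" using assms by (auto simp: partitions_def)
  have "mset (foldr insort us ts) = mset (foldr insort ts us)"
    by (simp add: mset_foldr_insort)
  then have e: "foldr insort us ts = foldr insort ts us"
    using plen_foldr_insort[OF s(1)] plen_foldr_insort[OF s(2)]
    by (metis properties_for_sort)
  have "set (foldr insort us ts) = set us \<union> set ts"
    by (metis mset_foldr_insort set_mset_mset set_mset_union)
  then have "foldr insort us ts \<in> partitions a b"
    using assms plen_foldr_insort[OF s(1)] by (auto simp: partitions_def)
  then show thesis
    using that plen_foldr_insort[OF s(1)] plen_foldr_insort[OF s(2)] e by metis
qed

lemma plen_map: "plen g (map f ts) = plen (g \<circ> f) ts"
  by (induction ts rule: induct_list012) auto

lemma plen_snoc: "plen g (xs @ [a, b]) = plen g (xs @ [a]) + dist (g a) (g b)"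
  using plen_append[of g xs a "[b]"] by simp

lemma plen_rev: "plen g (rev ts) = plen g ts"
proof (induction g ts rule: plen.induct)
  case (3 g x y zs)
  then show ?case by (simp add: plen_snoc dist_commute)
qed auto

lemma plen_cong: "(\<And>t. t \<in> set ts \<Longrightarrow> g t = h t) \<Longrightarrow> plen g ts = plen h ts"
  by (induction ts rule: induct_list012) auto

lemma plen_le_lipschitz:
  assumes "K-lipschitz_on {a..b} g" "ts \<in> partitions a b" "a \<le> b"
  shows "plen g ts \<le> K * (b - a)"
proof -
  have K: "0 \<le> K" using assms(1) lipschitz_on_nonneg by blast
  have "sorted ts \<Longrightarrow> set ts \<subseteq> {a..b} \<Longrightarrow> plen g ts \<le> K * (b - (if ts = [] then a else hd ts))"
  proof (induction ts rule: induct_list012)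
    case (3 x y zs)
    have "dist (g x) (g y) \<le> K * (y - x)"
      using lipschitz_onD[OF assms(1), of x y] 3(3,4) by (auto simp: dist_real_def)
    then show ?case using 3 by (auto simp: algebra_simps)
  qed (use K assms(3) in auto)
  moreover have "K * (b - (if ts = [] then a else hd ts)) \<le> K * (b - a)"
    using K assms(2) by (intro mult_left_mono) (cases ts; auto simp: partitions_def)+
  ultimately show ?thesis using assms(2) by (auto simp: partitions_def)
qed

lemma bdd_above_plen:
  assumes "K-lipschitz_on {a..b} g" "a \<le> b"
  shows "bdd_above (plen g ` partitions a b)"
  using plen_le_lipschitz[OF assms(1) _ assms(2)] by (meson bdd_aboveI2)

lemma plen_le_len:
  assumes "K-lipschitz_on {a..b} g" "a \<le> b" "ts \<in> partitions a b"
  shows "plen g ts \<le> len g a b"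
  unfolding len_def using assms by (intro cSUP_upper bdd_above_plen)

lemma partitions_Nil [simp]: "[] \<in> partitions a b"
  by (simp add: partitions_def)

lemma len_leI: "(\<And>ts. ts \<in> partitions a b \<Longrightarrow> plen g ts \<le> m) \<Longrightarrow> len g a b \<le> m"
  unfolding len_def using partitions_Nil by (intro cSUP_least) blast+

lemma len_le_lipschitz:
  assumes "K-lipschitz_on {a..b} g" "a \<le> b"
  shows "len g a b \<le> K * (b - a)"
  using assms by (intro len_leI plen_le_lipschitz)

lemma dist_le_len:
  assumes "K-lipschitz_on {a..b} g" "a \<le> b"
  shows "dist (g a) (g b) \<le> len g a b"
  using plen_le_len[OF assms, of "[a, b]"] assms by (auto simp: partitions_def)

lemma len_nonneg:
  assumes "K-lipschitz_on {a..b} g" "a \<le> b"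
  shows "0 \<le> len g a b"
  using dist_le_len[OF assms] zero_le_dist order_trans by blast

text \<open>Splitting a partition at \<open>b\<close> inserts \<open>b\<close>, which only lengthens
  the polygon; conversely, partitions of the two parts concatenate through \<open>b\<close>.\<close>

lemma len_add:
  assumes "K-lipschitz_on {a..c} g" "a \<le> b" "b \<le> c"
  shows "len g a c = len g a b + len g b c"
proof (rule antisym)
  have l: "K-lipschitz_on {a..b} g" "K-lipschitz_on {b..c} g"
    using assms by (auto intro: lipschitz_on_subset)
  show "len g a c \<le> len g a b + len g b c"
  proof (rule len_leI)
    fix ts assume ts: "ts \<in> partitions a c"
    define xs ys where "xs = takeWhile (\<lambda>t. t \<le> b) ts" and "ys = dropWhile (\<lambda>t. t \<le> b) ts"
    have e: "ts = xs @ ys" by (simp add: xs_def ys_def)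
    have "sorted xs" "sorted ys" "set xs \<subseteq> {a..c}" "set ys \<subseteq> {a..c}"
      using ts e by (auto simp: partitions_def sorted_append)
    moreover have "\<forall>t\<in>set xs. t \<le> b" unfolding xs_def by (meson set_takeWhileD)
    moreover have "\<forall>t\<in>set ys. b \<le> t"
    proof (cases ys)
      case (Cons y zs)
      then have "\<not> y \<le> b" unfolding ys_def by (metis dropWhile_eq_Cons_conv)
      then show ?thesis using Cons \<open>sorted ys\<close> by auto
    qed auto
    ultimately have "xs @ [b] \<in> partitions a b" "b # ys \<in> partitions b c"
      using assms by (auto simp: partitions_def sorted_append)
    then have "plen g (xs @ [b]) \<le> len g a b" "plen g (b # ys) \<le> len g b c"
      using plen_le_len l assms by blast+
    then show "plen g ts \<le> len g a b + len g b c"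
      using plen_insert_le[of g xs ys b] plen_append[of g xs b ys] e by simp
  qed
  have "plen g xs + plen g ys \<le> len g a c"
    if "xs \<in> partitions a b" "ys \<in> partitions b c" for xs ys
  proof -
    have "xs @ b # ys \<in> partitions a c"
      using that assms by (force simp: partitions_def sorted_append)
    then have "plen g (xs @ b # ys) \<le> len g a c"
      using plen_le_len[OF assms(1)] assms by auto
    moreover have "plen g xs \<le> plen g (xs @ [b])" "plen g ys \<le> plen g (b # ys)"
      using plen_insert_le[of g xs "[]" b] plen_insert_le[of g "[]" ys b] by auto
    ultimately show ?thesis using plen_append[of g xs b ys] by simp
  qed
  then have "len g a b \<le> len g a c - plen g ys" if "ys \<in> partitions b c" for ys
    using that by (intro len_leI) (simp add: algebra_simps)
  then have "len g b c \<le> len g a c - len g a b"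
    by (intro len_leI) (simp add: algebra_simps)
  then show "len g a b + len g b c \<le> len g a c" by simp
qed

text \<open>A monotone map sends partitions to partitions, even if it is neither continuous nor
  onto.\<close>

lemma len_comp_le:
  assumes "K-lipschitz_on {c..d} h" "c \<le> d"
    and "\<And>t. t \<in> {a..b} \<Longrightarrow> g t = h (\<phi> t)" "\<And>t. t \<in> {a..b} \<Longrightarrow> \<phi> t \<in> {c..d}"
    and "mono_on {a..b} \<phi>"
  shows "len g a b \<le> len h c d"
proof (rule len_leI)
  fix ts assume ts: "ts \<in> partitions a b"
  have "sorted (map \<phi> ts)"
    using ts assms(5) unfolding partitions_def sorted_wrt_map
    by (auto simp: monotone_on_def intro!: sorted_wrt_mono_rel[of ts "(\<le>)"] elim!: subsetD)
  then have "map \<phi> ts \<in> partitions c d"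
    using ts assms(4) by (auto simp: partitions_def)
  then have "plen h (map \<phi> ts) \<le> len h c d"
    using plen_le_len assms by blast
  moreover have "plen h (map \<phi> ts) = plen g ts"
    unfolding plen_map using ts assms(3) by (intro plen_cong) (auto simp: partitions_def)
  ultimately show "plen g ts \<le> len h c d" by simp
qed

lemma plen_le_curve_length:
  assumes "ts \<in> partitions 0 1"
  shows "ennreal (plen g ts) \<le> curve_length g"
proof -
  have "ennreal (plen g ts) = (\<Sum>i<length ts - 1. ennreal (dist (g (ts ! i)) (g (ts ! Suc i))))"
    by (simp add: plen_eq_sum sum_ennreal)
  then show ?thesis
    unfolding curve_length_def using assms by (auto simp: partitions_def intro!: SUP_upper2[of ts])
qed

lemma curve_length_leI:
  assumes "\<And>ts. ts \<in> partitions 0 1 \<Longrightarrow> ennreal (plen g ts) \<le> m"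
  shows "curve_length g \<le> m"
  unfolding curve_length_def using assms
  by (intro SUP_least) (auto simp: partitions_def plen_eq_sum sum_ennreal)

lemma curve_length_lipschitz:
  assumes "K-lipschitz_on {0..1} g"
  shows "curve_length g = ennreal (len g 0 1)"
proof (rule antisym)
  show "curve_length g \<le> ennreal (len g 0 1)"
    using plen_le_len[OF assms] by (intro curve_length_leI ennreal_leI) auto
  show "ennreal (len g 0 1) \<le> curve_length g"
  proof (cases "curve_length g")
    case (real r)
    then have "plen g ts \<le> r" if "ts \<in> partitions 0 1" for ts
      using plen_le_curve_length[OF that, of g] by (auto simp: ennreal_le_iff2)
    then show ?thesis using real by (auto intro!: ennreal_leI len_leI)
  qed auto
qed

lemma curve_length_reversepath: "curve_length (reversepath g) \<le> curve_length g"
proof (rule curve_length_leI)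
  fix ts :: "real list" assume ts: "ts \<in> partitions 0 1"
  define us where "us = rev (map (\<lambda>t. 1 - t) ts)"
  have "sorted us"
    using ts unfolding us_def partitions_def rev_map[symmetric] sorted_wrt_map sorted_wrt_rev
    by (auto simp: sorted_wrt_rev intro!: sorted_wrt_mono_rel[of ts "(\<le>)"])
  then have "us \<in> partitions 0 1" using ts by (auto simp: us_def partitions_def)
  moreover have "plen g us = plen (reversepath g) ts"
    unfolding us_def plen_rev plen_map by (auto simp: reversepath_def comp_def)
  ultimately show "ennreal (plen (reversepath g) ts) \<le> curve_length g"
    using plen_le_curve_length by metis
qed

section \<open>Paths that cover disjoint curves are at least as long in total\<close>

lemma finite_uniform_pos:
  fixes P :: "'a \<Rightarrow> real \<Rightarrow> bool"
  assumes "finite A" "\<And>a. a \<in> A \<Longrightarrow> \<exists>e>0. P a e"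
    and "\<And>a d e. P a e \<Longrightarrow> 0 < d \<Longrightarrow> d \<le> e \<Longrightarrow> P a d"
  shows "\<exists>e>0. \<forall>a\<in>A. P a e"
  using assms(1,2)
proof (induction A)
  case (insert a A)
  then obtain e d where "e > 0" "\<forall>a\<in>A. P a e" "d > 0" "P a d" by (metis insertCI)
  then show ?case
    by (intro exI[of _ "min d e"]) (auto intro: assms(3))
qed (auto intro: exI[of _ 1])

text \<open>Subadditivity of Lebesgue measure; the intervals may overlap in any way.\<close>

lemma interval_cover_le:
  fixes l r :: "'a \<Rightarrow> real"
  assumes "finite M" "\<And>m. m \<in> M \<Longrightarrow> l m \<le> r m" "{A..B} \<subseteq> (\<Union>m\<in>M. {l m..r m})"
  shows "B - A \<le> (\<Sum>m\<in>M. r m - l m)"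
proof (cases "A \<le> B")
  case True
  have "ennreal (B - A) = emeasure lborel {A..B}" using True by simp
  also have "\<dots> \<le> emeasure lborel (\<Union>m\<in>M. {l m..r m})"
    using assms by (intro emeasure_mono) auto
  also have "\<dots> \<le> (\<Sum>m\<in>M. emeasure lborel {l m..r m})"
    using assms by (intro emeasure_subadditive_finite) auto
  also have "\<dots> = ennreal (\<Sum>m\<in>M. r m - l m)"
    using assms by (subst sum_ennreal[symmetric]) auto
  finally show ?thesis
    using assms(2) by (subst (asm) ennreal_le_iff) (auto intro: sum_nonneg)
next
  case False
  then show ?thesis using assms(2) by (smt (verit) sum_nonneg)
qed

lemma piece_subset: "0 < N \<Longrightarrow> k < N \<Longrightarrow> {real k / real N..real (Suc k) / real N} \<subseteq> {0..1}"
  by (auto simp: field_simps)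

lemma compact_piece:
  assumes "path s" "0 < N" "k < N"
  shows "compact (s ` {real k / real N..real (Suc k) / real N})"
  by (intro compact_continuous_image continuous_on_subset[OF _ piece_subset] compact_Icc)
    (use assms in \<open>auto simp: path_def\<close>)

text \<open>Each piece attains its diameter at two parameters. Listed piece by piece, these pairs
  form a single partition.\<close>

lemma sum_diameter_le_curve_length:
  assumes "path s" "0 < N"
  shows "(\<Sum>k<N. ennreal (diameter (s ` {real k / N..real (Suc k) / N}))) \<le> curve_length s"
proof -
  have "\<exists>ts \<in> partitions 0 (real n / N). (\<Sum>k<n. diameter (s ` {real k / N..real (Suc k) / N})) \<le> plen s ts"
    if "n \<le> N" for n
    using that
  proof (induction n)
    case (Suc n)
    then obtain ts where ts: "ts \<in> partitions 0 (real n / N)"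
      "(\<Sum>k<n. diameter (s ` {real k / N..real (Suc k) / N})) \<le> plen s ts" by auto
    let ?I = "{real n / N..real (Suc n) / N}"
    have "compact (s ` ?I)" using compact_piece[OF assms, of n] Suc.prems by simp
    moreover have "s ` ?I \<noteq> {}" using assms(2) by (auto simp: field_simps)
    ultimately obtain x y where "x \<in> ?I" "y \<in> ?I" "dist (s x) (s y) = diameter (s ` ?I)"
      using diameter_compact_attained by blast
    then obtain u v where uv: "u \<in> ?I" "v \<in> ?I" "u \<le> v" "dist (s u) (s v) = diameter (s ` ?I)"
      by (metis dist_commute linear)
    have "plen s (ts @ [u, v]) \<ge> plen s ts + dist (s u) (s v)"
      using plen_insert_le[of s ts "[]" u] plen_snoc[of s ts u v] by simp
    moreover have "ts @ [u, v] \<in> partitions 0 (real (Suc n) / N)"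
    proof -
      have "0 \<le> real n / N" "real n / N \<le> real (Suc n) / N" by (auto simp: divide_right_mono)
      moreover have "sorted ts" and *: "\<And>t. t \<in> set ts \<Longrightarrow> 0 \<le> t \<and> t \<le> real n / N"
        using ts(1) by (auto simp: partitions_def)
      moreover have "t \<le> u" "t \<le> v" "0 \<le> t" "t \<le> real (Suc n) / N" if "t \<in> set ts" for t
        using *[OF that] uv(1-3) unfolding atLeastAtMost_iff by linarith+
      moreover have "0 \<le> u" "0 \<le> v" using uv(1-3) \<open>0 \<le> real n / N\<close> unfolding atLeastAtMost_iff by linarith+
      ultimately show ?thesis using uv(1-3) unfolding partitions_def
        by (auto simp: sorted_append simp del: of_nat_Suc)
    qed
    ultimately show ?case using ts(2) uv(4) by (intro bexI[of _ "ts @ [u, v]"]) auto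
  qed (auto intro: bexI[of _ "[]"])
  from this[of N] obtain ts where "ts \<in> partitions 0 1"
    "(\<Sum>k<N. diameter (s ` {real k / N..real (Suc k) / N})) \<le> plen s ts"
    using assms(2) by auto
  moreover have "(\<Sum>k<N. ennreal (diameter (s ` {real k / N..real (Suc k) / N})))
      = ennreal (\<Sum>k<N. diameter (s ` {real k / N..real (Suc k) / N}))"
    using compact_piece[OF assms] by (intro sum_ennreal diameter_ge_0 compact_imp_bounded) simp
  ultimately show ?thesis
    using order_trans[OF ennreal_leI plen_le_curve_length[of ts s]] by simp
qed

text \<open>The paths are cut into pieces so short that none meets two of the disjoint compact sets,
  so each piece is charged to at most one \<open>F i\<close>. Projecting \<open>F i\<close> to the
  direction from \<open>a i\<close> to \<open>b i\<close> gives an interval of length at least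
  \<open>dist (a i) (b i)\<close>, covered by intervals no longer than the diameters of the pieces
  charged to \<open>F i\<close>.\<close>

lemma sum_dist_le_curve_length_cover:
  fixes s :: "'j \<Rightarrow> real \<Rightarrow> complex" and F :: "'i \<Rightarrow> complex set"
  assumes fin: "finite I" "finite J" and s: "\<And>j. j \<in> J \<Longrightarrow> path (s j)"
    and F: "\<And>i. i \<in> I \<Longrightarrow> connected (F i)" "\<And>i. i \<in> I \<Longrightarrow> compact (F i)"
      "\<And>i. i \<in> I \<Longrightarrow> F i \<subseteq> (\<Union>j\<in>J. path_image (s j))"
      "\<And>i. i \<in> I \<Longrightarrow> a i \<in> F i" "\<And>i. i \<in> I \<Longrightarrow> b i \<in> F i"
      "\<And>i i'. i \<in> I \<Longrightarrow> i' \<in> I \<Longrightarrow> i \<noteq> i' \<Longrightarrow> F i \<inter> F i' = {}"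
  shows "(\<Sum>i\<in>I. ennreal (dist (a i) (b i))) \<le> (\<Sum>j\<in>J. curve_length (s j))"
proof -
  have "\<exists>e>0. \<forall>p\<in>I\<times>I. fst p \<noteq> snd p \<longrightarrow> (\<forall>x\<in>F (fst p). \<forall>y\<in>F (snd p). e \<le> dist x y)"
  proof (rule finite_uniform_pos)
    fix p assume "p \<in> I \<times> I"
    then show "\<exists>e>0. fst p \<noteq> snd p \<longrightarrow> (\<forall>x\<in>F (fst p). \<forall>y\<in>F (snd p). e \<le> dist x y)"
      using separate_compact_closed[of "F (fst p)" "F (snd p)"] F(2,6)
      by (cases "fst p = snd p") (auto simp: compact_imp_closed intro: exI[of _ 1])
  qed (use fin in \<open>auto\<close>, meson order_trans)
  then obtain e where e: "e > 0"
    "\<And>i i' x y. i \<in> I \<Longrightarrow> i' \<in> I \<Longrightarrow> i \<noteq> i' \<Longrightarrow> x \<in> F i \<Longrightarrow> y \<in> F i' \<Longrightarrow> e \<le> dist x y"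
    by force
  have "\<exists>d>0. \<forall>j\<in>J. \<forall>u\<in>{0..1}. \<forall>v\<in>{0..1}. dist u v < d \<longrightarrow> dist (s j u) (s j v) < e"
  proof (rule finite_uniform_pos)
    fix j assume "j \<in> J"
    then have "uniformly_continuous_on {0..1} (s j)"
      using s by (auto simp: path_def intro: compact_uniformly_continuous)
    then show "\<exists>d>0. \<forall>u\<in>{0..1}. \<forall>v\<in>{0..1}. dist u v < d \<longrightarrow> dist (s j u) (s j v) < e"
      using e(1) unfolding uniformly_continuous_on_def by (metis dist_commute)
  qed (use fin in \<open>auto\<close>)
  then obtain d where d: "d > 0"
    "\<And>j u v. j \<in> J \<Longrightarrow> u \<in> {0..1} \<Longrightarrow> v \<in> {0..1} \<Longrightarrow> dist u v < d \<Longrightarrow> dist (s j u) (s j v) < e"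
    by blast
  obtain N where N: "0 < N" "1 / real N < d"
    using d(1) by (metis inverse_eq_divide reals_Archimedean real_arch_inverse of_nat_0_less_iff neq0_conv)
  define piece where "piece = (\<lambda>(j, k). s j ` {real k / N..real (Suc k) / N})"
  define M where "M = J \<times> {..<N}"
  define m where "m i = {p\<in>M. piece p \<inter> F i \<noteq> {}}" for i
  have fM: "finite M" "\<And>i. finite (m i)" using fin by (auto simp: M_def m_def)
  have sub: "{real k / N..real (Suc k) / N} \<subseteq> {0..1}" if "k < N" for k
    using piece_subset N(1) that by blast
  have comp: "compact (piece p)" if p: "p \<in> M" for p
  proof -
    obtain j k where jk: "p = (j, k)" "j \<in> J" "k < N" using p by (auto simp: M_def)
    show ?thesis unfolding piece_def jk(1)
      using compact_piece[OF s[OF jk(2)] N(1) jk(3)] by simp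
  qed
  have near: "dist x y < e" if p: "p \<in> M" and xy: "x \<in> piece p" "y \<in> piece p" for p x y
  proof -
    obtain j k where jk: "p = (j, k)" "j \<in> J" "k < N" using p by (auto simp: M_def)
    obtain u v where uv: "x = s j u" "y = s j v" "u \<in> {real k / N..real (Suc k) / N}" 
      "v \<in> {real k / N..real (Suc k) / N}"
      using xy jk by (auto simp: piece_def)
    have "dist u v \<le> 1 / real N" using uv(3,4) by (auto simp: dist_real_def add_divide_distrib)
    moreover have "u \<in> {0..1}" "v \<in> {0..1}" using uv(3,4) sub[OF jk(3)] by blast+
    ultimately show ?thesis using d(2)[of j u v] uv(1,2) jk(2) N(2) by simp
  qed
  have disj: "m i \<inter> m i' = {}" if "i \<in> I" "i' \<in> I" "i \<noteq> i'" for i i'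
  proof (rule ccontr)
    assume "m i \<inter> m i' \<noteq> {}"
    then obtain p x y where "p \<in> M" "x \<in> piece p" "x \<in> F i" "y \<in> piece p" "y \<in> F i'"
      by (auto simp: m_def)
    then show False using near[of p x y] e(2)[OF that, of x y] by auto
  qed
  have one: "dist (a i) (b i) \<le> (\<Sum>p\<in>m i. diameter (piece p))" if i: "i \<in> I" for i
  proof -
    \<comment> \<open>A unit vector, or 0 if the two points coincide; in both cases the projection
      \<open>f\<close> does not increase distances.\<close>
    define n where "n = sgn (b i - a i)"
    define f where "f z = inner z n" for z
    have cf: "continuous_on S f" for S unfolding f_def by (intro continuous_intros)
    have lip: "\<bar>f z - f w\<bar> \<le> dist z w" for z w
      unfolding f_def inner_diff_left[symmetric] n_def
      using Cauchy_Schwarz_ineq2[of "z - w" "sgn (b i - a i)"]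
      by (auto simp: norm_sgn dist_norm split: if_splits)
    have fab: "f (b i) - f (a i) = dist (a i) (b i)"
    proof -
      have "inner x (sgn x) = norm x" for x :: complex
        by (cases "x = 0") (auto simp: sgn_div_norm dot_square_norm power2_eq_square)
      then show ?thesis unfolding f_def inner_diff_left[symmetric] n_def
        by (simp add: dist_norm norm_minus_commute)
    qed
    have ne: "piece p \<noteq> {}" "p \<in> M" if "p \<in> m i" for p using that by (auto simp: m_def)
    have ex: "\<exists>l r. f ` piece p \<subseteq> {l..r} \<and> l \<le> r \<and> r - l \<le> diameter (piece p)" if pm: "p \<in> m i" for p
    proof -
      obtain x where x: "x \<in> piece p" "\<And>z. z \<in> piece p \<Longrightarrow> f x \<le> f z"
        using continuous_attains_inf[OF comp[OF ne(2)[OF pm]] ne(1)[OF pm] cf] by blast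
      obtain y where y: "y \<in> piece p" "\<And>z. z \<in> piece p \<Longrightarrow> f z \<le> f y"
        using continuous_attains_sup[OF comp[OF ne(2)[OF pm]] ne(1)[OF pm] cf] by blast
      have "f y - f x \<le> dist x y" using lip[of y x] by (simp add: dist_commute)
      also have "\<dots> \<le> diameter (piece p)"
        using diameter_bounded_bound compact_imp_bounded[OF comp[OF ne(2)[OF pm]]] x y by metis
      finally show ?thesis using x y by (intro exI[of _ "f x"] exI[of _ "f y"]) auto
    qed
    then obtain l r where lr: "\<And>p. p \<in> m i \<Longrightarrow> f ` piece p \<subseteq> {l p..r p}"
      "\<And>p. p \<in> m i \<Longrightarrow> l p \<le> r p" "\<And>p. p \<in> m i \<Longrightarrow> r p - l p \<le> diameter (piece p)"
      by metis
    have "F i \<subseteq> (\<Union>p\<in>m i. piece p)"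
    proof
      fix z assume z: "z \<in> F i"
      then obtain j t where jt: "j \<in> J" "t \<in> {0..1}" "z = s j t" using F(3)[OF i] by (auto simp: path_image_def)
      have "\<exists>k<N. t \<in> {real k / N..real (Suc k) / N}"
      proof (cases "t = 1")
        case True
        then show ?thesis using N(1) by (intro exI[of _ "N - 1"]) (auto simp: field_simps of_nat_diff)
      next
        case False
        define k where "k = nat \<lfloor>t * N\<rfloor>"
        have k: "real k \<le> t * N" "t * N < real k + 1" unfolding k_def using jt(2) by auto
        then have "real k < N" using False jt(2) N(1) 
          by (smt (verit) atLeastAtMost_iff mult_less_cancel_right2 of_nat_0_less_iff)
        then show ?thesis using k N(1) by (intro exI[of _ k]) (auto simp: field_simps)
      qed
      then obtain k where "k < N" "t \<in> {real k / N..real (Suc k) / N}" by blast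
      then have "z \<in> piece (j, k)" "(j, k) \<in> M" using jt by (auto simp: piece_def M_def)
      then show "z \<in> (\<Union>p\<in>m i. piece p)" using z by (auto simp: m_def)
    qed
    then have "f ` F i \<subseteq> (\<Union>p\<in>m i. {l p..r p})" using lr(1) by blast
    moreover have "{f (a i)..f (b i)} \<subseteq> f ` F i"
    proof -
      have "connected (f ` F i)" using F(1)[OF i] cf by (rule connected_continuous_image[rotated])
      then show ?thesis using F(4,5)[OF i] by (metis connected_contains_Icc imageI)
    qed
    ultimately have "f (b i) - f (a i) \<le> (\<Sum>p\<in>m i. r p - l p)"
      using lr(2) fM by (intro interval_cover_le) auto
    also have "\<dots> \<le> (\<Sum>p\<in>m i. diameter (piece p))" by (intro sum_mono lr(3))
    finally show ?thesis using fab by simp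
  qed
  have dnn: "0 \<le> diameter (piece p)" if "p \<in> M" for p
    using comp[OF that] by (simp add: compact_imp_bounded diameter_ge_0)
  have "(\<Sum>i\<in>I. ennreal (dist (a i) (b i))) = ennreal (\<Sum>i\<in>I. dist (a i) (b i))"
    by (simp add: sum_ennreal)
  also have "\<dots> \<le> ennreal (\<Sum>i\<in>I. \<Sum>p\<in>m i. diameter (piece p))"
    using one by (intro ennreal_leI sum_mono)
  also have "(\<Sum>i\<in>I. \<Sum>p\<in>m i. diameter (piece p)) = (\<Sum>p\<in>(\<Union>i\<in>I. m i). diameter (piece p))"
    using fin fM disj by (intro sum.UNION_disjoint[symmetric]) auto
  also have "\<dots> \<le> (\<Sum>p\<in>M. diameter (piece p))"
    using fM dnn by (intro sum_mono2) (auto simp: m_def)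
  also have "ennreal (\<Sum>p\<in>M. diameter (piece p)) = (\<Sum>p\<in>M. ennreal (diameter (piece p)))"
    using dnn by (simp add: sum_ennreal)
  also have "\<dots> = (\<Sum>j\<in>J. \<Sum>k<N. ennreal (diameter (s j ` {real k / N..real (Suc k) / N})))"
    unfolding M_def sum.cartesian_product by (intro sum.cong) (auto simp: piece_def)
  also have "\<dots> \<le> (\<Sum>j\<in>J. curve_length (s j))"
    using s N(1) by (intro sum_mono sum_diameter_le_curve_length)
  finally show ?thesis by (simp add: ennreal_leI)
qed

lemma simple_path_eqD:
  assumes "simple_path g" "g u = g v" "u \<in> {0..1}" "v \<in> {0..1}"
  shows "u = v \<or> u = 0 \<and> v = 1 \<or> u = 1 \<and> v = 0"
  using assms unfolding simple_path_def loop_free_def by blast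

lemma simple_path_inj_on_open: "simple_path g \<Longrightarrow> inj_on g {0<..<1}"
proof (rule inj_onI)
  fix u v :: real assume "simple_path g" "u \<in> {0<..<1}" "v \<in> {0<..<1}" "g u = g v"
  then show "u = v" using simple_path_eqD[of g u v] by auto
qed

text \<open>Consecutive subarcs of a partition share endpoints, and so may different curves, whereas
  the covering estimate wants disjoint sets. Each subarc is therefore shortened by a fraction \<eta>
  at both ends; then \<eta> tends to 0.\<close>

lemma sum_len_le_curve_length_cover:
  fixes s :: "'j \<Rightarrow> real \<Rightarrow> complex" and g :: "'i \<Rightarrow> real \<Rightarrow> complex"
  assumes fin: "finite I" "finite J" and s: "\<And>j. j \<in> J \<Longrightarrow> path (s j)"
    and g: "\<And>i. i \<in> I \<Longrightarrow> simple_path (g i)" "\<And>i. i \<in> I \<Longrightarrow> (K i)-lipschitz_on {0..1} (g i)"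
      "\<And>i. i \<in> I \<Longrightarrow> path_image (g i) \<subseteq> (\<Union>j\<in>J. path_image (s j))"
      "\<And>i i'. i \<in> I \<Longrightarrow> i' \<in> I \<Longrightarrow> i \<noteq> i' \<Longrightarrow> g i ` {0<..<1} \<inter> g i' ` {0<..<1} = {}"
  shows "ennreal (\<Sum>i\<in>I. len (g i) 0 1) \<le> (\<Sum>j\<in>J. curve_length (s j))"
proof (cases "\<Sum>j\<in>J. curve_length (s j)")
  case (real R)
  have part: "(\<Sum>i\<in>I. plen (g i) (ts i)) \<le> R" if ts: "\<And>i. i \<in> I \<Longrightarrow> ts i \<in> partitions 0 1" for ts
  proof -
    \<comment> \<open>Steps between equal partition points contribute length 0 and are left out,
      because the shortened subarcs are separated by strict inequalities.\<close>
    define Q where "Q = (SIGMA i:I. {k. Suc k < length (ts i) \<and> ts i ! k < ts i ! Suc k})"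
    define l where "l \<eta> = (\<lambda>(i, k). ts i ! k + \<eta> * (ts i ! Suc k - ts i ! k))" for \<eta>
    define r where "r \<eta> = (\<lambda>(i, k). ts i ! Suc k - \<eta> * (ts i ! Suc k - ts i ! k))" for \<eta>
    have fk: "finite {k. Suc k < length (ts i) \<and> ts i ! k < ts i ! Suc k}" for i
      by (rule finite_subset[of _ "{..<length (ts i)}"]) auto
    have fQ: "finite Q" unfolding Q_def using fin(1) fk by (rule finite_SigmaI)
    have tsk: "ts i ! k \<in> {0..1}" if "i \<in> I" "k < length (ts i)" for i k
      using ts[OF that(1)] that(2) unfolding partitions_def by (metis (no_types, lifting) mem_Collect_eq nth_mem subsetD)
    have main: "(\<Sum>q\<in>Q. dist (g (fst q) (l \<eta> q)) (g (fst q) (r \<eta> q))) \<le> R" if \<eta>: "0 < \<eta>" "\<eta> < 1/2" for \<eta>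
    proof -
      have lr: "ts i ! k < l \<eta> (i, k)" "l \<eta> (i, k) \<le> r \<eta> (i, k)" "r \<eta> (i, k) < ts i ! Suc k" if "(i, k) \<in> Q" for i k
      proof -
        have d: "ts i ! Suc k - ts i ! k > 0" using that by (auto simp: Q_def)
        have "\<eta> * (ts i ! Suc k - ts i ! k) > 0" using d \<eta>(1) by (rule mult_pos_pos[rotated])
        moreover have "\<eta> * (ts i ! Suc k - ts i ! k) < 1/2 * (ts i ! Suc k - ts i ! k)"
          using \<eta>(2) d by (rule mult_strict_right_mono)
        ultimately show "ts i ! k < l \<eta> (i, k)" "l \<eta> (i, k) \<le> r \<eta> (i, k)" "r \<eta> (i, k) < ts i ! Suc k"
          using d by (auto simp: l_def r_def field_simps)
      qed
      have sub: "{l \<eta> q..r \<eta> q} \<subseteq> {0<..<1}" if "q \<in> Q" for q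
      proof -
        obtain i k where q: "q = (i, k)" by (cases q)
        then have "ts i ! k \<in> {0..1}" "ts i ! Suc k \<in> {0..1}"
          using that tsk[of i k] tsk[of i "Suc k"] by (auto simp: Q_def)
        then show ?thesis using lr[of i k] that q by auto
      qed
      have "(\<Sum>q\<in>Q. ennreal (dist (g (fst q) (l \<eta> q)) (g (fst q) (r \<eta> q)))) \<le> (\<Sum>j\<in>J. curve_length (s j))"
      proof (rule sum_dist_le_curve_length_cover[where F = "\<lambda>q. g (fst q) ` {l \<eta> q..r \<eta> q}", OF fQ fin(2) s])
        fix q assume q: "q \<in> Q"
        then have i: "fst q \<in> I" by (auto simp: Q_def)
        have "path (g (fst q))" using g(1)[OF i] by (rule simple_path_imp_path)
        then have "continuous_on {l \<eta> q..r \<eta> q} (g (fst q))"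
          unfolding path_def using sub[OF q] by (elim continuous_on_subset) (auto simp: subset_iff)
        then show "connected (g (fst q) ` {l \<eta> q..r \<eta> q})" "compact (g (fst q) ` {l \<eta> q..r \<eta> q})"
          by (auto intro: connected_continuous_image compact_continuous_image)
        have "g (fst q) ` {l \<eta> q..r \<eta> q} \<subseteq> path_image (g (fst q))"
          using sub[OF q] unfolding path_image_def by (intro image_mono) (auto simp: subset_iff)
        then show "g (fst q) ` {l \<eta> q..r \<eta> q} \<subseteq> (\<Union>j\<in>J. path_image (s j))" using g(3)[OF i] by blast
        show "g (fst q) (l \<eta> q) \<in> g (fst q) ` {l \<eta> q..r \<eta> q}" "g (fst q) (r \<eta> q) \<in> g (fst q) ` {l \<eta> q..r \<eta> q}"
          using lr[of "fst q" "snd q"] q by auto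
      next
        fix q q' assume q: "q \<in> Q" "q' \<in> Q" "q \<noteq> q'"
        obtain i k i' k' where ik: "q = (i, k)" "q' = (i', k')" by (cases q, cases q')
        then have i: "i \<in> I" "i' \<in> I" using q by (auto simp: Q_def)
        show "g (fst q) ` {l \<eta> q..r \<eta> q} \<inter> g (fst q') ` {l \<eta> q'..r \<eta> q'} = {}"
        proof (cases "i = i'")
          case False
          then have "g i ` {0<..<1} \<inter> g i' ` {0<..<1} = {}" using g(4) i by blast
          then show ?thesis using image_mono[OF sub[OF q(1)], of "g i"] image_mono[OF sub[OF q(2)], of "g i'"]
            unfolding ik fst_conv by blast
        next
          case True
          have srt: "ts i ! Suc m \<le> ts i ! m'" if "m < m'" "m' < length (ts i)" for m m'
            using ts[OF i(1)] that by (auto simp: partitions_def intro: sorted_nth_mono)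
          have "k < k' \<or> k' < k" using q(3) ik True by auto
          then have "{l \<eta> q..r \<eta> q} \<inter> {l \<eta> q'..r \<eta> q'} = {}"
          proof
            assume "k < k'"
            then show ?thesis using srt[of k k'] lr[of i k] lr[of i' k'] q ik True by (auto simp: Q_def)
          next
            assume "k' < k"
            then show ?thesis using srt[of k' k] lr[of i k] lr[of i' k'] q ik True by (auto simp: Q_def)
          qed
          moreover have "inj_on (g i) {0<..<1}"
            using g(1)[OF i(1)] by (rule simple_path_inj_on_open)
          ultimately show ?thesis using sub[OF q(1)] sub[OF q(2)] ik True
            by (simp add: inj_on_image_Int[symmetric])
        qed
      qed
      then show ?thesis using real by (simp add: sum_ennreal sum_nonneg ennreal_le_iff2) (smt (verit) sum_nonneg zero_le_dist)
    qed
    have "((\<lambda>\<eta>. \<Sum>q\<in>Q. dist (g (fst q) (l \<eta> q)) (g (fst q) (r \<eta> q))) \<longlongrightarrow> (\<Sum>q\<in>Q. dist (g (fst q) (l 0 q)) (g (fst q) (r 0 q)))) (at_right 0)"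
    proof (intro tendsto_sum tendsto_dist)
      fix q assume q: "q \<in> Q"
      obtain i k where ik: "q = (i, k)" "i \<in> I" using q by (auto simp: Q_def)
      have t: "0 \<le> ts i ! k" "ts i ! k < ts i ! Suc k" "ts i ! Suc k \<le> 1"
        using q ik tsk[of i k] tsk[of i "Suc k"] by (auto simp: Q_def)
      have cg: "continuous_on {0..1} (g i)" using g(1)[OF ik(2)] by (auto simp: simple_path_def path_def)
      have im: "l \<eta> q \<in> {0..1} \<and> r \<eta> q \<in> {0..1}" if "\<eta> \<in> {0..1}" for \<eta>
      proof -
        have "0 \<le> \<eta> * (ts i ! Suc k - ts i ! k)" "\<eta> * (ts i ! Suc k - ts i ! k) \<le> ts i ! Suc k - ts i ! k"
          using that t by (auto intro: mult_left_le_one_le)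
        then show ?thesis using t unfolding ik l_def r_def prod.case atLeastAtMost_iff by linarith
      qed
      have "continuous_on {0..1} (\<lambda>\<eta>. l \<eta> q)" "continuous_on {0..1} (\<lambda>\<eta>. r \<eta> q)"
        unfolding ik l_def r_def by (auto intro!: continuous_intros)
      note cl = this
      have im': "(\<lambda>\<eta>. l \<eta> q) ` {0..1} \<subseteq> {0..1}" "(\<lambda>\<eta>. r \<eta> q) ` {0..1} \<subseteq> {0..1}"
        using im by blast+
      have "continuous_on {0..1} (\<lambda>\<eta>. g i (l \<eta> q))" "continuous_on {0..1} (\<lambda>\<eta>. g i (r \<eta> q))"
        by (rule continuous_on_compose2[OF cg cl(1) im'(1)], rule continuous_on_compose2[OF cg cl(2) im'(2)])
      note this[THEN continuous_on_Icc_at_rightD, OF zero_less_one]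
      then show "((\<lambda>\<eta>. g (fst q) (l \<eta> q)) \<longlongrightarrow> g (fst q) (l 0 q)) (at_right 0)"
        "((\<lambda>\<eta>. g (fst q) (r \<eta> q)) \<longlongrightarrow> g (fst q) (r 0 q)) (at_right 0)" by (simp_all add: ik)
    qed
    moreover have "\<forall>\<^sub>F \<eta> in at_right 0. (\<Sum>q\<in>Q. dist (g (fst q) (l \<eta> q)) (g (fst q) (r \<eta> q))) \<le> R"
      using main by (intro eventually_at_rightI[of 0 "1/2"]) auto
    ultimately have "(\<Sum>q\<in>Q. dist (g (fst q) (l 0 q)) (g (fst q) (r 0 q))) \<le> R"
      by (intro tendsto_upperbound) auto
    moreover have "(\<Sum>q\<in>Q. dist (g (fst q) (l 0 q)) (g (fst q) (r 0 q))) = (\<Sum>i\<in>I. plen (g i) (ts i))"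
    proof -
      have "(\<Sum>q\<in>Q. dist (g (fst q) (l 0 q)) (g (fst q) (r 0 q)))
          = (\<Sum>(i, k)\<in>Q. dist (g i (ts i ! k)) (g i (ts i ! Suc k)))"
        by (intro sum.cong) (auto simp: l_def r_def)
      also have "\<dots> = (\<Sum>i\<in>I. \<Sum>k | Suc k < length (ts i) \<and> ts i ! k < ts i ! Suc k. dist (g i (ts i ! k)) (g i (ts i ! Suc k)))"
        unfolding Q_def using fin(1) fk by (intro sum.Sigma[symmetric]) auto
      also have "\<dots> = (\<Sum>i\<in>I. \<Sum>k<length (ts i) - 1. dist (g i (ts i ! k)) (g i (ts i ! Suc k)))"
      proof (rule sum.cong[OF refl], rule sum.mono_neutral_left)
        fix i assume i: "i \<in> I"
        show "\<forall>k\<in>{..<length (ts i) - 1} - {k. Suc k < length (ts i) \<and> ts i ! k < ts i ! Suc k}.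
            dist (g i (ts i ! k)) (g i (ts i ! Suc k)) = 0"
        proof
          fix k assume k: "k \<in> {..<length (ts i) - 1} - {k. Suc k < length (ts i) \<and> ts i ! k < ts i ! Suc k}"
          then have "ts i ! k \<le> ts i ! Suc k" using ts[OF i] by (auto simp: partitions_def intro: sorted_nth_mono)
          then have "ts i ! k = ts i ! Suc k" using k by auto
          then show "dist (g i (ts i ! k)) (g i (ts i ! Suc k)) = 0" by simp
        qed
      qed auto
      finally show ?thesis by (simp add: plen_eq_sum)
    qed
    ultimately show ?thesis by simp
  qed
  have "(\<Sum>i\<in>I. len (g i) 0 1) \<le> R + e" if e: "0 < e" for e
  proof -
    define e' where "e' = e / (1 + card I)"
    have e': "0 < e'" using e by (simp add: e'_def)
    have "\<exists>ts\<in>partitions 0 1. len (g i) 0 1 - e' < plen (g i) ts" for i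
    proof (rule ccontr)
      assume "\<not> ?thesis"
      then have "len (g i) 0 1 \<le> len (g i) 0 1 - e'" by (intro len_leI) (auto simp: not_less)
      then show False using e' by simp
    qed
    then obtain ts where ts: "\<And>i. ts i \<in> partitions 0 1" "\<And>i. len (g i) 0 1 - e' < plen (g i) (ts i)" by metis
    have "(\<Sum>i\<in>I. len (g i) 0 1) \<le> (\<Sum>i\<in>I. plen (g i) (ts i) + e')"
      using ts(2) by (intro sum_mono) (smt (verit))
    also have "\<dots> \<le> R + card I * e'" using part[of ts] ts(1) by (simp add: sum.distrib)
    also have "card I * e' \<le> e" using e by (simp add: e'_def field_simps)
    finally show ?thesis by simp
  qed
  then have "(\<Sum>i\<in>I. len (g i) 0 1) \<le> R" by (rule field_le_epsilon)
  then show ?thesis using real by (simp add: ennreal_leI)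
qed simp

section \<open>Lipschitz parametrizations: joining, reversal and constant speed\<close>

lemma lipschitz_on_affine:
  fixes g :: "real \<Rightarrow> complex"
  assumes "K-lipschitz_on T g" "\<And>t. t \<in> S \<Longrightarrow> m * t + c \<in> T"
  shows "(K * \<bar>m\<bar>)-lipschitz_on S (\<lambda>t. g (m * t + c))"
proof (rule lipschitz_onI)
  fix x y assume "x \<in> S" "y \<in> S"
  then have "dist (g (m * x + c)) (g (m * y + c)) \<le> K * dist (m * x + c) (m * y + c)"
    using assms by (intro lipschitz_onD) auto
  also have "dist (m * x + c) (m * y + c) = \<bar>m\<bar> * dist x y"
    by (simp add: dist_real_def flip: abs_mult right_diff_distrib)
  finally show "dist (g (m * x + c)) (g (m * y + c)) \<le> K * \<bar>m\<bar> * dist x y" by (simp add: mult.assoc)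
qed (use assms(1) lipschitz_on_nonneg in fastforce)

lemma lipschitz_reversepath:
  fixes g :: "real \<Rightarrow> complex"
  assumes "K-lipschitz_on {0..1} g" shows "K-lipschitz_on {0..1} (reversepath g)"
  using lipschitz_on_affine[OF assms, of "{0..1}" "-1" 1] by (simp add: reversepath_def)

lemma lipschitz_join:
  fixes g h :: "real \<Rightarrow> complex"
  assumes "K-lipschitz_on {0..1} g" "L-lipschitz_on {0..1} h" "pathfinish g = pathstart h"
  shows "(max (K * 2) (L * 2))-lipschitz_on {0..1} (g +++ h)"
proof -
  have "(K * 2)-lipschitz_on {0..1/2} (\<lambda>t. g (2 * t))"
    using lipschitz_on_affine[OF assms(1), of "{0..1/2}" 2 0] by simp
  moreover have "(L * 2)-lipschitz_on {1/2..1} (\<lambda>t. h (2 * t - 1))"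
    using lipschitz_on_affine[OF assms(2), of "{1/2..1}" 2 "-1"] by simp
  ultimately have "(max (K * 2) (L * 2))-lipschitz_on {0..1} (\<lambda>t. if t \<le> 1/2 then g (2 * t) else h (2 * t - 1))"
    using assms(3) by (intro lipschitz_on_concat_max) (auto simp: pathfinish_def pathstart_def)
  then show ?thesis by (simp add: joinpaths_def)
qed

lemma len_join_le:
  fixes g h :: "real \<Rightarrow> complex"
  assumes "K-lipschitz_on {0..1} g" "L-lipschitz_on {0..1} h" "pathfinish g = pathstart h"
  shows "len (g +++ h) 0 1 \<le> len g 0 1 + len h 0 1"
proof -
  have "len (g +++ h) 0 1 = len (g +++ h) 0 (1/2) + len (g +++ h) (1/2) 1"
    using len_add[OF lipschitz_join[OF assms], of "1/2"] by simp
  moreover have "len (g +++ h) 0 (1/2) \<le> len g 0 1"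
    by (rule len_comp_le[OF assms(1), where \<phi> = "\<lambda>t. t * 2"]) (auto simp: joinpaths_def monotone_on_def mult.commute)
  moreover have "len (g +++ h) (1/2) 1 \<le> len h 0 1"
  proof (rule len_comp_le[OF assms(2), where \<phi> = "\<lambda>t. 2 * t - 1"])
    fix t :: real assume "t \<in> {1/2..1}"
    then show "(g +++ h) t = h (2 * t - 1)"
    proof (cases "t = 1/2")
      case True
      show ?thesis unfolding True using assms(3) by (simp add: joinpaths_def pathfinish_def pathstart_def)
    qed (auto simp: joinpaths_def)
  qed (auto simp: monotone_on_def)
  ultimately show ?thesis by simp
qed

lemma len_reversepath_le:
  fixes g :: "real \<Rightarrow> complex"
  assumes "K-lipschitz_on {0..1} g"
  shows "len (reversepath g) 0 1 \<le> len g 0 1"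
  using curve_length_reversepath[of g] curve_length_lipschitz[OF assms]
    curve_length_lipschitz[OF lipschitz_reversepath[OF assms]] len_nonneg[OF assms]
  by (simp add: ennreal_le_iff)

text \<open>The new parameter is the normalized arc length \<sigma>. Simplicity of \<open>c\<close>
  makes \<sigma> strictly increasing, so it is a homeomorphism of the unit interval, and its inverse
  \<tau> reparametrizes \<open>c\<close>.\<close>

lemma constant_speed:
  fixes c :: "real \<Rightarrow> complex"
  assumes c: "simple_path c" and K: "K-lipschitz_on {0..1} c"
  obtains c' where "simple_path c'" "(len c 0 1)-lipschitz_on {0..1} c'"
    "path_image c' = path_image c" "pathstart c' = pathstart c" "pathfinish c' = pathfinish c"
proof -
  define L where "L = len c 0 1"
  have K0: "0 \<le> K" using K lipschitz_on_nonneg by blast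
  have sub: "K-lipschitz_on {u..v} c" if "0 \<le> u" "v \<le> 1" for u v
    using that by (intro lipschitz_on_subset[OF K]) auto
  have add: "len c 0 v = len c 0 u + len c u v" if "0 \<le> u" "u \<le> v" "v \<le> 1" for u v
    using that by (intro len_add[OF sub]) auto
  have inj: "c u \<noteq> c v" if "0 \<le> u" "u < v" "v \<le> 1" "(u, v) \<noteq> (0, 1)" for u v
  proof
    assume "c u = c v"
    moreover have "u \<in> {0..1}" "v \<in> {0..1}" using that by auto
    ultimately have "u = v \<or> u = 0 \<and> v = 1 \<or> u = 1 \<and> v = 0"
      using c unfolding simple_path_def loop_free_def by blast
    then show False using that by auto
  qed
  have pos': "0 < len c u v" if "0 \<le> u" "u < v" "v \<le> 1" "(u, v) \<noteq> (0, 1)" for u v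
    using dist_le_len[OF sub, of u v] inj[OF that] that by (smt (verit) zero_less_dist_iff)
  \<comment> \<open>If \<open>c\<close> is closed, the chord over the whole interval vanishes; the
    interval is halved to get two proper chords.\<close>
  have pos: "0 < len c u v" if "0 \<le> u" "u < v" "v \<le> 1" for u v
  proof (cases "(u, v) = (0, 1)")
    case True
    then show ?thesis using add[of "1/2" 1] pos'[of 0 "1/2"] pos'[of "1/2" 1] by simp
  qed (use pos' that in auto)
  have L: "0 < L" unfolding L_def by (rule pos) auto
  have zero: "len c 0 0 = 0"
    using len_le_lipschitz[OF sub, of 0 0] len_nonneg[OF sub, of 0 0] by simp
  define \<sigma> where "\<sigma> t = len c 0 t / L" for t
  have mono: "\<sigma> u < \<sigma> v" if "0 \<le> u" "u < v" "v \<le> 1" for u v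
    using add[of u v] pos[of u v] that L by (simp add: \<sigma>_def divide_strict_right_mono)
  have inj\<sigma>: "inj_on \<sigma> {0..1}" using mono by (intro linorder_inj_onI) fastforce+
  have lip\<sigma>: "(K / L)-lipschitz_on {0..1} \<sigma>"
  proof (rule lipschitz_on_leI)
    fix u v :: real assume uv: "u \<in> {0..1}" "v \<in> {0..1}" "u \<le> v"
    then have "\<sigma> v - \<sigma> u = len c u v / L" using add[of u v] by (simp add: \<sigma>_def add_divide_distrib)
    moreover have "len c u v \<le> K * (v - u)" "0 \<le> len c u v"
      using uv by (auto intro!: len_le_lipschitz len_nonneg sub)
    ultimately show "dist (\<sigma> u) (\<sigma> v) \<le> K / L * dist u v"
      using L uv by (auto simp: dist_real_def field_simps abs_if)
  qed (use K0 L in auto)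
  have cont: "continuous_on {0..1} \<sigma>" using lip\<sigma> by (rule lipschitz_on_continuous_on)
  have ends: "\<sigma> 0 = 0" "\<sigma> 1 = 1" using L zero by (auto simp: \<sigma>_def L_def)
  have "\<sigma> ` {0..1} = {0..1}"
  proof
    show "\<sigma> ` {0..1} \<subseteq> {0..1}"
    proof
      fix y assume "y \<in> \<sigma> ` {0..1}"
      then obtain t where t: "0 \<le> t" "t \<le> 1" "y = \<sigma> t" by auto
      then show "y \<in> {0..1}" using mono[of 0 t] mono[of t 1] ends by (cases "t = 0"; cases "t = 1") auto
    qed
    show "{0..1} \<subseteq> \<sigma> ` {0..1}"
    proof
      fix y :: real assume "y \<in> {0..1}"
      then show "y \<in> \<sigma> ` {0..1}" using IVT'[of \<sigma> 0 y 1] ends cont by force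
    qed
  qed
  then obtain \<tau> where \<tau>: "homeomorphism {0..1} {0..1} \<sigma> \<tau>"
    using homeomorphism_compact[OF compact_Icc cont _ inj\<sigma>] by blast
  have \<tau>in: "\<tau> t \<in> {0..1}" if "t \<in> {0..1}" for t using \<tau> that by (auto simp: homeomorphism_def)
  have \<sigma>\<tau>: "\<sigma> (\<tau> t) = t" if "t \<in> {0..1}" for t using \<tau> that by (auto simp: homeomorphism_def)
  have \<tau>\<sigma>: "\<tau> (\<sigma> t) = t" if "t \<in> {0..1}" for t using \<tau> that by (auto simp: homeomorphism_def)
  have \<tau>ends: "\<tau> 0 = 0" "\<tau> 1 = 1" using \<tau>\<sigma>[of 0] \<tau>\<sigma>[of 1] ends by auto
  have \<tau>mono: "\<tau> u \<le> \<tau> v" if "u \<in> {0..1}" "v \<in> {0..1}" "u \<le> v" for u v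
    using mono[of "\<tau> v" "\<tau> u"] \<tau>in[of u] \<tau>in[of v] \<sigma>\<tau> that by (auto simp: not_le[symmetric])
  have pc: "path c" using c by (rule simple_path_imp_path)
  show thesis
  proof (rule that[of "c \<circ> \<tau>"])
    have c\<tau>: "continuous_on {0..1} \<tau>" "\<tau> ` {0..1} = {0..1}" using \<tau> by (auto simp: homeomorphism_def)
    show im: "path_image (c \<circ> \<tau>) = path_image c"
      unfolding path_image_def image_comp[symmetric] c\<tau>(2) ..
    show "pathstart (c \<circ> \<tau>) = pathstart c" "pathfinish (c \<circ> \<tau>) = pathfinish c"
      by (auto simp: pathstart_def pathfinish_def \<tau>ends)
    have "path (c \<circ> \<tau>)" unfolding path_def
      using pc c\<tau> by (intro continuous_on_compose) (auto simp: path_def)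
    moreover have "loop_free (c \<circ> \<tau>)"
      unfolding loop_free_def
    proof (intro ballI impI)
      fix x y :: real assume xy: "x \<in> {0..1}" "y \<in> {0..1}" "(c \<circ> \<tau>) x = (c \<circ> \<tau>) y"
      then have "\<tau> x = \<tau> y \<or> \<tau> x = 0 \<and> \<tau> y = 1 \<or> \<tau> x = 1 \<and> \<tau> y = 0"
        using c \<tau>in unfolding simple_path_def loop_free_def by (metis comp_apply)
      then show "x = y \<or> x = 0 \<and> y = 1 \<or> x = 1 \<and> y = 0"
        using \<sigma>\<tau>[OF xy(1)] \<sigma>\<tau>[OF xy(2)] ends by metis
    qed
    ultimately show "simple_path (c \<circ> \<tau>)" by (simp add: simple_path_def)
    show "(len c 0 1)-lipschitz_on {0..1} (c \<circ> \<tau>)"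
    proof (rule lipschitz_on_leI)
      fix u v :: real assume uv: "u \<in> {0..1}" "v \<in> {0..1}" "u \<le> v"
      then have "dist (c (\<tau> u)) (c (\<tau> v)) \<le> len c (\<tau> u) (\<tau> v)"
        using \<tau>in[of u] \<tau>in[of v] \<tau>mono by (intro dist_le_len[OF sub]) auto
      also have "\<dots> = L * (\<sigma> (\<tau> v) - \<sigma> (\<tau> u))"
        using add[of "\<tau> u" "\<tau> v"] \<tau>in[of u] \<tau>in[of v] \<tau>mono uv L
        by (simp add: \<sigma>_def diff_divide_distrib[symmetric])
      finally show "dist ((c \<circ> \<tau>) u) ((c \<circ> \<tau>) v) \<le> len c 0 1 * dist u v"
        using \<sigma>\<tau> uv by (simp add: L_def dist_real_def)
    qed (use L L_def in auto)
  qed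
qed

text \<open>The derivative is continuous up to the breakpoints, hence bounded on every closed piece.
  This is the form in which smoothness of the edges enters.\<close>

lemma piecewise_C1_lipschitz:
  assumes "piecewise_C1 g"
  obtains K where "K-lipschitz_on {0..1} g"
proof -
  obtain n s where s: "s 0 = 0" "s n = 1" and "\<And>i. i < n \<Longrightarrow> s i < s (Suc i) \<and>
        (\<exists>g'. continuous_on {s i..s (Suc i)} g' \<and>
          (\<forall>t\<in>{s i..s (Suc i)}. (g has_vector_derivative g' t) (at t within {s i..s (Suc i)})))"
    using assms unfolding piecewise_C1_def by blast
  note st = this(3)
  have "\<exists>K. K-lipschitz_on {0..s i} g \<and> 0 \<le> s i" if "i \<le> n" for i
    using that
  proof (induction i)
    case 0
    then show ?case by (intro exI[of _ 0]) (auto simp: s lipschitz_on_def)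
  next
    case (Suc i)
    then obtain K where K: "K-lipschitz_on {0..s i} g" "0 \<le> s i" by auto
    obtain g' where i: "s i < s (Suc i)" and g': "continuous_on {s i..s (Suc i)} g'"
      "\<And>t. t \<in> {s i..s (Suc i)} \<Longrightarrow> (g has_vector_derivative g' t) (at t within {s i..s (Suc i)})"
      using st[of i] Suc.prems by auto
    have "bounded (g' ` {s i..s (Suc i)})"
      using g'(1) by (intro compact_imp_bounded compact_continuous_image) auto
    then obtain B where B: "0 < B" "\<And>t. t \<in> {s i..s (Suc i)} \<Longrightarrow> norm (g' t) \<le> B"
      unfolding bounded_pos by blast
    have "B-lipschitz_on {s i..s (Suc i)} g"
    proof (rule bounded_derivative_imp_lipschitz)
      fix t assume "t \<in> {s i..s (Suc i)}"
      then show "(g has_derivative (\<lambda>x. x *\<^sub>R g' t)) (at t within {s i..s (Suc i)})"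
        using g'(2) by (simp add: has_vector_derivative_def)
      show "onorm (\<lambda>x. x *\<^sub>R g' t) \<le> B"
        using B(2)[OF \<open>t \<in> _\<close>] by (intro onorm_le) (simp add: mult.commute[of B] mult_left_mono)
    qed (use B in auto)
    then have "(max K B)-lipschitz_on {0..s (Suc i)} (\<lambda>x. if x \<le> s i then g x else g x)"
      by (intro lipschitz_on_concat_max K(1)) auto
    then show ?case using K(2) i by (intro exI[of _ "max K B"]) auto
  qed
  from this[of n] s that show thesis by auto
qed

subsection \<open>Closed curves with long halving chords are nearly circular\<close>

lemma sin_ge_cubic: "0 \<le> x \<Longrightarrow> x - x ^ 3 / 6 \<le> sin (x::real)"
proof -
  assume "0 \<le> x"
  then have "\<bar>sin x - x\<bar> \<le> x ^ 3 / 6"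
    using Maclaurin_sin_bound[of x 3] by (simp add: numeral_3_eq_3 sin_coeff_def fact_numeral)
  then show ?thesis by linarith
qed

lemma two_sin_half_squared: "2 * (sin (d / 2))\<^sup>2 = 1 - cos (d::real)"
  using cos_double_sin[of "d / 2"] by simp

text \<open>The law of cosines for the triangle 0, \<open>exp z\<close>, \<open>exp w\<close>,
  written with the half angle so that both summands are visibly nonnegative.\<close>

lemma cmod_exp_diff:
  "(cmod (exp z - exp w))\<^sup>2 = (exp (Re z) - exp (Re w))\<^sup>2 + 4 * exp (Re z) * exp (Re w) * (sin ((Im z - Im w) / 2))\<^sup>2"
proof -
  note two_sin_half_squared[of "Im z - Im w"]
  then have s: "4 * exp (Re z) * exp (Re w) * (sin ((Im z - Im w) / 2))\<^sup>2
     = 2 * exp (Re z) * exp (Re w) * (1 - (cos (Im z) * cos (Im w) + sin (Im z) * sin (Im w)))"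
    by (simp add: cos_diff)
  show ?thesis
    unfolding s cmod_power2 minus_complex.simps Re_exp Im_exp
    by (simp add: power2_diff power_mult_distrib sin_squared_eq) (simp add: algebra_simps)
qed

lemma cmod_exp_diff_ge:
  assumes "0 \<le> r" "r \<le> exp (Re z)" "r \<le> exp (Re w)"
  shows "2 * r * \<bar>sin ((Im z - Im w) / 2)\<bar> \<le> cmod (exp z - exp w)"
proof (rule power2_le_imp_le)
  have "r * r \<le> exp (Re z) * exp (Re w)" using assms by (intro mult_mono) auto
  then have "r * r * (4 * (sin ((Im z - Im w) / 2))\<^sup>2) \<le> exp (Re z) * exp (Re w) * (4 * (sin ((Im z - Im w) / 2))\<^sup>2)"
    by (intro mult_right_mono) auto
  then show "(2 * r * \<bar>sin ((Im z - Im w) / 2)\<bar>)\<^sup>2 \<le> (cmod (exp z - exp w))\<^sup>2"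
    unfolding cmod_exp_diff by (simp add: power_mult_distrib power2_eq_square[of r]) (simp add: algebra_simps add_increasing)
qed auto

text \<open>The left side is the distance of \<open>exp z\<close> from the line through 0 and
  \<open>exp w\<close>.\<close>

lemma cmod_exp_diff_ge_sin:
  "exp (Re z) * \<bar>sin (Im z - Im w)\<bar> \<le> cmod (exp z - exp w)"
proof (rule power2_le_imp_le)
  define a where "a = Im z - Im w"
  note two_sin_half_squared[of a]
  then have "(cmod (exp z - exp w))\<^sup>2 = (exp (Re z) - exp (Re w))\<^sup>2 + 2 * exp (Re z) * exp (Re w) * (1 - cos a)"
    unfolding cmod_exp_diff by (simp add: a_def)
  also have "\<dots> = (exp (Re z) * sin a)\<^sup>2 + (exp (Re z) * cos a - exp (Re w))\<^sup>2"
    by (simp add: power2_diff power_mult_distrib sin_squared_eq) (simp add: algebra_simps)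
  finally show "(exp (Re z) * \<bar>sin (Im z - Im w)\<bar>)\<^sup>2 \<le> (cmod (exp z - exp w))\<^sup>2"
    by (simp add: a_def power_mult_distrib)
qed auto

text \<open>\<open>Im f\<close> is a continuous argument of \<gamma>, and radial projection to the
  circle of radius \<open>r\<close> does not lengthen a curve that stays outside its interior. On
  short parameter intervals the chord is at least 1 - e times the arc of that circle; summing up and
  letting e tend to 0 gives the bound.\<close>

lemma len_ge_angle:
  fixes \<gamma> :: "real \<Rightarrow> complex"
  assumes lip: "K-lipschitz_on {a..b} \<gamma>" and ab: "a \<le> b" and f: "continuous_on {a..b} f"
    "\<And>t. t \<in> {a..b} \<Longrightarrow> \<gamma> t = exp (f t)" and r: "0 \<le> r" "\<And>t. t \<in> {a..b} \<Longrightarrow> r \<le> cmod (\<gamma> t)"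
  shows "r * \<bar>Im (f b) - Im (f a)\<bar> \<le> len \<gamma> a b"
proof -
  have *: "(1 - e) * (r * \<bar>Im (f b) - Im (f a)\<bar>) \<le> len \<gamma> a b" if e: "0 < e" "e < 1" for e
  proof -
    have "uniformly_continuous_on {a..b} f" using f(1) by (intro compact_uniformly_continuous) auto
    then obtain d where d: "0 < d" "\<And>u v. u \<in> {a..b} \<Longrightarrow> v \<in> {a..b} \<Longrightarrow> dist u v < d \<Longrightarrow> dist (f u) (f v) < 2 * e"
      using e(1) unfolding uniformly_continuous_on_def by (metis mult_pos_pos zero_less_numeral)
    have loc: "(1 - e) * (r * \<bar>Im (f v) - Im (f u)\<bar>) \<le> dist (\<gamma> u) (\<gamma> v)"
      if uv: "u \<in> {a..b}" "v \<in> {a..b}" "dist u v < d" for u v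
    proof -
      define y where "y = \<bar>Im (f u) - Im (f v)\<bar> / 2"
      have "\<bar>Im (f u) - Im (f v)\<bar> \<le> dist (f u) (f v)"
        using abs_Im_le_cmod[of "f u - f v"] by (simp add: dist_norm)
      then have y: "0 \<le> y" "y < e" using d(2)[OF uv] by (auto simp: y_def)
      have "y * y * y \<le> e * 1 * y" using y e by (intro mult_right_mono mult_mono) auto
      moreover have "0 \<le> e * y" using y e by simp
      moreover have "(1 - e) * y = y - e * y" "y ^ 3 = y * y * y" by (simp_all add: algebra_simps power3_eq_cube)
      ultimately have "(1 - e) * y \<le> y - y ^ 3 / 6" by linarith
      also have "\<dots> \<le> sin y" using sin_ge_cubic y by blast
      also have "sin y \<le> \<bar>sin ((Im (f u) - Im (f v)) / 2)\<bar>" 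
      proof -
        have "sin \<bar>x\<bar> \<le> \<bar>sin x\<bar>" for x :: real by (cases "0 \<le> x") auto
        from this[of "(Im (f u) - Im (f v)) / 2"] show ?thesis by (simp add: y_def)
      qed
      finally have "2 * r * ((1 - e) * y) \<le> 2 * r * \<bar>sin ((Im (f u) - Im (f v)) / 2)\<bar>"
        using r(1) by (intro mult_left_mono) auto
      also have "\<dots> \<le> cmod (exp (f u) - exp (f v))"
        using r(1) r(2)[OF uv(1)] r(2)[OF uv(2)] f(2) uv by (intro cmod_exp_diff_ge) auto
      finally show ?thesis using f(2) uv by (simp add: dist_norm y_def algebra_simps abs_minus_commute)
    qed
    obtain N :: nat where N: "(b - a) / d < real N" "0 < N"
      using reals_Archimedean2[of "max 1 ((b - a) / d)"] by (metis max_less_iff_conj of_nat_0_less_iff order_less_trans zero_less_one)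
    define t where "t k = a + (b - a) * (real k / real N)" for k
    have tin: "t k \<in> {a..b}" if "k \<le> N" for k
    proof -
      have "real k / real N \<le> 1" using that N(2) by simp
      then have "(b - a) * (real k / real N) \<le> (b - a) * 1" using ab by (intro mult_left_mono) auto
      then show ?thesis using ab by (simp add: t_def)
    qed
    have tSuc: "t (Suc k) - t k = (b - a) / real N" for k
      by (simp add: t_def add_divide_distrib algebra_simps)
    have step: "0 \<le> (b - a) / real N" "(b - a) / real N < d" using N d ab by (auto simp: field_simps)
    have "(1 - e) * (r * \<bar>Im (f (t k)) - Im (f a)\<bar>) \<le> len \<gamma> a (t k)" if "k \<le> N" for k
      using that
    proof (induction k)
      case 0
      show ?case using len_nonneg[of K a a \<gamma>] lipschitz_on_nonneg[OF lip] by (simp add: t_def)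
    next
      case (Suc k)
      have k: "t k \<in> {a..b}" "t (Suc k) \<in> {a..b}" using Suc.prems tin[of k] tin[of "Suc k"] by simp_all
      have le: "t k \<le> t (Suc k)" using tSuc[of k] step by linarith
      have dd: "dist (t k) (t (Suc k)) < d"
        using le tSuc[of k] step(2) by (simp add: dist_real_def)
      have "(1 - e) * (r * \<bar>Im (f (t (Suc k))) - Im (f a)\<bar>)
         \<le> (1 - e) * (r * (\<bar>Im (f (t (Suc k))) - Im (f (t k))\<bar> + \<bar>Im (f (t k)) - Im (f a)\<bar>))"
        using e r(1) by (intro mult_left_mono) auto
      also have "\<dots> = (1 - e) * (r * \<bar>Im (f (t (Suc k))) - Im (f (t k))\<bar>) + (1 - e) * (r * \<bar>Im (f (t k)) - Im (f a)\<bar>)"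
        by (simp add: algebra_simps)
      also have "\<dots> \<le> dist (\<gamma> (t k)) (\<gamma> (t (Suc k))) + len \<gamma> a (t k)"
        using Suc.IH Suc.prems by (intro add_mono loc[OF k dd]) simp
      also have "\<dots> \<le> len \<gamma> (t k) (t (Suc k)) + len \<gamma> a (t k)"
        using k le by (intro add_right_mono dist_le_len[of K] lipschitz_on_subset[OF lip]) auto
      also have "\<dots> = len \<gamma> a (t (Suc k))"
        using len_add[of K a "t (Suc k)" \<gamma> "t k"] k le lipschitz_on_subset[OF lip, of "{a..t (Suc k)}"] by auto
      finally show ?case .
    qed
    from this[of N] show ?thesis using N(2) by (simp add: t_def)
  qed
  have "((\<lambda>e. (1 - e) * (r * \<bar>Im (f b) - Im (f a)\<bar>)) \<longlongrightarrow> (1 - 0) * (r * \<bar>Im (f b) - Im (f a)\<bar>)) (at_right 0)"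
    by (intro tendsto_intros)
  moreover have "\<forall>\<^sub>F e in at_right 0. (1 - e) * (r * \<bar>Im (f b) - Im (f a)\<bar>) \<le> len \<gamma> a b"
    using * by (intro eventually_at_rightI[of 0 1]) auto
  ultimately show ?thesis using tendsto_upperbound by fastforce
qed

text \<open>The two lengths are read as the coordinates of a plane vector. Each step contributes a
  vector of norm at most \<open>L\<close> times the parameter step, and the triangle inequality adds
  them up.\<close>

lemma plen_Pythagoras:
  fixes f g :: "real \<Rightarrow> complex"
  assumes "\<And>u v. (dist (f u) (f v))\<^sup>2 + (dist (g u) (g v))\<^sup>2 \<le> (L * \<bar>u - v\<bar>)\<^sup>2" "0 \<le> L"
    and "ts \<in> partitions a b" "a \<le> b"
  shows "(plen f ts)\<^sup>2 + (plen g ts)\<^sup>2 \<le> (L * (b - a))\<^sup>2"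
proof -
  have "sorted ts \<Longrightarrow> set ts \<subseteq> {a..b} \<Longrightarrow> ts \<noteq> [] \<Longrightarrow> cmod (Complex (plen f ts) (plen g ts)) \<le> L * (b - hd ts)"
  proof (induction ts rule: induct_list012)
    case (3 x y zs)
    have "cmod (Complex (dist (f x) (f y)) (dist (g x) (g y))) \<le> L * (y - x)"
      unfolding cmod_def using assms(1)[of x y] 3(3) assms(2) by (intro real_le_lsqrt) (auto simp: power2_commute power_mult_distrib)
    moreover have "cmod (Complex (plen f (y # zs)) (plen g (y # zs))) \<le> L * (b - y)" using 3 by auto
    moreover have "Complex (plen f (x # y # zs)) (plen g (x # y # zs))
       = Complex (dist (f x) (f y)) (dist (g x) (g y)) + Complex (plen f (y # zs)) (plen g (y # zs))"
      by (simp add: complex_eq_iff)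
    ultimately show ?case
      using norm_triangle_le[of "Complex (dist (f x) (f y)) (dist (g x) (g y))" "Complex (plen f (y # zs)) (plen g (y # zs))" "L * (b - x)"]
      by (simp add: algebra_simps)
  qed (use assms(2) in \<open>auto simp: complex_norm\<close>)
  moreover have "L * (b - hd ts) \<le> L * (b - a)" if "ts \<noteq> []"
    using assms(2,3) that by (intro mult_left_mono) (cases ts; auto simp: partitions_def)+
  ultimately have "cmod (Complex (plen f ts) (plen g ts)) \<le> L * (b - a)"
    using assms(2-4) by (cases "ts = []") (auto simp: partitions_def complex_norm)
  then show ?thesis using assms(2,4) power_mono[of "cmod (Complex (plen f ts) (plen g ts))" "L * (b - a)" 2]
    by (simp add: cmod_power2)
qed

text \<open>The two suprema may be approached along different partitions; a common refinement
  handles both, and they are then taken one after the other.\<close>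

lemma len_Pythagoras:
  fixes f g :: "real \<Rightarrow> complex"
  assumes "\<And>u v. (dist (f u) (f v))\<^sup>2 + (dist (g u) (g v))\<^sup>2 \<le> (L * \<bar>u - v\<bar>)\<^sup>2" "0 \<le> L" "a \<le> b"
    and "K-lipschitz_on {a..b} f" "K'-lipschitz_on {a..b} g"
  shows "(len f a b)\<^sup>2 + (len g a b)\<^sup>2 \<le> (L * (b - a))\<^sup>2"
proof -
  let ?X = "(L * (b - a))\<^sup>2"
  have *: "(plen f ts)\<^sup>2 + (plen g us)\<^sup>2 \<le> ?X" if tu: "ts \<in> partitions a b" "us \<in> partitions a b" for ts us
  proof -
    obtain vs where "vs \<in> partitions a b" "plen f ts \<le> plen f vs" "plen g us \<le> plen g vs"
      using common_refinement[OF tu] by metis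
    then have "(plen f vs)\<^sup>2 + (plen g vs)\<^sup>2 \<le> ?X" "(plen f ts)\<^sup>2 \<le> (plen f vs)\<^sup>2" "(plen g us)\<^sup>2 \<le> (plen g vs)\<^sup>2"
      using plen_Pythagoras[OF assms(1,2) _ assms(3), of vs] by (auto intro: power_mono plen_nonneg)
    then show ?thesis by linarith
  qed
  have **: "(len f a b)\<^sup>2 + (plen g us)\<^sup>2 \<le> ?X" if us: "us \<in> partitions a b" for us
  proof -
    have "len f a b \<le> sqrt (?X - (plen g us)\<^sup>2)"
      using *[OF _ us] by (intro len_leI real_le_rsqrt) (simp add: algebra_simps)
    then have "(len f a b)\<^sup>2 \<le> (sqrt (?X - (plen g us)\<^sup>2))\<^sup>2" using len_nonneg[OF assms(4,3)] by (intro power_mono)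
    then show ?thesis using *[OF partitions_Nil us] by simp
  qed
  have "len g a b \<le> sqrt (?X - (len f a b)\<^sup>2)"
    using ** by (intro len_leI real_le_rsqrt) (simp add: algebra_simps)
  then have "(len g a b)\<^sup>2 \<le> (sqrt (?X - (len f a b)\<^sup>2))\<^sup>2" using len_nonneg[OF assms(5,3)] by (intro power_mono)
  then show ?thesis using **[OF partitions_Nil] by simp
qed

text \<open>Two points halve the curve. Every point of the curve lies on an arc of half the length
  between them, hence in an ellipse with these foci, whose points are within a quarter of the length
  of the midpoint.\<close>

lemma closed_curve_in_cball:
  fixes M :: "real \<Rightarrow> complex"
  assumes lip: "K-lipschitz_on {a..b} M" and ab: "a \<le> b" and "M b = M a"
  obtains z where "\<And>t. t \<in> {a..b} \<Longrightarrow> dist z (M t) \<le> len M a b / 4"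
proof -
  have sub: "K-lipschitz_on {u..v} M" if "a \<le> u" "v \<le> b" for u v
    using that by (intro lipschitz_on_subset[OF lip]) auto
  have add: "len M u w = len M u v + len M v w" if "a \<le> u" "u \<le> v" "v \<le> w" "w \<le> b" for u v w
    using that by (intro len_add[OF sub]) auto
  have dl: "dist (M u) (M v) \<le> len M u v" if "a \<le> u" "u \<le> v" "v \<le> b" for u v
    using that by (intro dist_le_len[OF sub]) auto
  have "K-lipschitz_on {a..b} (len M a)"
  proof (rule lipschitz_on_leI)
    fix u v assume uv: "u \<in> {a..b}" "v \<in> {a..b}" "u \<le> v"
    then have "len M a v - len M a u = len M u v" using add[of a u v] by simp
    moreover have "len M u v \<le> K * (v - u)" "0 \<le> len M u v" using uv by (auto intro!: len_le_lipschitz len_nonneg sub)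
    ultimately show "dist (len M a u) (len M a v) \<le> K * dist u v" using uv by (simp add: dist_real_def)
  qed (use lip lipschitz_on_nonneg in blast)
  then have cont: "continuous_on {a..b} (len M a)" by (rule lipschitz_on_continuous_on)
  have nn: "0 \<le> len M a b" by (rule len_nonneg[OF lip ab])
  have "len M a a = 0" using add[of a a a] ab by simp
  then obtain t1 where t1: "a \<le> t1" "t1 \<le> b" "len M a t1 = len M a b / 2"
    using IVT'[of "len M a" a "len M a b / 2" b] nn ab cont by auto
  have t1b: "len M t1 b = len M a b / 2" using add[of a t1 b] t1 by simp
  show thesis
  proof (rule that[of "midpoint (M a) (M t1)"])
    fix t assume t: "t \<in> {a..b}"
    have "dist (M t) (M a) + dist (M t) (M t1) \<le> len M a b / 2"
    proof (cases "t \<le> t1")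
      case True
      then show ?thesis using dl[of a t] dl[of t t1] add[of a t t1] t t1 by (simp add: dist_commute)
    next
      case False
      then show ?thesis using dl[of t1 t] dl[of t b] add[of t1 t b] t t1 t1b assms(3) by (simp add: dist_commute)
    qed
    moreover have "dist (midpoint (M a) (M t1)) (M t) \<le> (dist (M t) (M a) + dist (M t) (M t1)) / 2"
    proof -
      have "midpoint (M a) (M t1) - M t = (1/2) *\<^sub>R ((M a - M t) + (M t1 - M t))"
        by (simp add: midpoint_def scaleR_conv_of_real field_simps)
      then show ?thesis using norm_triangle_ineq[of "M a - M t" "M t1 - M t"] by (simp add: dist_norm norm_minus_commute)
    qed
    ultimately show "dist (midpoint (M a) (M t1)) (M t) \<le> len M a b / 4" by simp
  qed
qed

text \<open>Meant for the difference of two continuous logarithms of the same function: its values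
  lie in a discrete set.\<close>

lemma constant_on_if_multiples:
  assumes "connected S" "continuous_on S h"
    and "\<And>t. t \<in> S \<Longrightarrow> \<exists>n::int. h t = (of_int (2 * n) * of_real pi) * \<i>"
  shows "h constant_on S"
proof (rule continuous_discrete_range_constant[OF assms(1,2)])
  fix u assume u: "u \<in> S"
  have "2 * pi \<le> cmod (h v - h u)" if v: "v \<in> S" "h v \<noteq> h u" for v
  proof -
    obtain m n :: int where mn: "h u = (of_int (2 * m) * of_real pi) * \<i>" "h v = (of_int (2 * n) * of_real pi) * \<i>"
      using assms(3)[OF u] assms(3)[OF v(1)] by blast
    define k where "k = n - m"
    have e: "h v - h u = of_real (of_int (2 * k) * pi) * \<i>" using mn by (simp add: k_def algebra_simps)
    have "k \<noteq> 0" using mn v(2) by (auto simp: k_def)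
    then have "2 \<le> \<bar>real_of_int (2 * k)\<bar>" by linarith
    then have "2 * pi \<le> \<bar>real_of_int (2 * k)\<bar> * pi" by (intro mult_right_mono) auto
    also have "\<dots> = cmod (h v - h u)" unfolding e norm_mult norm_of_real by (simp add: abs_mult)
    finally show ?thesis .
  qed
  then show "\<exists>e>0. \<forall>v. v \<in> S \<and> h v \<noteq> h u \<longrightarrow> e \<le> cmod (h v - h u)"
    by (intro exI[of _ "2 * pi"]) auto
qed

text \<open>\<open>S\<close> changes sign after half a period, so its argument turns by at least pi.
  As \<open>S\<close> stays outside the disk of radius \<open>r\<close>, this costs length pi r,
  while \<open>S\<close> and \<open>M\<close> together have, in the Pythagorean sense, only
  \<open>L / 2\<close>, which is pi r (1 + \<epsilon>^2). Hence \<open>M\<close>, closed after half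
  a period, is short and stays near a point \<open>z\<close>, and a large value of \<open>S\<close>
  would exceed the budget too.\<close>

lemma near_circle_periodic:
  fixes C :: "real \<Rightarrow> complex"
  assumes lip: "L-lipschitz_on UNIV C" and per: "\<And>t. C (t + 1) = C t" and L: "0 < L"
    and \<epsilon>: "0 < \<epsilon>" "\<epsilon> \<le> 1 / 100" and r: "r = L / (2 * pi * (1 + \<epsilon>\<^sup>2))"
    and half: "\<And>t. 2 * r \<le> dist (C t) (C (t + 1 / 2))"
  obtains z \<rho> where "0 < \<rho>" "\<rho> \<le> r" "\<And>t. t \<in> {0..1} \<Longrightarrow> \<rho> \<le> dist z (C t)"
    "\<And>t. t \<in> {0..1} \<Longrightarrow> dist z (C t) \<le> (1 + 3 * \<epsilon>) * \<rho>" "winding_number C z \<noteq> 0"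
proof -
  define S where "S t = (C t - C (t + 1 / 2)) / 2" for t
  define M where "M t = (C t + C (t + 1 / 2)) / 2" for t
  have CSM: "C t = S t + M t" for t by (simp add: S_def M_def field_simps)
  have per2: "C (t + 1 / 2 + 1 / 2) = C t" for t using per[of t] by (simp add: add.assoc)
  have Sh: "S (t + 1 / 2) = - S t" and Mh: "M (t + 1 / 2) = M t" for t
    unfolding S_def M_def per2 by (simp_all add: field_simps)
  have rpos: "0 < r" using L \<epsilon> pi_gt_zero by (simp add: r add_pos_nonneg)
  have Lr: "L / 2 = pi * r * (1 + \<epsilon>\<^sup>2)"
  proof -
    have "2 * pi * (1 + \<epsilon>\<^sup>2) \<noteq> 0" using pi_gt_zero add_pos_nonneg[of 1 "\<epsilon>\<^sup>2"] by auto
    then have "r * (2 * pi * (1 + \<epsilon>\<^sup>2)) = L" unfolding r by (rule nonzero_eq_divide_eq[THEN iffD1]) simp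
    then show ?thesis by (simp add: algebra_simps)
  qed
  have Sr: "r \<le> cmod (S t)" for t
    using half[of t] by (simp add: S_def norm_divide dist_norm)
  have S0: "S t \<noteq> 0" for t using Sr[of t] rpos by auto
  have pyth: "(dist (S u) (S v))\<^sup>2 + (dist (M u) (M v))\<^sup>2 \<le> (L * \<bar>u - v\<bar>)\<^sup>2" for u v
  proof -
    define p q where "p = C u - C v" and "q = C (u + 1/2) - C (v + 1/2)"
    have "cmod p \<le> L * \<bar>u - v\<bar>" "cmod q \<le> L * \<bar>u - v\<bar>"
      using lipschitz_onD[OF lip, of u v] lipschitz_onD[OF lip, of "u + 1/2" "v + 1/2"]
      by (auto simp: p_def q_def dist_norm dist_real_def)
    then have "(cmod p)\<^sup>2 \<le> (L * \<bar>u - v\<bar>)\<^sup>2" "(cmod q)\<^sup>2 \<le> (L * \<bar>u - v\<bar>)\<^sup>2"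
      by (auto intro: power_mono)
    moreover have "(cmod ((p - q) / 2))\<^sup>2 + (cmod ((p + q) / 2))\<^sup>2 = ((cmod p)\<^sup>2 + (cmod q)\<^sup>2) / 2"
      by (simp add: cmod_power2 power_divide power2_diff power2_sum) (simp add: field_simps)
    moreover have "a \<le> x \<Longrightarrow> b \<le> x \<Longrightarrow> c = (a + b) / 2 \<Longrightarrow> c \<le> x" for a b c x :: real by simp
    ultimately have le: "(cmod ((p - q) / 2))\<^sup>2 + (cmod ((p + q) / 2))\<^sup>2 \<le> (L * \<bar>u - v\<bar>)\<^sup>2"
      by blast
    have eq: "S u - S v = (p - q) / 2" "M u - M v = (p + q) / 2"
      by (simp_all add: S_def M_def p_def q_def field_simps)
    show ?thesis using le unfolding dist_norm eq .
  qed
  have lipS: "L-lipschitz_on A S" and lipM: "L-lipschitz_on A M" for A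
  proof -
    have "dist (S u) (S v) \<le> L * dist u v \<and> dist (M u) (M v) \<le> L * dist u v" for u v
    proof -
      have "(dist (S u) (S v))\<^sup>2 \<le> (L * \<bar>u - v\<bar>)\<^sup>2" "(dist (M u) (M v))\<^sup>2 \<le> (L * \<bar>u - v\<bar>)\<^sup>2"
        using pyth[of u v] zero_le_power2[of "dist (S u) (S v)"] zero_le_power2[of "dist (M u) (M v)"] by linarith+
      then show ?thesis using L unfolding dist_real_def by (auto intro!: power2_le_imp_le)
    qed
    then show "L-lipschitz_on A S" "L-lipschitz_on A M" using L by (auto intro!: lipschitz_onI)
  qed
  have contS: "continuous_on A S" and contM: "continuous_on A M" for A
    using lipS lipM lipschitz_on_continuous_on by blast+
  have "contractible (UNIV :: real set)" by (simp add: convex_imp_contractible)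
  then obtain f where f: "continuous_on UNIV f" "\<And>t. S t = exp (f t)"
    using continuous_logarithm_on_contractible[OF contS, of UNIV] S0 by auto
  \<comment> \<open>The increment of the logarithm over half a period. It is constant, and an odd
    multiple of pi i because \<open>S\<close> changes sign; in particular it is not 0.\<close>
  define j where "j t = f (t + 1 / 2) - f t" for t
  have jn: "\<exists>n::int. j t - pi * \<i> = (of_int (2 * n) * pi) * \<i>" for t
  proof -
    have "exp (j t) = S (t + 1/2) / S t" unfolding j_def exp_diff f(2)[symmetric] ..
    then have "exp (j t) = exp (pi * \<i>)" using Sh[of t] S0[of t] by simp
    then show ?thesis unfolding exp_eq by (metis add_diff_cancel_left')
  qed
  have "(\<lambda>t. j t - pi * \<i>) constant_on UNIV"
  proof (rule constant_on_if_multiples)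
    show "continuous_on UNIV (\<lambda>t. j t - pi * \<i>)" unfolding j_def
      by (intro continuous_intros continuous_on_compose2[OF f(1)]) auto
  qed (use jn in auto)
  then obtain J' where "\<And>t. j t - pi * \<i> = J'" by (auto simp: constant_on_def)
  then obtain J where J: "\<And>t. j t = J" by (metis diff_add_cancel)
  obtain m :: int where "J - pi * \<i> = (of_int (2 * m) * pi) * \<i>" using jn[of 0] J by auto
  then have "J = pi * \<i> + (of_int (2 * m) * pi) * \<i>" by (metis add.commute diff_add_cancel)
  then obtain n :: int where n: "J = (of_int (2 * n + 1) * pi) * \<i>" by (simp add: algebra_simps)
  have ImJ: "pi \<le> \<bar>Im J\<bar>"
  proof -
    have "1 \<le> \<bar>2 * n + 1\<bar>" by presburger
    then have "1 \<le> \<bar>real_of_int (2 * n + 1)\<bar>"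
      by (metis of_int_1 of_int_abs of_int_le_iff)
    then have "1 * pi \<le> \<bar>real_of_int (2 * n + 1)\<bar> * pi" by (intro mult_right_mono) auto
    moreover have "Im J = real_of_int (2 * n + 1) * pi" unfolding n by simp
    ultimately show ?thesis by (simp add: abs_mult)
  qed
  have ReJ: "Re J = 0" unfolding n by simp
  have fh: "f (t + 1 / 2) = f t + J" for t using J[of t] unfolding j_def by (metis add.commute diff_add_cancel)
  \<comment> \<open>The first and the last angle \<alpha> of the turn from \<open>S t0\<close> to
    \<open>- S t0\<close> are charged with chords, each at least the distance of an endpoint of norm
    \<open>cmod (S t0)\<close> from a line through 0. The turn in between is charged at radius
    \<open>r\<close>.\<close>
  have lenS: "2 * cmod (S t0) * sin \<alpha> + r * (pi - 2 * \<alpha>) \<le> len S t0 (t0 + 1/2)"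
    if \<alpha>: "0 \<le> \<alpha>" "\<alpha> \<le> pi / 2" for t0 \<alpha>
  proof -
    \<comment> \<open>The sign orients the argument so that it ends at a positive value, whichever
      way \<open>S\<close> turns.\<close>
    define \<phi> where "\<phi> t = sgn (Im J) * (Im (f t) - Im (f t0))" for t
    have c\<phi>: "continuous_on A \<phi>" for A
      unfolding \<phi>_def by (intro continuous_intros continuous_on_subset[OF f(1)]) auto
    have sJ: "\<bar>sgn (Im J)\<bar> = 1" using ImJ pi_gt3 by (auto simp: sgn_if)
    have \<phi>abs: "\<bar>Im (f u) - Im (f v)\<bar> = \<bar>\<phi> u - \<phi> v\<bar>" for u v
    proof -
      have "\<phi> u - \<phi> v = sgn (Im J) * (Im (f u) - Im (f v))" by (simp add: \<phi>_def algebra_simps)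
      then show ?thesis using sJ by (simp add: abs_mult)
    qed
    have ends: "\<phi> t0 = 0" "\<phi> (t0 + 1/2) = \<bar>Im J\<bar>"
      using fh[of t0] by (auto simp: \<phi>_def sgn_if)
    obtain ta where ta: "t0 \<le> ta" "ta \<le> t0 + 1/2" "\<phi> ta = \<alpha>"
      using IVT'[of \<phi> t0 \<alpha> "t0 + 1/2"] ends \<alpha> ImJ c\<phi> pi_gt_zero by auto
    obtain tb where tb: "ta \<le> tb" "tb \<le> t0 + 1/2" "\<phi> tb = \<bar>Im J\<bar> - \<alpha>"
      using IVT'[of \<phi> ta "\<bar>Im J\<bar> - \<alpha>" "t0 + 1/2"] ends \<alpha> ImJ c\<phi> ta by auto
    have sin0: "0 \<le> sin \<alpha>" using \<alpha> by (intro sin_ge_zero) auto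
    have sinabs: "\<bar>sin x\<bar> = sin \<alpha>" if "\<bar>x\<bar> = \<alpha>" for x
      using that sin0 by (auto simp: abs_if split: if_splits)
    have Sexp: "cmod (S t) = exp (Re (f t))" for t by (simp add: f(2))
    have "cmod (S t0) * sin \<alpha> \<le> dist (S t0) (S ta)"
      using cmod_exp_diff_ge_sin[of "f t0" "f ta"] sinabs[of "Im (f t0) - Im (f ta)"] \<phi>abs[of t0 ta] ta ends \<alpha>
      by (simp add: dist_norm f(2))
    also have "\<dots> \<le> len S t0 ta" using ta by (intro dist_le_len[OF lipS])
    finally have 1: "cmod (S t0) * sin \<alpha> \<le> len S t0 ta" .
    have "cmod (S t0) * sin \<alpha> \<le> dist (S (t0 + 1/2)) (S tb)"
      using cmod_exp_diff_ge_sin[of "f (t0 + 1/2)" "f tb"] sinabs[of "Im (f (t0 + 1/2)) - Im (f tb)"] \<phi>abs[of "t0 + 1/2" tb] tb ends \<alpha>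
        fh[of t0] ReJ by (simp add: dist_norm f(2))
    also have "\<dots> \<le> len S tb (t0 + 1/2)" using tb by (subst dist_commute) (intro dist_le_len[OF lipS])
    finally have 2: "cmod (S t0) * sin \<alpha> \<le> len S tb (t0 + 1/2)" .
    have "r * (pi - 2 * \<alpha>) \<le> r * \<bar>Im (f tb) - Im (f ta)\<bar>"
      unfolding \<phi>abs using rpos ta tb ImJ by (intro mult_left_mono) auto
    also have "\<dots> \<le> len S ta tb"
      using f(2) Sr rpos tb by (intro len_ge_angle[OF lipS] continuous_on_subset[OF f(1)]) auto
    finally have 3: "r * (pi - 2 * \<alpha>) \<le> len S ta tb" .
    have "len S t0 (t0 + 1/2) = len S t0 ta + len S ta tb + len S tb (t0 + 1/2)"
      using len_add[OF lipS, of t0 ta "t0 + 1/2"] len_add[OF lipS, of ta tb "t0 + 1/2"] ta tb by simp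
    then show ?thesis using 1 2 3 by simp
  qed
  have lenP: "(len S t (t + 1/2))\<^sup>2 + (len M t (t + 1/2))\<^sup>2 \<le> (L / 2)\<^sup>2" for t
    using len_Pythagoras[OF pyth _ _ lipS lipM, of t "t + 1/2"] L by simp
  have Smax: "cmod (S t) \<le> r * (1 + \<epsilon> / 2)" for t
  proof (rule ccontr)
    assume "\<not> ?thesis"
    then have big: "r * (1 + \<epsilon> / 2) \<le> cmod (S t)" by simp
    \<comment> \<open>The excess of the norm gains \<alpha> \<epsilon>, the cubic error of the sine
      loses \<alpha>^3 / 3, and pi \<epsilon>^2 is available. With \<alpha>^2 = \<epsilon> the net
      gain is nearly 2/3 \<alpha> \<epsilon>, against pi \<alpha> times \<alpha> \<epsilon>, where
      pi \<alpha> \<le> 4/10.\<close>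
    define \<alpha> where "\<alpha> = sqrt \<epsilon>"
    have \<alpha>: "0 < \<alpha>" "\<alpha> * \<alpha> = \<epsilon>" "\<alpha> \<le> 1/10"
      using \<epsilon> real_sqrt_le_mono[OF \<epsilon>(2)] by (auto simp: \<alpha>_def real_sqrt_divide)
    have "(len S t (t + 1/2))\<^sup>2 \<le> (L / 2)\<^sup>2" using lenP[of t] zero_le_power2[of "len M t (t + 1/2)"] by linarith
    then have "len S t (t + 1/2) \<le> L / 2" by (rule power2_le_imp_le) (use L in simp)
    moreover have "\<alpha> \<le> pi / 2" using \<alpha> pi_gt3 by linarith
    ultimately have le: "2 * cmod (S t) * sin \<alpha> + r * (pi - 2 * \<alpha>) \<le> pi * r * (1 + \<epsilon>\<^sup>2)"
      using lenS[of \<alpha> t] \<alpha>(1) Lr by linarith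
    have s: "\<alpha> * (1 - \<epsilon> / 6) \<le> sin \<alpha>" using sin_ge_cubic[of \<alpha>] \<alpha> by (simp add: power3_eq_cube algebra_simps)
    have "0 \<le> \<alpha> * (1 - \<epsilon> / 6)" using \<alpha> \<epsilon> by simp
    then have "2 * (r * (1 + \<epsilon> / 2)) * (\<alpha> * (1 - \<epsilon> / 6)) \<le> 2 * cmod (S t) * sin \<alpha>"
      using big s rpos \<epsilon> by (intro mult_mono) auto
    moreover have "r * (2 * (1 + \<epsilon> / 2) * (\<alpha> * (1 - \<epsilon> / 6)) + (pi - 2 * \<alpha>))
        = 2 * (r * (1 + \<epsilon> / 2)) * (\<alpha> * (1 - \<epsilon> / 6)) + r * (pi - 2 * \<alpha>)"
      "r * (pi * (1 + \<epsilon>\<^sup>2)) = pi * r * (1 + \<epsilon>\<^sup>2)"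
      by (simp_all add: field_simps)
    ultimately have "r * (2 * (1 + \<epsilon> / 2) * (\<alpha> * (1 - \<epsilon> / 6)) + (pi - 2 * \<alpha>)) \<le> r * (pi * (1 + \<epsilon>\<^sup>2))"
      using le by linarith
    then have "2 * (1 + \<epsilon> / 2) * (\<alpha> * (1 - \<epsilon> / 6)) + (pi - 2 * \<alpha>) \<le> pi * (1 + \<epsilon>\<^sup>2)"
      using rpos by (simp only: mult_le_cancel_left_pos)
    moreover have "2 * (1 + \<epsilon> / 2) * (\<alpha> * (1 - \<epsilon> / 6)) = 2 * \<alpha> + \<alpha> * (\<epsilon> * (2/3 - \<epsilon> / 6))"
      "pi * (1 + \<epsilon>\<^sup>2) = pi + pi * (\<epsilon> * \<epsilon>)"
      by (simp_all add: power2_eq_square field_simps)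
    ultimately have "\<alpha> * (\<epsilon> * (2/3 - \<epsilon> / 6)) \<le> pi * (\<epsilon> * \<epsilon>)" by linarith
    also have "\<dots> = \<alpha> * (\<epsilon> * (pi * \<alpha>))" using \<alpha>(2) by (metis mult.assoc mult.left_commute)
    finally have "2/3 - \<epsilon> / 6 \<le> pi * \<alpha>" using \<alpha> \<epsilon> by simp
    moreover have "pi * \<alpha> \<le> 4 * (1/10)" using \<alpha> pi_less_4 by (intro mult_mono) auto
    ultimately show False using \<epsilon> by simp
  qed
  obtain z where z: "\<And>t. t \<in> {0..1/2} \<Longrightarrow> dist z (M t) \<le> len M 0 (1/2) / 4"
    using closed_curve_in_cball[OF lipM, of 0 "1/2"] Mh[of 0] by auto
  \<comment> \<open>Pythagoras leaves a length of pi \<epsilon> r sqrt (2 + \<epsilon>^2) for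
    \<open>M\<close>, and 4.48 is slightly more than pi sqrt 2. A quarter of it is the 1.12
    below.\<close>
  have "len M 0 (1/2) \<le> 448 / 100 * \<epsilon> * r"
  proof (rule power2_le_imp_le)
    have "pi * r \<le> len S 0 (1/2)" using lenS[of 0 0] by (simp add: mult.commute)
    then have "(pi * r)\<^sup>2 \<le> (len S 0 (1/2))\<^sup>2" using rpos by (intro power_mono) auto
    then have "(len M 0 (1/2))\<^sup>2 \<le> (pi * r * (1 + \<epsilon>\<^sup>2))\<^sup>2 - (pi * r)\<^sup>2"
      using lenP[of 0] Lr by simp
    also have "\<dots> = pi\<^sup>2 * (2 + \<epsilon>\<^sup>2) * (\<epsilon> * r)\<^sup>2"
      by (simp add: power2_eq_square algebra_simps)
    also have "\<dots> \<le> (448/100)\<^sup>2 * (\<epsilon> * r)\<^sup>2"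
    proof (rule mult_right_mono)
      have "pi \<le> 315/100" using pi_approx by simp
      then have "pi\<^sup>2 \<le> (315/100)\<^sup>2" by (intro power_mono) auto
      moreover have "\<epsilon>\<^sup>2 \<le> (1/100)\<^sup>2" using \<epsilon> by (intro power_mono) auto
      ultimately have "pi\<^sup>2 * (2 + \<epsilon>\<^sup>2) \<le> (315/100)\<^sup>2 * (2 + (1/100)\<^sup>2)"
        by (intro mult_mono) auto
      then show "pi\<^sup>2 * (2 + \<epsilon>\<^sup>2) \<le> (448/100)\<^sup>2" by (simp add: power2_eq_square)
    qed simp
    finally show "(len M 0 (1/2))\<^sup>2 \<le> (448 / 100 * \<epsilon> * r)\<^sup>2" by (simp only: power_mult_distrib mult.assoc)
  qed (use \<epsilon> rpos in auto)
  then have zM: "dist z (M t) \<le> 112 / 100 * \<epsilon> * r" if "t \<in> {0..1}" for t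
  proof (cases "t \<le> 1/2")
    case True
    then show ?thesis using z[of t] that \<open>len M 0 (1/2) \<le> _\<close> by auto
  next
    case False
    then have "dist z (M (t - 1/2)) \<le> len M 0 (1/2) / 4" using that by (intro z) auto
    then show ?thesis using Mh[of "t - 1/2"] \<open>len M 0 (1/2) \<le> _\<close> by auto
  qed
  define \<rho> where "\<rho> = r * (1 - 112 / 100 * \<epsilon>)"
  have \<rho>: "0 < \<rho>" "\<rho> \<le> r" using rpos \<epsilon> by (auto simp: \<rho>_def mult_le_cancel_left1)
  have Cz: "C t - z = S t + (M t - z)" for t by (simp add: CSM)
  have in1: "\<rho> \<le> dist z (C t)" if "t \<in> {0..1}" for t
    using zM[OF that] Sr[of t] norm_diff_ineq[of "S t" "M t - z"]
    by (simp add: \<rho>_def dist_norm norm_minus_commute[of z] Cz algebra_simps)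
  have in2: "dist z (C t) \<le> (1 + 3 * \<epsilon>) * \<rho>" if "t \<in> {0..1}" for t
  proof -
    have "dist z (C t) \<le> cmod (S t) + dist z (M t)"
      using norm_triangle_ineq[of "S t" "M t - z"] by (simp add: dist_norm norm_minus_commute[of z] Cz)
    also have "\<dots> \<le> r * (1 + \<epsilon> / 2) + 112 / 100 * \<epsilon> * r" using Smax zM[OF that] by (rule add_mono)
    also have "\<dots> = r * (1 + 162 / 100 * \<epsilon>)" by (simp add: algebra_simps)
    \<comment> \<open>The product is 1 + 1.88 \<epsilon> - 3.36 \<epsilon>^2, and for \<epsilon>
      \<le> 1/100 the surplus 0.26 \<epsilon> absorbs the quadratic term.\<close>
    also have "\<dots> \<le> r * ((1 + 3 * \<epsilon>) * (1 - 112 / 100 * \<epsilon>))"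
    proof (rule mult_left_mono)
      have "\<epsilon> * \<epsilon> \<le> \<epsilon> * (1/100)" using \<epsilon> by (intro mult_left_mono) auto
      moreover have "(1 + 3 * \<epsilon>) * (1 - 112 / 100 * \<epsilon>) = 1 + 188/100 * \<epsilon> - 336/100 * (\<epsilon> * \<epsilon>)"
        by (simp add: field_simps)
      ultimately show "1 + 162 / 100 * \<epsilon> \<le> (1 + 3 * \<epsilon>) * (1 - 112 / 100 * \<epsilon>)" using \<epsilon> by linarith
    qed (use rpos in auto)
    finally show ?thesis by (simp add: \<rho>_def algebra_simps)
  qed
  have "winding_number C z \<noteq> 0"
  proof
    assume w0: "winding_number C z = 0"
    have "path C" unfolding path_def using lipschitz_on_continuous_on[OF lip] continuous_on_subset by blast
    moreover have "z \<notin> path_image C" using in1 \<rho>(1) by (fastforce simp: path_image_def)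
    ultimately obtain q where q: "path q" "pathfinish q - pathstart q = 2 * of_real pi * \<i> * winding_number C z"
      "\<And>t. t \<in> {0..1} \<Longrightarrow> C t = z + exp (q t)" using winding_number_as_continuous_log by blast
    \<comment> \<open>A logarithm of \<open>C - z\<close>, which factors as \<open>S\<close> times 1
      + (M - z)/S. The second factor lies in the right half plane, so its principal logarithm is
      continuous and returns to its value after a period; the total change is that of
      \<open>f\<close>, namely \<open>2 * J\<close>. A vanishing winding number would make it
      0.\<close>
    define p where "p t = f t + Ln (1 + (M t - z) / S t)" for t
    have small: "cmod ((M t - z) / S t) < 1" if "t \<in> {0..1}" for t
    proof -
      have "cmod (M t - z) \<le> 112 / 100 * \<epsilon> * r" using zM[OF that] by (simp add: dist_norm norm_minus_commute)
      also have "\<dots> < 1 * r" using \<epsilon> rpos by (intro mult_strict_right_mono) auto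
      also have "\<dots> \<le> cmod (S t)" using Sr by simp
      finally show ?thesis by (simp add: norm_divide divide_less_eq S0)
    qed
    have half_plane: "0 < Re (1 + (M t - z) / S t)" if "t \<in> {0..1}" for t
      using small[OF that] abs_Re_le_cmod[of "(M t - z) / S t"] by simp
    have notneg: "1 + (M t - z) / S t \<notin> \<real>\<^sub>\<le>\<^sub>0" if "t \<in> {0..1}" for t
      using half_plane[OF that] by (auto simp: complex_nonpos_Reals_iff)
    have cp: "continuous_on {0..1} p"
      unfolding p_def using notneg S0
      by (intro continuous_intros continuous_on_subset[OF f(1)] contM contS) auto
    have ep: "exp (p t) = C t - z" if "t \<in> {0..1}" for t
    proof -
      have "1 + (M t - z) / S t \<noteq> 0" using notneg[OF that] by auto
      then show ?thesis unfolding p_def exp_add f(2)[symmetric] using S0[of t] by (simp add: Cz field_simps)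
    qed
    have cq: "continuous_on {0..1} q" using q(1) by (simp add: path_def)
    have dn: "\<exists>n::int. p t - q t = (of_int (2 * n) * pi) * \<i>" if "t \<in> {0..1}" for t
    proof -
      have "exp (p t) = exp (q t)" using ep[OF that] q(3)[OF that] by simp
      then show ?thesis unfolding exp_eq by (metis add_diff_cancel_left')
    qed
    have "(\<lambda>t. p t - q t) constant_on {0..1}"
      using cp cq dn by (intro constant_on_if_multiples continuous_intros) auto
    then have "p 1 - q 1 = p 0 - q 0" by (auto simp: constant_on_def)
    moreover have "q 1 = q 0" using q(2) w0 by (simp add: pathstart_def pathfinish_def)
    ultimately have "p 1 = p 0" by simp
    moreover have "S 1 = S 0" "M 1 = M 0" "f 1 = f 0 + 2 * J"
      using Sh[of 0] Sh[of "1/2"] Mh[of 0] Mh[of "1/2"] fh[of 0] fh[of "1/2"] by simp_all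
    ultimately have "J = 0" by (simp add: p_def)
    then show False using ImJ pi_gt3 by simp
  qed
  then show thesis using that \<rho> in1 in2 by blast
qed

text \<open>Extends \<open>c\<close> periodically, so that halving pairs need no case distinction.
  Across an integer the Lipschitz bound is obtained by passing through the common endpoint of
  \<open>c\<close>.\<close>

lemma near_circle:
  fixes c :: "real \<Rightarrow> complex"
  assumes lip: "L-lipschitz_on {0..1} c" and loop: "pathfinish c = pathstart c" and L: "0 < L"
    and \<epsilon>: "0 < \<epsilon>" "\<epsilon> \<le> 1 / 100" and r: "r = L / (2 * pi * (1 + \<epsilon>\<^sup>2))"
    and half: "\<And>t. t \<in> {0..<1/2} \<Longrightarrow> 2 * r \<le> dist (c t) (c (t + 1 / 2))"
  obtains z \<rho> where "0 < \<rho>" "\<rho> \<le> r" "path_image c \<subseteq> cball z ((1 + 3 * \<epsilon>) * \<rho>) - ball z \<rho>"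
    "winding_number c z \<noteq> 0"
proof -
  define C where "C t = c (frac t)" for t
  have c01: "c 1 = c 0" using loop by (simp add: pathstart_def pathfinish_def)
  have fr: "frac t \<in> {0..1}" for t :: real using frac_lt_1[of t] by (simp add: less_imp_le)
  have CL: "L-lipschitz_on UNIV C"
  proof (rule lipschitz_on_leI)
    fix u v :: real assume "u \<le> v"
    show "dist (C u) (C v) \<le> L * dist u v"
    proof (cases "\<lfloor>u\<rfloor> = \<lfloor>v\<rfloor>")
      case True
      then have "dist (frac u) (frac v) = dist u v" by (simp add: frac_def dist_real_def)
      then show ?thesis unfolding C_def using lipschitz_onD[OF lip fr fr, of u v] by simp
    next
      case False
      then have "\<lfloor>u\<rfloor> + 1 \<le> \<lfloor>v\<rfloor>" using floor_mono[OF \<open>u \<le> v\<close>] by linarith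
      then have *: "(1 - frac u) + frac v \<le> v - u" unfolding frac_def by linarith
      have "dist (C u) (C v) \<le> dist (c (frac u)) (c 1) + dist (c 0) (c (frac v))"
        unfolding C_def using dist_triangle[of "c (frac u)" "c (frac v)" "c 1"] c01 by simp
      also have "\<dots> \<le> L * dist (frac u) 1 + L * dist 0 (frac v)"
        using fr by (intro add_mono lipschitz_onD[OF lip]) auto
      also have "\<dots> = L * ((1 - frac u) + frac v)" using fr[of u] fr[of v] by (simp add: dist_real_def algebra_simps)
      also have "\<dots> \<le> L * (v - u)" using L * by (intro mult_left_mono) auto
      finally show ?thesis using \<open>u \<le> v\<close> by (simp add: dist_real_def)
    qed
  qed (use L in auto)
  have Cp: "C (t + 1) = C t" for t by (simp add: C_def frac_def)
  have Ch: "2 * r \<le> dist (C t) (C (t + 1 / 2))" for t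
  proof (cases "frac t < 1/2")
    case True
    then have "frac (t + 1/2) = frac t + 1/2" unfolding frac_add by (simp add: frac_eq[THEN iffD2])
    then show ?thesis using half[of "frac t"] True by (simp add: C_def)
  next
    case False
    have "frac (1/2 :: real) = 1/2" by (simp add: frac_eq)
    then have "frac (t + 1/2) = frac t - 1/2" unfolding frac_add using False by simp
    then show ?thesis using half[of "frac t - 1/2"] False frac_lt_1[of t] by (simp add: C_def dist_commute)
  qed
  have Cc: "C t = c t" if "t \<in> {0..1}" for t
    using that c01 by (cases "t = 1") (auto simp: C_def frac_eq[THEN iffD2])
  show thesis
  proof (rule near_circle_periodic[OF CL Cp L \<epsilon> r Ch])
    fix z \<rho> assume z: "0 < \<rho>" "\<rho> \<le> r" "\<And>t. t \<in> {0..1} \<Longrightarrow> \<rho> \<le> dist z (C t)"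
      "\<And>t. t \<in> {0..1} \<Longrightarrow> dist z (C t) \<le> (1 + 3 * \<epsilon>) * \<rho>" "winding_number C z \<noteq> 0"
    have "path_image c \<subseteq> cball z ((1 + 3 * \<epsilon>) * \<rho>) - ball z \<rho>"
    proof
      fix x assume "x \<in> path_image c"
      then obtain t where "t \<in> {0..1}" "x = C t" using Cc by (auto simp: path_image_def)
      then show "x \<in> cball z ((1 + 3 * \<epsilon>) * \<rho>) - ball z \<rho>" using z(3,4)[of t] by (simp add: not_less)
    qed
    moreover have "winding_number C z = winding_number c z" by (rule winding_number_cong) (simp add: Cc)
    ultimately show thesis by (intro that[of \<rho> z] z(1,2)) (use z(5) in auto)
  qed
qed

subsection \<open>Cycles and separation in plane graphs\<close>

abbreviation unseparated :: "complex set \<Rightarrow> complex \<Rightarrow> complex \<Rightarrow> bool" where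
  "unseparated K \<equiv> connected_component (- K)"

lemma unseparated_subset: "unseparated K x y \<Longrightarrow> K' \<subseteq> K \<Longrightarrow> unseparated K' x y"
  by (erule connected_component_of_subset) auto

text \<open>Used in both directions: to glue sets that do not separate, and to find a separating
  member when a union separates.\<close>

lemma unseparated_Un:
  assumes "compact S" "compact T" "connected (S \<inter> T)" "unseparated S x y" "unseparated T x y"
  shows "unseparated (S \<union> T) x y"
  by (rule Janiszewski[OF assms(1) compact_imp_closed[OF assms(2)] assms(3-5)])

lemma unseparated_Un_point:
  assumes "compact S" "compact T" "S \<inter> T \<subseteq> {a}" "unseparated S x y" "unseparated T x y"
  shows "unseparated (S \<union> T) x y"
proof (rule unseparated_Un[OF assms(1,2) _ assms(4,5)])
  show "connected (S \<inter> T)" using assms(3) by (metis connected_empty connected_sing subset_singletonD)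
qed

lemma unseparated_if_connected: "connected (- K) \<Longrightarrow> x \<notin> K \<Longrightarrow> y \<notin> K \<Longrightarrow> unseparated K x y"
  unfolding connected_component_def by blast

lemma unseparated_arc: "arc g \<Longrightarrow> x \<notin> path_image g \<Longrightarrow> y \<notin> path_image g \<Longrightarrow> unseparated (path_image g) x y"
  by (intro unseparated_if_connected connected_arc_complement) auto

definition body :: "(real \<Rightarrow> complex) set \<Rightarrow> complex set" where
  "body T = (\<Union>g\<in>T. path_image g)"

definition weight :: "(real \<Rightarrow> complex) set \<Rightarrow> real" where
  "weight T = (\<Sum>g\<in>T. len g 0 1)"

lemma body_insert: "body (insert g T) = path_image g \<union> body T"
  by (auto simp: body_def)

lemma body_mono: "S \<subseteq> T \<Longrightarrow> body S \<subseteq> body T"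
  by (auto simp: body_def)

lemma body_empty [simp]: "body {} = {}"
  by (simp add: body_def)

text \<open>Walks along whole edges without repeated vertices, together with their edge set and a
  path that runs through them. The ends differ, so the path is an arc; the trivial walk is excluded
  and has to be added in \<open>reach\<close>.\<close>

inductive trail :: "(real \<Rightarrow> complex) set \<Rightarrow> complex \<Rightarrow> complex \<Rightarrow> (real \<Rightarrow> complex) set \<Rightarrow> (real \<Rightarrow> complex) \<Rightarrow> bool"
  for S u where
  single: "h \<in> S \<Longrightarrow> c = h \<or> c = reversepath h \<Longrightarrow> pathstart c = u \<Longrightarrow> pathfinish c = v \<Longrightarrow> u \<noteq> v
    \<Longrightarrow> trail S u v {h} c"
| extend: "trail S u v T c \<Longrightarrow> h \<in> S \<Longrightarrow> c' = h \<or> c' = reversepath h \<Longrightarrow> pathstart c' = v \<Longrightarrow> pathfinish c' = w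
    \<Longrightarrow> w \<notin> path_image c \<Longrightarrow> trail S u w (insert h T) (c +++ c')"

section \<open>Elementary properties of plane graphs\<close>

locale plane_graph =
  fixes G :: embedded_graph
  assumes G: "finite_plane_graph G"
begin

abbreviation points :: "complex set" where
  "points \<equiv> graph_points G"

lemma finite_edges: "finite (edges G)" and finite_verts: "finite (verts G)"
  using G by (auto simp: finite_plane_graph_def)

lemma edge_simple: "g \<in> edges G \<Longrightarrow> simple_path g"
  and edge_ends: "g \<in> edges G \<Longrightarrow> pathstart g \<in> verts G \<and> pathfinish g \<in> verts G"
  and edge_open_verts: "g \<in> edges G \<Longrightarrow> g ` {0<..<1} \<inter> verts G = {}"
  using G by (auto simp: finite_plane_graph_def)

lemma edge_lipschitz: "g \<in> edges G \<Longrightarrow> \<exists>K. K-lipschitz_on {0..1} g"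
proof -
  assume "g \<in> edges G"
  then have "piecewise_C1 g" using G by (simp add: finite_plane_graph_def)
  then obtain K where "K-lipschitz_on {0..1} g" by (rule piecewise_C1_lipschitz)
  then show ?thesis ..
qed

lemma edge_path: "g \<in> edges G \<Longrightarrow> path g"
  using edge_simple simple_path_imp_path by blast

lemma path_image_eq_open: "path_image g = g ` {0<..<1} \<union> {pathstart g, pathfinish g}"
proof -
  have "{0..1::real} = {0<..<1} \<union> {0, 1}" by auto
  then show ?thesis unfolding path_image_def pathstart_def pathfinish_def by (metis image_Un image_insert image_empty)
qed

lemma edge_verts: "g \<in> edges G \<Longrightarrow> v \<in> path_image g \<Longrightarrow> v \<in> verts G \<Longrightarrow> v = pathstart g \<or> v = pathfinish g"
  using edge_open_verts[of g] path_image_eq_open[of g] by auto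

lemma edges_meet_in_verts:
  assumes "g \<in> edges G" "h \<in> edges G" "g \<noteq> h" "z \<in> path_image g" "z \<in> path_image h"
  shows "z \<in> verts G"
proof -
  have "z \<in> {pathstart g, pathfinish g}" using G assms unfolding finite_plane_graph_def by blast
  then show ?thesis using edge_ends[OF assms(1)] by auto
qed

lemma edge_open_unique:
  assumes "g \<in> edges G" "h \<in> edges G" "z \<in> g ` {0<..<1}" "z \<in> path_image h"
  shows "h = g"
  using edges_meet_in_verts[OF assms(1,2)] assms edge_open_verts[OF assms(1)] path_image_eq_open[of g] by blast

lemma edge_subset_points: "g \<in> edges G \<Longrightarrow> path_image g \<subseteq> points"
  and verts_subset_points: "verts G \<subseteq> points"
  by (auto simp: graph_points_def)

lemma graph_points_eq: "points = verts G \<union> body (edges G)"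
  by (auto simp: graph_points_def body_def)

lemma finite_sub_edges: "T \<subseteq> edges G \<Longrightarrow> finite T"
  using finite_edges finite_subset by blast

lemma compact_body: "T \<subseteq> edges G \<Longrightarrow> compact (body T)"
  unfolding body_def using finite_sub_edges edge_path by (intro compact_UN) (auto intro: compact_path_image)

lemma body_subset_points: "T \<subseteq> edges G \<Longrightarrow> body T \<subseteq> points"
  unfolding graph_points_eq using body_mono by blast

lemma compact_graph_points: "compact (points)"
proof -
  have "compact (body (edges G))" by (intro compact_body) simp
  then show ?thesis
    unfolding graph_points_eq by (intro compact_Un finite_imp_compact[OF finite_verts])
qed

lemma len_edge_nonneg: "g \<in> edges G \<Longrightarrow> 0 \<le> len g 0 1"
  using edge_lipschitz len_nonneg by (metis zero_le_one)

lemma weight_mono: "S \<subseteq> T \<Longrightarrow> T \<subseteq> edges G \<Longrightarrow> weight S \<le> weight T"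
  unfolding weight_def using len_edge_nonneg finite_sub_edges by (intro sum_mono2) auto

text \<open>The parameter interval of an edge is placed on the real axis, a null set of the plane,
  and Lipschitz maps preserve null sets. The purpose is that points off the graph are dense.\<close>

lemma negligible_graph_points: "negligible (points)"
proof -
  have "negligible (path_image g)" if g: "g \<in> edges G" for g
  proof -
    obtain K where K: "K-lipschitz_on {0..1} g" using edge_lipschitz g by blast
    define S where "S = {z. \<i> \<bullet> z = 0} \<inter> {z. Re z \<in> {0..1}}"
    have "negligible S" unfolding S_def
      by (intro negligible_subset[OF negligible_hyperplane[of "\<i>" 0]]) auto
    then have "negligible ((\<lambda>z. g (Re z)) ` S)"
    proof (rule negligible_locally_Lipschitz_image[rotated])
      fix z assume z: "z \<in> S"
      have "norm (g (Re w) - g (Re z)) \<le> K * norm (w - z)" if "w \<in> S" for w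
      proof -
        have "norm (g (Re w) - g (Re z)) \<le> K * \<bar>Re w - Re z\<bar>"
          using lipschitz_onD[OF K, of "Re w" "Re z"] z that by (simp add: S_def dist_norm)
        also have "\<dots> \<le> K * norm (w - z)"
          using abs_Re_le_cmod[of "w - z"] lipschitz_on_nonneg[OF K] by (intro mult_left_mono) auto
        finally show ?thesis .
      qed
      then show "\<exists>T B. open T \<and> z \<in> T \<and> (\<forall>w\<in>S \<inter> T. norm (g (Re w) - g (Re z)) \<le> B * norm (w - z))"
        by (intro exI[of _ UNIV] exI[of _ K]) auto
    qed auto
    moreover have "path_image g \<subseteq> (\<lambda>z. g (Re z)) ` S"
    proof
      fix z assume "z \<in> path_image g"
      then obtain t where "t \<in> {0..1}" "z = g t" by (auto simp: path_image_def)
      then show "z \<in> (\<lambda>z. g (Re z)) ` S"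
        by (intro image_eqI[of _ _ "complex_of_real t"]) (auto simp: S_def inner_complex_def)
    qed
    ultimately show ?thesis by (rule negligible_subset)
  qed
  then have "negligible (body (edges G))"
    unfolding body_def using finite_edges by (intro negligible_Union) auto
  then show ?thesis unfolding graph_points_eq
    using negligible_finite[OF finite_verts] by (rule negligible_Un[rotated])
qed

lemma closure_complement: "closure (- points) = UNIV"
proof -
  have "interior (points) = {}"
    using negligible_graph_points open_not_negligible[OF open_interior] negligible_subset interior_subset by metis
  then show ?thesis by (simp add: closure_complement)
qed

section \<open>Trails, reachability and cycles\<close>

text \<open>A new edge meets the edges of the trail only in vertices, hence in its own ends, and its
  far end is off the trail; so the extension is again an arc and the weights add.\<close>

lemma trail_props:
  assumes "S \<subseteq> edges G" "trail S u v T c"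
  shows "T \<subseteq> S" "arc c" "pathstart c = u" "pathfinish c = v" "path_image c = body T"
    "u \<in> verts G" "v \<in> verts G" "\<exists>K. K-lipschitz_on {0..1} c" "len c 0 1 \<le> weight T"
proof -
  have or: "arc c \<and> path_image c = path_image h \<and> pathstart c \<in> verts G \<and> pathfinish c \<in> verts G
      \<and> (\<exists>K. K-lipschitz_on {0..1} c) \<and> len c 0 1 \<le> len h 0 1"
    if hc: "h \<in> S" "c = h \<or> c = reversepath h" "pathstart c \<noteq> pathfinish c" for h c
  proof -
    have h: "h \<in> edges G" using hc assms(1) by auto
    obtain K where K: "K-lipschitz_on {0..1} h" using edge_lipschitz h by blast
    have "simple_path c" using edge_simple[OF h] hc(2) simple_path_reversepath by blast
    then have "arc c" using hc(3) simple_path_imp_arc by metis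
    moreover have "\<exists>K. K-lipschitz_on {0..1} c" using hc(2) K lipschitz_reversepath[OF K] by blast
    moreover have "path_image c = path_image h" "pathstart c \<in> verts G" "pathfinish c \<in> verts G" "len c 0 1 \<le> len h 0 1"
      using hc(2) edge_ends[OF h] len_reversepath_le[OF K] by auto
    ultimately show ?thesis by blast
  qed
  have "T \<subseteq> S \<and> arc c \<and> pathstart c = u \<and> pathfinish c = v \<and> path_image c = body T \<and>
    u \<in> verts G \<and> v \<in> verts G \<and> (\<exists>K. K-lipschitz_on {0..1} c) \<and> len c 0 1 \<le> weight T"
    using assms(2)
  proof induction
    case (single h c v)
    then show ?case using or[of h c] by (auto simp: body_insert weight_def)
  next
    case (extend v T c h c' w)
    have vc: "v \<in> path_image c" using extend.IH pathfinish_in_path_image by metis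
    have wne: "w \<noteq> v" using extend vc by auto
    then have o: "arc c'" "path_image c' = path_image h" "w \<in> verts G" "\<exists>K. K-lipschitz_on {0..1} c'" "len c' 0 1 \<le> len h 0 1"
      using or[of h c'] extend by auto
    have h: "h \<in> edges G" "h \<in> S" using extend assms(1) by auto
    have wh: "w \<in> path_image h" using extend.hyps o(2) pathfinish_in_path_image by metis
    have hT: "h \<notin> T" using extend.IH wh extend.hyps by (auto simp: body_def)
    have int: "path_image c \<inter> path_image c' \<subseteq> {pathstart c'}"
    proof
      fix z assume z: "z \<in> path_image c \<inter> path_image c'"
      then obtain g where g: "g \<in> T" "z \<in> path_image g" using extend.IH by (auto simp: body_def)
      then have "z \<in> verts G" using edges_meet_in_verts[of g h z] h hT z o(2) extend.IH assms(1) by blast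
      then have "z = pathstart h \<or> z = pathfinish h" using edge_verts[OF h(1)] z o(2) by auto
      then have "z = v \<or> z = w" using extend.hyps by auto
      then show "z \<in> {pathstart c'}" using z extend.hyps by auto
    qed
    have "arc (c +++ c')" using arc_join[of c c'] extend.IH extend.hyps o int by auto
    moreover have "path_image (c +++ c') = body (insert h T)"
      using path_image_join[of c c'] extend.IH extend.hyps o by (auto simp: body_insert)
    moreover obtain K K' where K: "K-lipschitz_on {0..1} c" "K'-lipschitz_on {0..1} c'" using extend.IH o by blast
    then have "len (c +++ c') 0 1 \<le> len c 0 1 + len c' 0 1" "\<exists>K. K-lipschitz_on {0..1} (c +++ c')"
      using len_join_le[OF K] lipschitz_join[OF K] extend.IH extend.hyps by auto
    moreover have "weight (insert h T) = len h 0 1 + weight T"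
      unfolding weight_def using hT extend.IH assms(1) finite_sub_edges[of T] by (intro sum.insert) auto
    ultimately show ?case using extend o h by auto
  qed
  then show "T \<subseteq> S" "arc c" "pathstart c = u" "pathfinish c = v" "path_image c = body T"
    "u \<in> verts G" "v \<in> verts G" "\<exists>K. K-lipschitz_on {0..1} c" "len c 0 1 \<le> weight T" by auto
qed

text \<open>A trail can be stopped at any vertex that it passes.\<close>

lemma trail_vertex:
  assumes "S \<subseteq> edges G" "trail S u v T c" "w \<in> verts G" "w \<in> path_image c"
  shows "w = u \<or> (\<exists>T c. trail S u w T c)"
  using assms(2,4)
proof induction
  case (single h c v)
  have "w = pathstart h \<or> w = pathfinish h"
    using edge_verts[of h w] single assms(1,3) by auto
  then show ?case using single trail.single[of h S c u v] by auto
next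
  case (extend v T c h c' w')
  have "pathfinish c = v" using trail_props[OF assms(1) extend.hyps(1)] by auto
  then have "w \<in> path_image c \<or> w \<in> path_image h" using extend.prems extend.hyps path_image_join[of c c'] by auto
  then consider "w \<in> path_image c" | "w = pathstart h" | "w = pathfinish h"
    using edge_verts[of h w] extend.hyps assms(1,3) by blast
  then have "w \<in> path_image c \<or> w = v \<or> w = w'" using extend.hyps by cases auto
  then show ?case using extend.IH trail.extend[OF extend.hyps] extend.hyps(1) by blast
qed

definition reach :: "(real \<Rightarrow> complex) set \<Rightarrow> complex \<Rightarrow> complex set" where
  "reach S u = {v. v = u \<or> (\<exists>T c. trail S u v T c)}"

text \<open>The trail is extended along the edge unless it already passes the far end, in which case
  an initial part of it suffices.\<close>

lemma reach_edge:
  assumes "S \<subseteq> edges G" "h \<in> S" "c = h \<or> c = reversepath h" "pathstart c \<in> reach S u"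
  shows "pathfinish c \<in> reach S u"
proof (cases "pathfinish c = u")
  case False
  have fv: "pathfinish c \<in> verts G" using edge_ends[of h] assms by auto
  consider "pathstart c = u" | T d where "trail S u (pathstart c) T d" using assms(4) by (auto simp: reach_def)
  then show ?thesis
  proof cases
    case 1
    then show ?thesis using trail.single[OF assms(2,3), of u] False by (auto simp: reach_def)
  next
    case 2
    then show ?thesis
      using trail_vertex[OF assms(1) 2 fv] trail.extend[OF 2 assms(2,3)] by (cases "pathfinish c \<in> path_image d") (auto simp: reach_def)
  qed
qed (auto simp: reach_def)

text \<open>A cycle is its edge set; the closed curve is only a witness. The bound by the weight
  makes the constant-speed parametrization Lipschitz with constant \<open>weight T\<close>.\<close>

definition is_cycle :: "(real \<Rightarrow> complex) set \<Rightarrow> (real \<Rightarrow> complex) \<Rightarrow> bool" where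
  "is_cycle T c \<longleftrightarrow> T \<subseteq> edges G \<and> simple_path c \<and> pathfinish c = pathstart c \<and> path_image c = body T
     \<and> (\<exists>K. K-lipschitz_on {0..1} c) \<and> len c 0 1 \<le> weight T"

lemma body_int_edge:
  assumes "S \<subseteq> edges G" "e \<in> edges G" "e \<notin> S" "z \<in> body S" "z \<in> path_image e"
  shows "z = pathstart e \<or> z = pathfinish e"
proof -
  obtain g where "g \<in> S" "z \<in> path_image g" using assms by (auto simp: body_def)
  then show ?thesis using edges_meet_in_verts[of g e z] edge_verts[of e z] assms by blast
qed

text \<open>Induction on the edges.  A new edge whose ends are joined by a trail in the old edges forms a cycle
  with that trail, and this cycle meets the old edges exactly in the trail, which is connected; so
  Janiszewski's theorem applies.\<close>

lemma unseparated_body: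
  assumes "S \<subseteq> edges G" "x \<notin> points" "y \<notin> points"
    and "\<And>T c. T \<subseteq> S \<Longrightarrow> is_cycle T c \<Longrightarrow> unseparated (body T) x y"
  shows "unseparated (body S) x y"
  using finite_sub_edges[OF assms(1)] assms(1,4)
proof (induction S rule: finite_induct)
  case empty
  show ?case unfolding connected_component_def body_empty by (intro exI[of _ UNIV]) auto
next
  case (insert e S)
  have S: "S \<subseteq> edges G" and e: "e \<in> edges G" using insert.prems by auto
  have IH: "unseparated (body S) x y" using insert by blast
  have cS: "compact (body S)" "compact (path_image e)"
    using compact_body[OF S] edge_path[OF e] by (auto intro: compact_path_image)
  have xy: "x \<notin> path_image e" "y \<notin> path_image e" using assms(2,3) edge_subset_points[OF e] by auto
  define u v where "u = pathstart e" and "v = pathfinish e"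
  have int: "body S \<inter> path_image e \<subseteq> {u, v}"
    using body_int_edge[OF S e insert.hyps(2)] by (auto simp: u_def v_def)
  obtain K where K: "K-lipschitz_on {0..1} e" using edge_lipschitz e by blast
  show ?case
  proof (cases "u = v")
    case True
    have "is_cycle {e} e" unfolding is_cycle_def
      using e K edge_simple[OF e] True by (auto simp: body_insert weight_def u_def v_def)
    then have "unseparated (path_image e) x y" using insert.prems(2)[of "{e}" e] by (simp add: body_insert)
    then show ?thesis unfolding body_insert
      using unseparated_Un_point[OF cS _ IH, of u] int True by (simp add: Un_commute)
  next
    case False
    have arc_e: "arc e" using edge_simple[OF e] False by (simp add: simple_path_imp_arc u_def v_def)
    show ?thesis
    proof (cases "v \<in> reach S u")
      case True
      then obtain T c where Tc: "trail S u v T c" using False by (auto simp: reach_def)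
      note tp = trail_props[OF S Tc]
      define d where "d = c +++ reversepath e"
      have TE: "T \<subseteq> edges G" using tp S by auto
      have eT: "e \<notin> T" using tp insert.hyps by auto
      obtain K' where K': "K'-lipschitz_on {0..1} c" using tp by blast
      have im: "path_image d = body (insert e T)"
        unfolding d_def using tp by (simp add: path_image_join v_def body_insert Un_commute)
      have "path_image c \<inter> path_image (reversepath e) \<subseteq> {pathstart c, pathstart (reversepath e)}"
        using body_int_edge[OF TE e eT] tp by (auto simp: u_def v_def)
      then have "simple_path d" unfolding d_def
        using tp arc_e by (intro simple_path_join_loop) (auto simp: u_def v_def arc_reversepath)
      moreover have "pathfinish d = pathstart d" unfolding d_def using tp by (simp add: u_def)
      moreover have "\<exists>K. K-lipschitz_on {0..1} d" "len d 0 1 \<le> len c 0 1 + len (reversepath e) 0 1"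
        unfolding d_def using tp lipschitz_join[OF K' lipschitz_reversepath[OF K]] len_join_le[OF K' lipschitz_reversepath[OF K]]
        by (auto simp: v_def)
      moreover have "weight (insert e T) = len e 0 1 + weight T"
        unfolding weight_def using eT finite_sub_edges[OF TE] by (intro sum.insert)
      ultimately have "is_cycle (insert e T) d"
        unfolding is_cycle_def using im TE e tp len_reversepath_le[OF K] by auto
      then have un: "unseparated (body (insert e T)) x y" using insert.prems(2)[of "insert e T" d] tp by auto
      have "body S \<inter> body (insert e T) = path_image c"
      proof -
        have "u \<in> path_image c" "v \<in> path_image c"
          using tp pathstart_in_path_image pathfinish_in_path_image by metis+
        then show ?thesis using int tp body_mono[OF tp(1)] unfolding body_insert by auto
      qed
      then have "connected (body S \<inter> body (insert e T))"
        using connected_path_image[OF arc_imp_path[OF tp(2)]] by simp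
      moreover have "compact (body (insert e T))" using TE e by (intro compact_body) simp
      ultimately have "unseparated (body S \<union> body (insert e T)) x y"
        using unseparated_Un[OF cS(1) _ _ IH un] by blast
      moreover have "body S \<union> body (insert e T) = body (insert e S)"
        using body_mono[OF tp(1)] by (auto simp: body_insert)
      ultimately show ?thesis by simp
    next
      case nr: False
      \<comment> \<open>No trail in \<open>S\<close> joins the ends of \<open>e\<close>. The edges
        attached to \<open>u\<close> and the remaining ones have disjoint bodies; \<open>e\<close>
        meets the former at most in \<open>u\<close> and the latter at most in \<open>v\<close>, so
        all three are glued along at most single points.\<close>
      define S1 where "S1 = {g \<in> S. pathstart g \<in> reach S u \<or> pathfinish g \<in> reach S u}"
      define S2 where "S2 = S - S1"
      have both: "pathstart g \<in> reach S u \<and> pathfinish g \<in> reach S u" if "g \<in> S1" for g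
        using that reach_edge[OF S, of g g u] reach_edge[OF S, of g "reversepath g" u] by (auto simp: S1_def)
      have vert1: "z \<in> reach S u" if "z \<in> body S1" "z \<in> verts G" for z
      proof -
        obtain g where g: "g \<in> S1" "z \<in> path_image g" using \<open>z \<in> body S1\<close> by (auto simp: body_def)
        then have "z = pathstart g \<or> z = pathfinish g" using edge_verts[of g z] that S by (auto simp: S1_def)
        then show ?thesis using both[OF g(1)] by auto
      qed
      have vert2: "z \<notin> reach S u" if "z \<in> body S2" "z \<in> verts G" for z
      proof -
        obtain g where g: "g \<in> S2" "z \<in> path_image g" using \<open>z \<in> body S2\<close> by (auto simp: body_def)
        then have "z = pathstart g \<or> z = pathfinish g" using edge_verts[of g z] that S by (auto simp: S2_def)
        then show ?thesis using g by (auto simp: S1_def S2_def)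
      qed
      have disj: "body S1 \<inter> body S2 = {}"
      proof (rule ccontr)
        assume "\<not> ?thesis"
        then obtain z where z: "z \<in> body S1" "z \<in> body S2" by auto
        then obtain g h where gh: "g \<in> S1" "z \<in> path_image g" "h \<in> S2" "z \<in> path_image h" by (auto simp: body_def)
        then have "z \<in> verts G" using edges_meet_in_verts[of g h z] S by (auto simp: S1_def S2_def)
        then show False using vert1 vert2 z by blast
      qed
      have uv: "u \<in> verts G" "v \<in> verts G" "u \<in> reach S u" using edge_ends[OF e] by (auto simp: u_def v_def reach_def)
      have sub: "body S1 \<subseteq> body S" "body S2 \<subseteq> body S" "body S = body S1 \<union> body S2"
        by (auto simp: body_def S1_def S2_def)
      have c12: "compact (body S1)" "compact (body S2)" using S by (auto intro!: compact_body simp: S1_def S2_def)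
      have "unseparated (body S1 \<union> path_image e) x y"
      proof (rule unseparated_Un_point[OF c12(1) cS(2)])
        show "body S1 \<inter> path_image e \<subseteq> {u}" using int sub vert1 nr uv by auto
        show "unseparated (body S1) x y" using IH sub(1) by (rule unseparated_subset)
        show "unseparated (path_image e) x y" using arc_e xy by (rule unseparated_arc)
      qed
      then have "unseparated ((body S1 \<union> path_image e) \<union> body S2) x y"
      proof (rule unseparated_Un_point[rotated 3])
        show "compact (body S1 \<union> path_image e)" "compact (body S2)" using c12 cS by auto
        show "(body S1 \<union> path_image e) \<inter> body S2 \<subseteq> {v}" using int sub vert2 uv disj by auto
        show "unseparated (body S2) x y" using IH sub(2) by (rule unseparated_subset)
      qed
      then show ?thesis using sub(3) by (simp add: body_insert Un_ac)
    qed
  qed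
qed

text \<open>The part of \<open>K\<close> on an incompletely covered edge is contained in two arcs dangling from vertices,
  which Janiszewski's theorem allows to remove.\<close>

lemma separates_full_edges:
  assumes K: "compact K" "K \<subseteq> points" and x: "x \<notin> points" and y: "y \<notin> points"
    and "\<not> unseparated K x y"
  shows "\<not> unseparated (body {g \<in> edges G. path_image g \<subseteq> K}) x y"
proof
  define S where "S = {g \<in> edges G. path_image g \<subseteq> K}"
  assume "unseparated (body {g \<in> edges G. path_image g \<subseteq> K}) x y"
  then have un: "unseparated (body S) x y" by (simp add: S_def)
  have S: "S \<subseteq> edges G" by (auto simp: S_def)
  \<comment> \<open>Adding all vertices in advance ensures that later arcs are attached at points
    already present.\<close>
  have "unseparated (body S \<union> W) x y" if "finite W" "W \<subseteq> verts G" for W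
    using that
  proof (induction W)
    case (insert w W)
    have "unseparated ((body S \<union> W) \<union> {w}) x y"
    proof (rule unseparated_Un_point[where a = w])
      show "compact (body S \<union> W)" using compact_body[OF S] insert by (auto intro: finite_imp_compact)
      show "unseparated (body S \<union> W) x y" using insert by auto
      have "connected (- {w})" by (rule connected_punctured_universe) simp
      then show "unseparated {w} x y"
        using insert.prems x y verts_subset_points by (intro unseparated_if_connected) auto
    qed auto
    then show ?case by simp
  qed (use un in simp)
  then have unv: "unseparated (body S \<union> verts G) x y" using finite_verts by blast
  \<comment> \<open>Induction over the incompletely covered edges: \<open>Z\<close> contains the
    part of \<open>K\<close> on the edges treated so far and avoids the open parts of the others, so
    the next pair of arcs meets it only at the ends of their edge.\<close>
  have "\<exists>Z. compact Z \<and> body S \<union> verts G \<subseteq> Z \<and> K \<inter> body F \<subseteq> Z \<and> unseparated Z x y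
      \<and> (\<forall>h \<in> edges G - S - F. Z \<inter> h ` {0<..<1} = {})" if "finite F" "F \<subseteq> edges G - S" for F
    using that
  proof (induction F)
    case empty
    have "compact (body S \<union> verts G)" using compact_body[OF S] finite_verts by (auto intro: finite_imp_compact)
    moreover have "(body S \<union> verts G) \<inter> h ` {0<..<1} = {}" if "h \<in> edges G - S" for h
    proof -
      have "body S \<inter> h ` {0<..<1} = {}"
        using edge_open_unique[of h] that S by (auto simp: body_def)
      then show ?thesis using edge_open_verts[of h] that by auto
    qed
    ultimately show ?case using unv by (intro exI[of _ "body S \<union> verts G"]) auto
  next
    case (insert g F)
    then obtain Z where Z: "compact Z" "body S \<union> verts G \<subseteq> Z" "K \<inter> body F \<subseteq> Z" "unseparated Z x y"
      "\<And>h. h \<in> edges G - S - F \<Longrightarrow> Z \<inter> h ` {0<..<1} = {}" by auto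
    have g: "g \<in> edges G" "g \<notin> S" using insert.prems by auto
    have gc: "continuous_on {0..1} g" using edge_path[OF g(1)] by (simp add: path_def)
    have Zg: "Z \<inter> g ` {0<..<1} = {}" using Z(5) insert by auto
    have "open (- K)" using K(1) compact_imp_closed by blast
    then obtain A where A: "open A" "A \<inter> {0..1} = g -` (- K) \<inter> {0..1}"
      using continuous_on_open_invariant[THEN iffD1, OF gc] by blast
    have A_iff: "t \<in> A \<longleftrightarrow> g t \<notin> K" if "t \<in> {0..1}" for t
      using A(2) that by blast
    \<comment> \<open>The uncovered point may be an end of the edge. As the complement of
      \<open>K\<close> is open, the parameter can be moved into the open interval.\<close>
    obtain t0 where t0: "0 < t0" "t0 < 1" "g t0 \<notin> K"
    proof -
      have "\<not> path_image g \<subseteq> K" using g by (simp add: S_def)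
      then obtain t where t: "t \<in> {0..1}" "g t \<notin> K" unfolding path_image_def by blast
      then have "t \<in> A" using A_iff by blast
      then obtain d where d: "d > 0" "ball t d \<subseteq> A" using A(1) openE by blast
      define m where "m = min d (1/2) / 2"
      have m: "0 < m" "m < d" "m < 1/2" unfolding m_def using d(1) by (auto simp: min_def)
      define s where "s = (if t < 1/2 then t + m else t - m)"
      have "s \<in> ball t d" "0 < s" "s < 1" using m t(1) by (auto simp: s_def dist_real_def)
      then have "s \<in> A" "s \<in> {0..1}" using d(2) by auto
      then have "g s \<notin> K" using A_iff by blast
      then show thesis using that \<open>0 < s\<close> \<open>s < 1\<close> by blast
    qed
    have "t0 \<in> A" using A_iff[of t0] t0 by simp
    then obtain d where d: "d > 0" "ball t0 d \<subseteq> A" using A(1) openE by blast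
    define m where "m = min d (min t0 (1 - t0)) / 2"
    have m: "0 < m" "m < d" "m < t0" "m < 1 - t0" unfolding m_def using d(1) t0 by (auto simp: min_def)
    define a b where "a = t0 - m" and "b = t0 + m"
    have ab: "0 < a" "a < t0" "t0 < b" "b < 1" using m by (auto simp: a_def b_def)
    have "{a<..<b} \<subseteq> ball t0 d"
    proof
      fix t assume "t \<in> {a<..<b}"
      then have "\<bar>t0 - t\<bar> < m" unfolding a_def b_def by auto
      then show "t \<in> ball t0 d" using m(2) by (simp add: dist_real_def)
    qed
    then have abA: "{a<..<b} \<subseteq> A" using d(2) by (rule subset_trans)
    have gap: "g t \<notin> K" if "a < t" "t < b" for t
    proof -
      have "t \<in> A" using abA that by auto
      moreover have "t \<in> {0..1}" using that ab by simp
      ultimately show ?thesis using A_iff by blast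
    qed
    have arcs: "arc (subpath 0 a g)" "arc (subpath b 1 g)"
    proof -
      have "g s \<noteq> g t" if "s \<in> {0..1}" "t \<in> {0..1}" "s < t" "s \<noteq> 0 \<or> t \<noteq> 1" for s t
        using simple_path_eqD[OF edge_simple[OF g(1)], of s t] that by auto
      then have "g 0 \<noteq> g a" "g b \<noteq> g 1" using ab by auto
      then show "arc (subpath 0 a g)" "arc (subpath b 1 g)"
        using ab edge_simple[OF g(1)] by (auto intro!: arc_simple_path_subpath)
    qed
    have im: "path_image (subpath 0 a g) = g ` {0..a}" "path_image (subpath b 1 g) = g ` {b..1}"
      using ab by (auto simp: path_image_subpath)
    have subX: "g ` {0..a} \<subseteq> path_image g" "g ` {b..1} \<subseteq> path_image g"
      using ab by (auto simp: path_image_def)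
    have xya: "x \<notin> g ` {0..a}" "y \<notin> g ` {0..a}" "x \<notin> g ` {b..1}" "y \<notin> g ` {b..1}"
      using subX edge_subset_points[OF g(1)] x y by blast+
    have cc: "compact (g ` {0..a})" "compact (g ` {b..1})"
      using arcs im by (metis arc_imp_path compact_path_image)+
    have 1: "unseparated (Z \<union> g ` {0..a}) x y"
    proof (rule unseparated_Un_point[OF Z(1) cc(1) _ Z(4)])
      show "Z \<inter> g ` {0..a} \<subseteq> {g 0}"
      proof
        fix z assume "z \<in> Z \<inter> g ` {0..a}"
        then obtain t where t: "t \<in> {0..a}" "z = g t" "g t \<in> Z" by auto
        then have "\<not> (0 < t \<and> t < 1)" using Zg by auto
        then show "z \<in> {g 0}" using t ab by (auto simp: order.order_iff_strict)
      qed
      show "unseparated (g ` {0..a}) x y" using unseparated_arc[OF arcs(1)] xya im by auto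
    qed
    have 2: "unseparated ((Z \<union> g ` {0..a}) \<union> g ` {b..1}) x y"
    proof (rule unseparated_Un_point[OF compact_Un[OF Z(1) cc(1)] cc(2) _ 1])
      \<comment> \<open>If the edge is a loop, the two arcs also meet each other, but in
        \<open>g 1\<close> as well, so a single common point remains.\<close>
      show "(Z \<union> g ` {0..a}) \<inter> g ` {b..1} \<subseteq> {g 1}"
      proof
        fix z assume z: "z \<in> (Z \<union> g ` {0..a}) \<inter> g ` {b..1}"
        then obtain t where t: "t \<in> {b..1}" "z = g t" by auto
        show "z \<in> {g 1}"
        proof (cases "t = 1")
          case False
          then have "t \<in> {0<..<1}" using t(1) ab by auto
          then have "z \<notin> Z" using Zg t(2) by blast
          then obtain s where s: "s \<in> {0..a}" "g s = g t" using z t(2) by auto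
          have "s \<in> {0..1}" "t \<in> {0..1}" using s(1) t(1) ab by auto
          then have "s = t \<or> s = 0 \<and> t = 1 \<or> s = 1 \<and> t = 0"
            by (rule simple_path_eqD[OF edge_simple[OF g(1)] s(2)])
          moreover have "s < t" "s \<noteq> 1" using s(1) t(1) ab by auto
          ultimately show ?thesis using False by auto
        qed (use t in auto)
      qed
      show "unseparated (g ` {b..1}) x y" using unseparated_arc[OF arcs(2)] xya im by auto
    qed
    show ?case
    proof (intro exI[of _ "(Z \<union> g ` {0..a}) \<union> g ` {b..1}"] conjI ballI)
      show "compact ((Z \<union> g ` {0..a}) \<union> g ` {b..1})" using Z(1) cc by auto
      show "body S \<union> verts G \<subseteq> (Z \<union> g ` {0..a}) \<union> g ` {b..1}" using Z(2) by auto
      show "unseparated ((Z \<union> g ` {0..a}) \<union> g ` {b..1}) x y" by (rule 2)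
      have "K \<inter> path_image g \<subseteq> g ` {0..a} \<union> g ` {b..1}"
      proof
        fix z assume "z \<in> K \<inter> path_image g"
        then obtain t where t: "t \<in> {0..1}" "z = g t" "g t \<in> K" by (auto simp: path_image_def)
        then have "\<not> (a < t \<and> t < b)" using gap by auto
        then show "z \<in> g ` {0..a} \<union> g ` {b..1}" using t by auto
      qed
      then show "K \<inter> body (insert g F) \<subseteq> (Z \<union> g ` {0..a}) \<union> g ` {b..1}"
        using Z(3) unfolding body_insert by blast
      fix h assume h: "h \<in> edges G - S - insert g F"
      have "path_image g \<inter> h ` {0<..<1} = {}" using edge_open_unique[of h g] h g by auto
      then show "((Z \<union> g ` {0..a}) \<union> g ` {b..1}) \<inter> h ` {0<..<1} = {}"
        using Z(5)[of h] h subX by blast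
    qed
  qed
  from this[of "edges G - S"] obtain Z where Z: "body S \<union> verts G \<subseteq> Z" "K \<inter> body (edges G - S) \<subseteq> Z" "unseparated Z x y"
    using finite_edges by auto
  have "K \<subseteq> Z"
  proof
    fix z assume z: "z \<in> K"
    then have "z \<in> verts G \<or> z \<in> body S \<or> z \<in> body (edges G - S)"
      using K(2) by (auto simp: graph_points_def body_def)
    then show "z \<in> Z" using Z z by blast
  qed
  then show False using unseparated_subset[OF Z(3)] assms(5) by blast
qed

subsection \<open>Shortest enclosing cycles\<close>

text \<open>One point replaces infinity for all subsets of the graph at once, so that lying inside
  such a set becomes separation from a fixed point.\<close>

lemma exists_far_point:
  "\<exists>y. y \<notin> points \<and> (\<forall>K. K \<subseteq> points \<longrightarrow> y \<in> outside K)"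
proof -
  obtain B where B: "points \<subseteq> ball 0 B" "0 < B"
    using compact_graph_points compact_imp_bounded bounded_subset_ballD by blast
  have far: "complex_of_real B \<notin> ball 0 B" using B by simp
  show ?thesis
  proof (intro exI[of _ "complex_of_real B"] conjI allI impI)
    show "complex_of_real B \<notin> points" using B(1) far by blast
    fix K assume "K \<subseteq> points"
    then have "- ball 0 B \<subseteq> outside K" using B(1) by (intro outside_subset_convex) auto
    then show "complex_of_real B \<in> outside K" using far by blast
  qed
qed

lemma unseparated_iff_outside:
  assumes "K \<subseteq> points" "y \<in> outside K"
  shows "unseparated K x y \<longleftrightarrow> x \<in> outside K"
proof
  assume "unseparated K x y"
  then show "x \<in> outside K"
    using outside_same_component[OF connected_component_sym assms(2)] by blast
next
  assume "x \<in> outside K"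
  moreover have "bounded K" using assms(1) bounded_subset compact_graph_points compact_imp_bounded by blast
  then have "connected (outside K)" by (intro connected_outside) auto
  moreover have "outside K \<subseteq> - K" by (auto simp: outside_def)
  ultimately show "unseparated K x y" using assms(2) unfolding connected_component_def by blast
qed

lemma not_unseparated_iff_inside:
  assumes "K \<subseteq> points" "y \<in> outside K" "x \<notin> points"
  shows "\<not> unseparated K x y \<longleftrightarrow> x \<in> inside K"
proof -
  have "x \<in> - K" using assms by auto
  then show ?thesis unfolding unseparated_iff_outside[OF assms(1,2)]
    using inside_Un_outside[of K] inside_Int_outside[of K] by blast
qed

definition cycles :: "(real \<Rightarrow> complex) set set" where
  "cycles = {T. \<exists>c. is_cycle T c}"

lemma cycles_edges: "T \<in> cycles \<Longrightarrow> T \<subseteq> edges G"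
  by (auto simp: cycles_def is_cycle_def)

lemma finite_cycles: "finite cycles"
  using finite_edges cycles_edges by (intro finite_subset[of cycles "Pow (edges G)"]) auto

lemma inside_body_cycle:
  assumes "S \<subseteq> edges G" "x \<notin> points" "x \<in> inside (body S)"
  obtains T where "T \<in> cycles" "T \<subseteq> S" "x \<in> inside (body T)"
proof -
  obtain y where y: "y \<notin> points" "\<And>K. K \<subseteq> points \<Longrightarrow> y \<in> outside K"
    using exists_far_point by blast
  have "\<not> unseparated (body S) x y"
    using not_unseparated_iff_inside body_subset_points[OF assms(1)] y assms(2,3) by blast
  then obtain T c where T: "T \<subseteq> S" "is_cycle T c" "\<not> unseparated (body T) x y"
    using unseparated_body[OF assms(1,2) y(1)] by blast
  then have TX: "body T \<subseteq> points" using assms(1) body_subset_points by blast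
  have "x \<in> inside (body T)" using not_unseparated_iff_inside[OF TX y(2)[OF TX] assms(2)] T(3) by blast
  then show thesis using that T by (auto simp: cycles_def)
qed

text \<open>The bridge from arbitrary paths to edges: the completely covered edges alone enclose
  \<open>x\<close>, a cycle is extracted from them, and its edges are together no longer than the
  paths that cover them.\<close>

lemma inside_paths_cycle:
  fixes s :: "'j \<Rightarrow> real \<Rightarrow> complex"
  assumes J: "finite J" and s: "\<And>j. j \<in> J \<Longrightarrow> path (s j)" "\<And>j. j \<in> J \<Longrightarrow> path_image (s j) \<subseteq> points"
    and x: "x \<notin> points" "x \<in> inside (\<Union>j\<in>J. path_image (s j))"
  obtains T where "T \<in> cycles" "x \<in> inside (body T)" "ennreal (weight T) \<le> (\<Sum>j\<in>J. curve_length (s j))"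
proof -
  obtain y where y: "y \<notin> points" "\<And>K. K \<subseteq> points \<Longrightarrow> y \<in> outside K"
    using exists_far_point by blast
  let ?K = "\<Union>j\<in>J. path_image (s j)"
  have "?K \<subseteq> points" using s(2) by blast
  then have sep: "\<not> unseparated ?K x y"
    using not_unseparated_iff_inside y x by blast
  let ?S = "{g \<in> edges G. path_image g \<subseteq> ?K}"
  have "compact ?K" using J s(1) by (intro compact_UN) (auto intro: compact_path_image)
  then have "\<not> unseparated (body ?S) x y" using separates_full_edges[of ?K x y] s(2) x(1) y(1) sep by blast
  moreover have SX: "body ?S \<subseteq> points" by (intro body_subset_points) auto
  ultimately have xS: "x \<in> inside (body ?S)"
    using not_unseparated_iff_inside[OF SX y(2)[OF SX] x(1)] by simp
  have "?S \<subseteq> edges G" by auto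
  then obtain T where T: "T \<in> cycles" "T \<subseteq> ?S" "x \<in> inside (body T)"
    using x(1) xS by (rule inside_body_cycle)
  have "\<exists>K. \<forall>g\<in>edges G. (K g)-lipschitz_on {0..1} g" using edge_lipschitz by metis
  then obtain K where K: "\<And>g. g \<in> edges G \<Longrightarrow> (K g)-lipschitz_on {0..1} g" by blast
  have TE: "T \<subseteq> edges G" using T by auto
  have "ennreal (\<Sum>g\<in>T. len g 0 1) \<le> (\<Sum>j\<in>J. curve_length (s j))"
  proof (rule sum_len_le_curve_length_cover[where K = K])
    show "g ` {0<..<1} \<inter> h ` {0<..<1} = {}" if "g \<in> T" "h \<in> T" "g \<noteq> h" for g h
      using edge_open_unique[of g h] that TE path_image_eq_open[of h] by blast
  qed (use T TE finite_sub_edges J s edge_simple K in auto)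
  then show thesis using that T by (simp add: weight_def)
qed

lemma cycle_regions:
  assumes "T \<in> cycles"
  shows "open (inside (body T))" "connected (inside (body T))" "bounded (inside (body T))"
    "open (outside (body T))" "connected (outside (body T))" "\<not> bounded (outside (body T))"
    "frontier (inside (body T)) = body T" "frontier (outside (body T)) = body T"
    "inside (body T) \<inter> outside (body T) = {}" "inside (body T) \<union> outside (body T) = - body T"
proof -
  obtain c where "is_cycle T c" using assms by (auto simp: cycles_def)
  then have "simple_path c" "pathfinish c = pathstart c" "path_image c = body T" by (auto simp: is_cycle_def)
  then show "open (inside (body T))" "connected (inside (body T))" "bounded (inside (body T))"
    "open (outside (body T))" "connected (outside (body T))" "\<not> bounded (outside (body T))"
    "frontier (inside (body T)) = body T" "frontier (outside (body T)) = body T"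
    "inside (body T) \<inter> outside (body T) = {}" "inside (body T) \<union> outside (body T) = - body T"
    using Jordan_inside_outside[of c] by auto
qed

lemma cycle_regions_closure:
  assumes "T \<in> cycles"
  shows "inside (body T) \<inter> closure (outside (body T)) = {}" "outside (body T) \<inter> closure (inside (body T)) = {}"
  unfolding open_Int_closure_eq_empty[OF cycle_regions(1)[OF assms]]
    open_Int_closure_eq_empty[OF cycle_regions(4)[OF assms]]
  using cycle_regions(9)[OF assms] by (simp_all add: Int_commute)

lemma edge_in_closure: "g \<in> edges G \<Longrightarrow> path_image g \<subseteq> closure (g ` {0<..<1})"
proof -
  assume "g \<in> edges G"
  then have "continuous_on {0..1} g" using edge_path by (simp add: path_def)
  then have "g ` closure {0<..<1} \<subseteq> closure (g ` {0<..<1})"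
    by (intro image_closure_subset closure_subset) auto
  then show ?thesis by (simp add: path_image_def)
qed

definition is_min :: "(real \<Rightarrow> complex) set \<Rightarrow> complex \<Rightarrow> bool" where
  "is_min T x \<longleftrightarrow> T \<in> cycles \<and> x \<in> inside (body T)
     \<and> (\<forall>T'\<in>cycles. x \<in> inside (body T') \<longrightarrow> weight T \<le> weight T')"

lemma lipschitz_subpath:
  fixes c :: "real \<Rightarrow> complex"
  assumes "L-lipschitz_on {0..1} c" "0 \<le> a" "a \<le> b" "b \<le> 1"
  shows "(L * (b - a))-lipschitz_on {0..1} (subpath a b c)"
proof -
  have "(b - a) * t + a \<in> {0..1}" if "t \<in> {0..1}" for t
  proof -
    have "0 \<le> (b - a) * t" "(b - a) * t \<le> b - a" using that assms by (auto intro: mult_right_le_one_le)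
    then show ?thesis using assms by auto
  qed
  then have "(L * \<bar>b - a\<bar>)-lipschitz_on {0..1} (\<lambda>t. c ((b - a) * t + a))"
    by (intro lipschitz_on_affine[OF assms(1)])
  then show ?thesis using assms(3) by (simp add: subpath_def)
qed

lemma curve_length_subpath_le:
  fixes c :: "real \<Rightarrow> complex"
  assumes "L-lipschitz_on {0..1} c" "0 \<le> a" "a \<le> b" "b \<le> 1"
  shows "curve_length (subpath a b c) \<le> ennreal (L * (b - a))"
  unfolding curve_length_lipschitz[OF lipschitz_subpath[OF assms]]
  using len_le_lipschitz[OF lipschitz_subpath[OF assms]] by (intro ennreal_leI) simp

text \<open>The path \<open>s\<close> together with either half of the cycle forms two sets that
  intersect exactly in \<open>s\<close>, which is connected. Their union separates, so one of them
  does, and it yields an enclosing cycle of weight at most the length of \<open>s\<close> plus half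
  the weight of \<open>T\<close>. Minimality of \<open>T\<close> bounds this from below.\<close>

lemma halving_path_long:
  assumes min: "is_min T x" and x: "x \<notin> points"
    and c: "simple_path c" "path_image c = body T" "(weight T)-lipschitz_on {0..1} c"
    and t: "t \<in> {0..<1/2}"
    and s: "path s" "path_image s \<subseteq> points" "pathstart s = c t" "pathfinish s = c (t + 1/2)"
  shows "ennreal (weight T / 2) \<le> curve_length s"
proof -
  have T: "T \<in> cycles" "x \<in> inside (body T)" using min by (auto simp: is_min_def)
  have bT: "body T \<subseteq> points" using cycles_edges[OF T(1)] by (rule body_subset_points)
  obtain y where y: "y \<notin> points" "\<And>K. K \<subseteq> points \<Longrightarrow> y \<in> outside K"
    using exists_far_point by blast
  have W: "0 \<le> weight T" using c(3) lipschitz_on_nonneg by blast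
  have pc: "path c" using c(1) by (rule simple_path_imp_path)
  \<comment> \<open>Path 0 is the shortcut and path 1 the half between the two points. The other
    half passes the base point of the loop and therefore consists of paths 2 and 3.\<close>
  define p where "p = (\<lambda>i::nat. if i = 0 then s else if i = 1 then subpath t (t + 1/2) c else
     if i = 2 then subpath 0 t c else subpath (t + 1/2) 1 c)"
  have pp: "path (p i)" for i using s(1) pc t by (auto simp: p_def)
  have im: "path_image (subpath t (t + 1/2) c) = c ` {t..t + 1/2}" "path_image (subpath 0 t c) = c ` {0..t}"
    "path_image (subpath (t + 1/2) 1 c) = c ` {t + 1/2..1}"
    using t by (auto simp: path_image_subpath)
  have cT: "c ` {u..v} \<subseteq> body T" if "0 \<le> u" "v \<le> 1" for u v
    using that unfolding c(2)[symmetric] path_image_def by (intro image_mono) auto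
  have "c ` {t..t + 1/2} \<subseteq> points" "c ` {0..t} \<subseteq> points" "c ` {t + 1/2..1} \<subseteq> points"
    using t by (intro subset_trans[OF cT bT]; simp)+
  note cX = this
  have pX: "path_image (p i) \<subseteq> points" for i
    using s(2) cX by (simp add: p_def im)
  define A B where "A = c ` {t..t + 1/2}" and "B = c ` {0..t} \<union> c ` {t + 1/2..1}"
  have comp: "compact (path_image s)" "compact A" "compact B"
    unfolding A_def B_def im[symmetric] using s(1) pc t by (auto intro!: compact_path_image compact_Un)
  have AB: "body T \<subseteq> A \<union> B"
  proof
    fix z assume "z \<in> body T"
    then obtain u where "u \<in> {0..1}" "z = c u" unfolding c(2)[symmetric] path_image_def by auto
    then show "z \<in> A \<union> B" unfolding A_def B_def by (cases "u \<le> t"; cases "u \<le> t + 1/2") auto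
  qed
  have ends: "c t \<in> path_image s" "c (t + 1/2) \<in> path_image s"
    using s(3,4) pathstart_in_path_image pathfinish_in_path_image by metis+
  have "A \<inter> B \<subseteq> path_image s"
  proof
    fix z assume "z \<in> A \<inter> B"
    then obtain u v where uv: "u \<in> {t..t + 1/2}" "z = c u" "v \<in> {0..t} \<union> {t + 1/2..1}" "z = c v"
      unfolding A_def B_def by auto
    then have cuv: "c u = c v" by simp
    have "u \<in> {0..1}" "v \<in> {0..1}" using uv(1,3) t by auto
    then have "u = v \<or> u = 0 \<and> v = 1 \<or> u = 1 \<and> v = 0" by (rule simple_path_eqD[OF c(1) cuv])
    then have "u = t \<or> u = t + 1/2" using uv(1,3) t by auto
    then show "z \<in> path_image s" using ends uv(2) by auto
  qed
  then have "(A \<union> path_image s) \<inter> (B \<union> path_image s) = path_image s" by blast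
  then have conn: "connected ((A \<union> path_image s) \<inter> (B \<union> path_image s))"
    using s(1) by (simp add: connected_path_image)
  have ABX: "A \<subseteq> points" "B \<subseteq> points" using cX unfolding A_def B_def by blast+
  have TX: "\<not> unseparated (body T) x y" using not_unseparated_iff_inside[OF bT y(2)[OF bT] x] T(2) by simp
  have "\<not> unseparated ((A \<union> path_image s) \<union> (B \<union> path_image s)) x y"
    using TX unseparated_subset[of "(A \<union> path_image s) \<union> (B \<union> path_image s)" x y "body T"] AB by blast
  then consider "\<not> unseparated (A \<union> path_image s) x y" | "\<not> unseparated (B \<union> path_image s) x y"
    using unseparated_Un[OF compact_Un[OF comp(2,1)] compact_Un[OF comp(3,1)] conn] by blast
  then have "\<exists>J. finite J \<and> x \<in> inside (\<Union>i\<in>J. path_image (p i)) \<and> (\<Sum>i\<in>J. curve_length (p i)) \<le> curve_length s + ennreal (weight T / 2)"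
  proof cases
    case 1
    have "(\<Union>i\<in>{0,1}. path_image (p i)) = A \<union> path_image s" by (auto simp: p_def im A_def)
    moreover have "A \<union> path_image s \<subseteq> points" using ABX s(2) by auto
    then have "x \<in> inside (A \<union> path_image s)"
      using not_unseparated_iff_inside[of "A \<union> path_image s" y x] y(2) x 1 by blast
    moreover have "(\<Sum>i\<in>{0,1}. curve_length (p i)) \<le> curve_length s + ennreal (weight T / 2)"
      using curve_length_subpath_le[OF c(3), of t "t + 1/2"] t by (simp add: p_def add_left_mono)
    ultimately show ?thesis by (intro exI[of _ "{0, 1}"]) auto
  next
    case 2
    have "(\<Union>i\<in>{0,2,3}. path_image (p i)) = B \<union> path_image s" by (auto simp: p_def im B_def)
    moreover have "B \<union> path_image s \<subseteq> points" using ABX s(2) by auto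
    then have "x \<in> inside (B \<union> path_image s)"
      using not_unseparated_iff_inside[of "B \<union> path_image s" y x] y(2) x 2 by blast
    moreover have "(\<Sum>i\<in>{0,2,3}. curve_length (p i)) \<le> curve_length s + ennreal (weight T / 2)"
    proof -
      have "curve_length (subpath 0 t c) + curve_length (subpath (t + 1/2) 1 c)
          \<le> ennreal (weight T * (t - 0)) + ennreal (weight T * (1 - (t + 1/2)))"
        using t by (intro add_mono curve_length_subpath_le[OF c(3)]) auto
      also have "\<dots> = ennreal (weight T * (t - 0) + weight T * (1 - (t + 1/2)))"
        using t W by (intro ennreal_plus[symmetric]) auto
      also have "weight T * (t - 0) + weight T * (1 - (t + 1/2)) = weight T / 2" by (simp add: field_simps)
      finally show ?thesis by (simp add: p_def add_left_mono)
    qed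
    ultimately show ?thesis by (intro exI[of _ "{0, 2, 3}"]) auto
  qed
  then obtain J where J: "finite J" "x \<in> inside (\<Union>i\<in>J. path_image (p i))"
    "(\<Sum>i\<in>J. curve_length (p i)) \<le> curve_length s + ennreal (weight T / 2)" by blast
  obtain T' where T': "T' \<in> cycles" "x \<in> inside (body T')" "ennreal (weight T') \<le> (\<Sum>i\<in>J. curve_length (p i))"
    using inside_paths_cycle[OF J(1) pp pX x J(2)] by blast
  have "ennreal (weight T) \<le> ennreal (weight T')" using min T' by (intro ennreal_leI) (auto simp: is_min_def)
  then have le: "ennreal (weight T) \<le> curve_length s + ennreal (weight T / 2)" using T'(3) J(3) by simp
  then show ?thesis
  proof (cases "curve_length s")
    case (real r)
    then have "ennreal (weight T) \<le> ennreal (r + weight T / 2)"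
      using le W by (simp add: ennreal_plus)
    then have "weight T \<le> r + weight T / 2" using real W by (subst (asm) ennreal_le_iff) auto
    then show ?thesis using real by (auto intro: ennreal_leI)
  qed simp
qed

lemma weight_cycle_pos:
  assumes "is_cycle T c" shows "0 < weight T"
proof -
  obtain K where c: "simple_path c" "K-lipschitz_on {0..1} c" "len c 0 1 \<le> weight T"
    using assms by (auto simp: is_cycle_def)
  have "c 0 \<noteq> c (1/2)" using simple_path_eqD[OF c(1), of 0 "1/2"] by auto
  moreover have "dist (c 0) (c (1/2)) \<le> len c 0 (1/2)" "0 \<le> len c (1/2) 1"
    by (intro dist_le_len[of K] len_nonneg[of K] lipschitz_on_subset[OF c(2)]; simp)+
  moreover have "len c 0 1 = len c 0 (1/2) + len c (1/2) 1" by (rule len_add[OF c(2)]) auto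
  ultimately show ?thesis using c(3) zero_less_dist_iff[of "c 0" "c (1/2)"] by linarith
qed

text \<open>Halving pairs have graph distance at least half the weight; dividing by the bound on the
  dilation gives a Euclidean distance of at least \<open>2 * r\<close>. The nonzero winding number
  then shows that the centre of the annulus is inside the cycle.\<close>

lemma min_cycle_near_circle:
  assumes min: "is_min T x" and x: "x \<notin> points" and \<epsilon>: "0 < \<epsilon>" "\<epsilon> \<le> 1 / 100"
    and dil: "dilation G \<le> ennreal ((1 + \<epsilon>\<^sup>2) * (pi / 2))"
  obtains z \<rho> where "0 < \<rho>" "\<rho> \<le> weight T / (2 * pi * (1 + \<epsilon>\<^sup>2))" "ball z \<rho> \<subseteq> inside (body T)"
    "inside (body T) \<subseteq> cball z ((1 + 3 * \<epsilon>) * \<rho>)"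
proof -
  have T: "T \<in> cycles" "x \<in> inside (body T)" using min by (auto simp: is_min_def)
  then obtain c0 where c0: "is_cycle T c0" by (auto simp: cycles_def)
  then obtain K where K: "K-lipschitz_on {0..1} c0" by (auto simp: is_cycle_def)
  obtain c where c: "simple_path c" "(len c0 0 1)-lipschitz_on {0..1} c" "path_image c = path_image c0"
    "pathstart c = pathstart c0" "pathfinish c = pathfinish c0"
    using constant_speed[OF _ K] c0 by (auto simp: is_cycle_def)
  have c': "(weight T)-lipschitz_on {0..1} c" "path_image c = body T" "pathfinish c = pathstart c"
    using c c0 lipschitz_on_mono[OF c(2) order_refl] by (auto simp: is_cycle_def)
  have W: "0 < weight T" using c0 by (rule weight_cycle_pos)
  define \<delta> where "\<delta> = (1 + \<epsilon>\<^sup>2) * (pi / 2)"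
  have \<delta>: "0 < \<delta>" unfolding \<delta>_def using add_pos_nonneg[of 1 "\<epsilon>\<^sup>2"] by simp
  define r where "r = weight T / (2 * pi * (1 + \<epsilon>\<^sup>2))"
  have r: "2 * r = weight T / 2 / \<delta>" by (simp add: r_def \<delta>_def)
  have bT: "body T \<subseteq> points" using cycles_edges[OF T(1)] by (rule body_subset_points)
  have half: "2 * r \<le> dist (c t) (c (t + 1/2))" if t: "t \<in> {0..<1/2}" for t
  proof -
    have ne: "c t \<noteq> c (t + 1/2)" using simple_path_eqD[OF c(1), of t "t + 1/2"] t by auto
    have inX: "c t \<in> points" "c (t + 1/2) \<in> points"
      using bT t unfolding c'(2)[symmetric] path_image_def by auto
    have "ennreal (weight T / 2) \<le> graph_dist G (c t) (c (t + 1/2))"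
      unfolding graph_dist_def
      by (intro INF_greatest halving_path_long[OF min x c(1) c'(2,1) t]) auto
    then have "ennreal (weight T / 2) / ennreal (dist (c t) (c (t + 1/2)))
        \<le> graph_dist G (c t) (c (t + 1/2)) / ennreal (dist (c t) (c (t + 1/2)))"
      by (rule divide_right_mono_ennreal)
    also have "\<dots> \<le> dilation G"
      unfolding dilation_def using ne inX by (intro SUP_upper2[of "(c t, c (t + 1/2))"]) auto
    also have "\<dots> \<le> ennreal \<delta>" using dil by (simp add: \<delta>_def)
    finally have "weight T / 2 / dist (c t) (c (t + 1/2)) \<le> \<delta>"
      using ne W \<delta> by (simp add: divide_ennreal)
    then show ?thesis unfolding r using ne \<delta> by (simp add: field_simps)
  qed
  obtain z \<rho> where z: "0 < \<rho>" "\<rho> \<le> r" "path_image c \<subseteq> cball z ((1 + 3 * \<epsilon>) * \<rho>) - ball z \<rho>"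
    "winding_number c z \<noteq> 0"
    using near_circle[OF c'(1,3) W \<epsilon> r_def half] by blast
  have "ball z \<rho> \<subseteq> inside (body T)"
  proof -
    have "ball z \<rho> \<subseteq> inside (body T) \<union> outside (body T)"
      unfolding cycle_regions(10)[OF T(1)] using z(3) c'(2) by auto
    moreover have "z \<notin> outside (body T)"
      using z(4) winding_number_zero_in_outside[of c z] c(1) c'(2,3) simple_path_imp_path by metis
    then have "ball z \<rho> \<inter> inside (body T) \<noteq> {}" using calculation z(1) centre_in_ball by blast
    ultimately show ?thesis
      using connectedD[OF connected_ball, of "inside (body T)" "outside (body T)" z \<rho>] cycle_regions[OF T(1)] by blast
  qed
  moreover have "inside (body T) \<subseteq> cball z ((1 + 3 * \<epsilon>) * \<rho>)"
  proof -
    have "- cball z ((1 + 3 * \<epsilon>) * \<rho>) \<subseteq> outside (body T)"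
      using z(3) c'(2) by (intro outside_subset_convex) auto
    then show ?thesis using cycle_regions(9)[OF T(1)] by blast
  qed
  ultimately show thesis using that[of \<rho> z] z(1,2) r_def by simp
qed

section \<open>Regions, cuts and their modularity\<close>

text \<open>Bounded unions of faces: a subset of the complement of the graph is a union of
  components exactly if it and its relative complement are open.\<close>

definition region :: "complex set \<Rightarrow> bool" where
  "region U \<longleftrightarrow> U \<subseteq> - points \<and> open U \<and> open (- points - U) \<and> bounded U"

text \<open>Whether an edge is cut is read off closures of regions anywhere along the edge.  This makes the cut
  function submodular without knowing that an edge has only two sides.\<close>

definition touched :: "complex set \<Rightarrow> (real \<Rightarrow> complex) set" where
  "touched U = {g \<in> edges G. g ` {0<..<1} \<inter> closure U \<noteq> {}}"

definition cut :: "complex set \<Rightarrow> (real \<Rightarrow> complex) set" where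
  "cut U = touched U \<inter> touched (- points - U)"

lemma touched_Un: "touched (U \<union> W) = touched U \<union> touched W"
  by (auto simp: touched_def)

lemma touched_mono: "U \<subseteq> W \<Longrightarrow> touched U \<subseteq> touched W"
  using closure_mono[of U W] by (auto simp: touched_def)

lemma cut_edges: "cut U \<subseteq> edges G"
  by (auto simp: cut_def touched_def)

lemma region_Int: "region U \<Longrightarrow> region W \<Longrightarrow> region (U \<inter> W)"
  and region_Un: "region U \<Longrightarrow> region W \<Longrightarrow> region (U \<union> W)"
  and region_Diff: "region U \<Longrightarrow> region W \<Longrightarrow> region (U - W)"
proof -
  assume U: "region U" and W: "region W"
  have "- points - (U \<inter> W) = (- points - U) \<union> (- points - W)"
    "- points - (U \<union> W) = (- points - U) \<inter> (- points - W)"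
    "- points - (U - W) = (- points - U) \<union> (U \<inter> W)"
    "U - W = U \<inter> (- points - W)"
    using U W by (auto simp: region_def)
  then show "region (U \<inter> W)" "region (U \<union> W)" "region (U - W)"
    using U W unfolding region_def by (auto intro: bounded_subset)
qed

text \<open>The two inclusions say that every edge is counted on the left at most as often as on the
  right.\<close>

lemma weight_add_le:
  assumes "A \<union> B \<subseteq> C \<union> D" "A \<inter> B \<subseteq> C \<inter> D" "C \<subseteq> edges G" "D \<subseteq> edges G"
  shows "weight A + weight B \<le> weight C + weight D"
proof -
  have AB: "A \<subseteq> edges G" "B \<subseteq> edges G" using assms by auto
  have "weight A + weight B = weight (A \<union> B) + weight (A \<inter> B)"
    unfolding weight_def using AB finite_sub_edges by (intro sum.union_inter[symmetric]) auto
  also have "\<dots> \<le> weight (C \<union> D) + weight (C \<inter> D)"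
    using assms by (intro add_mono weight_mono) auto
  also have "\<dots> = weight C + weight D"
    unfolding weight_def using assms finite_sub_edges by (intro sum.union_inter) auto
  finally show ?thesis .
qed

text \<open>What touches an intersection touches both sets, and what touches a union touches one of
  them; the same holds for the complements with the roles exchanged. Counting each edge gives the
  inequality.\<close>

lemma cut_submodular:
  "weight (cut (U \<inter> W)) + weight (cut (U \<union> W)) \<le> weight (cut U) + weight (cut W)"
proof (rule weight_add_le)
  let ?V = "- points"
  have 1: "touched (U \<inter> W) \<subseteq> touched U \<inter> touched W" using touched_mono[of "U \<inter> W"] by auto
  have 2: "touched (?V - (U \<union> W)) \<subseteq> touched (?V - U) \<inter> touched (?V - W)"
    using touched_mono[of "?V - (U \<union> W)"] by auto
  have 3: "touched (?V - (U \<inter> W)) = touched (?V - U) \<union> touched (?V - W)"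
    unfolding touched_Un[symmetric] by (rule arg_cong[where f = touched]) auto
  show "cut (U \<inter> W) \<union> cut (U \<union> W) \<subseteq> cut U \<union> cut W"
    using 1 2 3 touched_Un[of U W] unfolding cut_def by blast
  show "cut (U \<inter> W) \<inter> cut (U \<union> W) \<subseteq> cut U \<inter> cut W"
    using 1 2 unfolding cut_def by blast
qed (rule cut_edges)+

text \<open>In substance submodularity for \<open>U\<close> and the complement of \<open>W\<close>,
  because a set and its complement off the graph have the same cut.\<close>

lemma cut_posimodular:
  assumes "region U" "region W"
  shows "weight (cut (U - W)) + weight (cut (W - U)) \<le> weight (cut U) + weight (cut W)"
proof (rule weight_add_le)
  let ?V = "- points"
  have V: "U \<subseteq> ?V" "W \<subseteq> ?V" using assms by (auto simp: region_def)
  have 1: "touched (U - W) \<subseteq> touched U \<inter> touched (?V - W)" "touched (W - U) \<subseteq> touched W \<inter> touched (?V - U)"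
    using V by (intro Int_greatest touched_mono; blast)+
  have "?V - (U - W) = (?V - U) \<union> (U \<inter> W)" "?V - (W - U) = (?V - W) \<union> (U \<inter> W)" using V by auto
  then have 2: "touched (?V - (U - W)) = touched (?V - U) \<union> touched (U \<inter> W)"
    "touched (?V - (W - U)) = touched (?V - W) \<union> touched (U \<inter> W)"
    by (metis touched_Un)+
  have 3: "touched (U \<inter> W) \<subseteq> touched U \<inter> touched W" using touched_mono[of "U \<inter> W"] by auto
  show "cut (U - W) \<union> cut (W - U) \<subseteq> cut U \<union> cut W"
    using 1 2 3 unfolding cut_def by blast
  show "cut (U - W) \<inter> cut (W - U) \<subseteq> cut U \<inter> cut W"
    using 1 unfolding cut_def by blast
qed (rule cut_edges)+

text \<open>Otherwise \<open>x\<close> can be joined to points far away while avoiding the cut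
  edges. The closures of \<open>U\<close> and of its complement cover the outside of these edges
  and, vertices apart, meet only on cut edges, so they would disconnect a connected set.\<close>

lemma region_inside_cut:
  assumes U: "region U" and x: "x \<in> U"
  shows "x \<in> inside (body (cut U))"
proof (rule ccontr)
  assume "x \<notin> inside (body (cut U))"
  let ?K = "body (cut U)" and ?V = "- points"
  have KX: "?K \<subseteq> points" using cut_edges by (rule body_subset_points)
  have xX: "x \<notin> points" using U x by (auto simp: region_def)
  have "closed ?K" using compact_body[OF cut_edges] compact_imp_closed by blast
  define Q where "Q = outside ?K"
  have xQ: "x \<in> Q" using \<open>x \<notin> inside _\<close> xX KX inside_Un_outside[of ?K] unfolding Q_def by blast
  have bK: "bounded ?K" using compact_body[OF cut_edges] compact_imp_bounded by blast
  have Q: "open Q" "connected Q" "Q \<subseteq> - ?K" "\<not> bounded Q"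
    unfolding Q_def using open_outside[OF \<open>closed ?K\<close>] connected_outside[OF bK] unbounded_outside[OF bK]
    by (auto simp: outside_def)
  \<comment> \<open>Deleting finitely many points keeps an open connected set connected, and it
    avoids the question how closures of regions meet at a vertex.\<close>
  have cQ: "connected (Q - verts G)"
    using Q finite_verts by (intro connected_open_delete_finite) auto
  have "\<not> Q \<subseteq> points \<union> U"
    using Q(4) U compact_imp_bounded[OF compact_graph_points] bounded_subset bounded_Un unfolding region_def by metis
  then obtain y where y: "y \<in> Q" "y \<in> ?V" "y \<notin> U" by auto
  define S1 S2 where "S1 = closure U" and "S2 = closure (?V - U)"
  have "S1 \<union> S2 = closure ?V" unfolding S1_def S2_def closure_Un[symmetric] using U
    by (intro arg_cong[where f = closure]) (auto simp: region_def)
  then have cover: "Q - verts G \<subseteq> S1 \<union> S2" using closure_complement by simp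
  have disj: "S1 \<inter> S2 \<inter> (Q - verts G) = {}"
  proof (rule ccontr)
    assume "\<not> ?thesis"
    then obtain p where p: "p \<in> S1" "p \<in> S2" "p \<in> Q" "p \<notin> verts G" by auto
    have "U \<inter> S2 = {}" "(?V - U) \<inter> S1 = {}"
      using U unfolding S1_def S2_def region_def by (auto simp: open_Int_closure_eq_empty)
    then have "p \<in> points" using p by auto
    then obtain g where g: "g \<in> edges G" "p \<in> path_image g" using p(4) by (auto simp: graph_points_def)
    then have "p \<in> g ` {0<..<1}" using path_image_eq_open[of g] edge_ends[OF g(1)] p(4) by auto
    then have "g \<in> cut U" using p(1,2) g(1) unfolding cut_def touched_def S1_def S2_def by auto
    then show False using g(2) p(3) Q(3) by (auto simp: body_def)
  qed
  have "U \<subseteq> S1" "?V - U \<subseteq> S2" unfolding S1_def S2_def by (rule closure_subset)+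
  then have "x \<in> S1 \<inter> (Q - verts G)" "y \<in> S2 \<inter> (Q - verts G)"
    using x xQ xX y verts_subset_points by auto
  moreover have "closed S1" "closed S2" by (simp_all add: S1_def S2_def)
  ultimately show False using connected_closedD[OF cQ disj cover] by blast
qed

lemma region_cycle:
  assumes "region U" "x \<in> U"
  obtains T where "T \<in> cycles" "T \<subseteq> cut U" "x \<in> inside (body T)" "weight T \<le> weight (cut U)"
proof -
  have "x \<notin> points" using assms by (auto simp: region_def)
  then obtain T where "T \<in> cycles" "T \<subseteq> cut U" "x \<in> inside (body T)"
    using inside_body_cycle[OF cut_edges _ region_inside_cut[OF assms]] by blast
  then show thesis using that weight_mono[OF _ cut_edges] by blast
qed

text \<open>Each cut of a region around \<open>x\<close> contains a cycle around \<open>x\<close>.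
  With \<open>weight_cut_cycle\<close> this identifies shortest enclosing cycles with minimum cuts,
  so inequalities for cuts can be applied to cycles.\<close>

lemma is_min_le_cut:
  assumes "is_min T x" "region U" "x \<in> U"
  shows "weight T \<le> weight (cut U)"
proof -
  obtain T' where "T' \<in> cycles" "x \<in> inside (body T')" "weight T' \<le> weight (cut U)"
    by (rule region_cycle[OF assms(2,3)])
  then show ?thesis using assms(1) unfolding is_min_def by fastforce
qed

lemma edge_open_inside_or_outside:
  assumes T: "T \<in> cycles" and g: "g \<in> edges G" "g \<notin> T"
  shows "g ` {0<..<1} \<subseteq> inside (body T) \<or> g ` {0<..<1} \<subseteq> outside (body T)"
proof -
  have "g ` {0<..<1} \<inter> body T = {}"
    using edge_open_unique[OF g(1)] cycles_edges[OF T] g(2) by (auto simp: body_def)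
  then have "g ` {0<..<1} \<subseteq> inside (body T) \<union> outside (body T)" using cycle_regions(10)[OF T] by auto
  moreover have "connected (g ` {0<..<1})"
    using edge_path[OF g(1)] unfolding path_def
    by (intro connected_continuous_image) (auto elim: continuous_on_subset)
  ultimately show ?thesis
    using connectedD[of "g ` {0<..<1}" "inside (body T)" "outside (body T)"] cycle_regions[OF T] by blast
qed

text \<open>An edge outside \<open>T\<close> lies entirely on one side of the cycle, and neither
  side meets the closure of the other; hence only edges of \<open>T\<close> can be cut.\<close>

lemma cycle_region:
  assumes T: "T \<in> cycles"
  shows "region (inside (body T) - points)" "cut (inside (body T) - points) \<subseteq> T"
proof -
  let ?X = "points"
  have cX: "open (- ?X)" using compact_graph_points compact_imp_closed by blast
  have bX: "body T \<subseteq> ?X" using cycles_edges[OF T] by (rule body_subset_points)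
  have eq: "inside (body T) - ?X = inside (body T) \<inter> - ?X"
    "- ?X - (inside (body T) - ?X) = outside (body T) \<inter> - ?X"
    using cycle_regions(9,10)[OF T] bX by blast+
  show "region (inside (body T) - ?X)"
    unfolding region_def
  proof (intro conjI)
    show "open (inside (body T) - ?X)" unfolding eq(1) using cX cycle_regions(1)[OF T] by (rule open_Int[rotated])
    show "open (- ?X - (inside (body T) - ?X))" unfolding eq(2) using cycle_regions(4)[OF T] cX by (rule open_Int)
    show "bounded (inside (body T) - ?X)" using cycle_regions(3)[OF T] by (rule bounded_subset) auto
  qed auto
  show "cut (inside (body T) - ?X) \<subseteq> T"
  proof (rule ccontr)
    assume "\<not> ?thesis"
    then obtain g where g: "g \<in> edges G" "g \<notin> T" "g ` {0<..<1} \<inter> closure (inside (body T) - ?X) \<noteq> {}"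
      "g ` {0<..<1} \<inter> closure (outside (body T) \<inter> - ?X) \<noteq> {}"
      unfolding cut_def touched_def eq(2) by auto
    note cycle_regions_closure[OF T]
    moreover have "closure (inside (body T) - ?X) \<subseteq> closure (inside (body T))"
      "closure (outside (body T) \<inter> - ?X) \<subseteq> closure (outside (body T))" by (intro closure_mono; auto)+
    ultimately show False using edge_open_inside_or_outside[OF T g(1,2)] g(3,4) by blast
  qed
qed

lemma weight_cut_cycle: "T \<in> cycles \<Longrightarrow> weight (cut (inside (body T) - points)) \<le> weight T"
  by (intro weight_mono cycle_region(2) cycles_edges)

text \<open>Serves to keep a cycle found in the cut of a smaller region within the closed inside of
  the original one.\<close>

lemma touched_inside_edge:
  assumes T: "T \<in> cycles" and g: "g \<in> touched U" "U \<subseteq> inside (body T)"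
  shows "path_image g \<subseteq> inside (body T) \<union> body T"
proof -
  have gE: "g \<in> edges G" using g by (auto simp: touched_def)
  have cl: "closure (inside (body T)) = inside (body T) \<union> body T"
    using closure_Un_frontier[of "inside (body T)"] cycle_regions(7)[OF T] by simp
  have "g ` {0<..<1} \<subseteq> closure (inside (body T))"
  proof (cases "g \<in> T")
    case True
    then show ?thesis unfolding cl using path_image_eq_open[of g] by (auto simp: body_def)
  next
    case False
    note cycle_regions_closure(2)[OF T]
    moreover have "g ` {0<..<1} \<inter> closure (inside (body T)) \<noteq> {}"
      using g closure_mono[OF g(2)] by (auto simp: touched_def)
    ultimately show ?thesis using edge_open_inside_or_outside[OF T gE False] closure_subset by blast
  qed
  then have "closure (g ` {0<..<1}) \<subseteq> closure (inside (body T))" by (intro closure_minimal) auto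
  moreover note edge_in_closure[OF gE]
  ultimately show ?thesis using cl by blast
qed

text \<open>The outside of \<open>T\<close> is connected, unbounded and disjoint from the smaller
  cycle, so it is outside of that too. Points of \<open>body T\<close> are limits of it and cannot
  lie in the open inside of \<open>T'\<close>.\<close>

lemma inside_subset_inside:
  assumes T: "T \<in> cycles" and T': "T' \<in> cycles" and sub: "body T' \<subseteq> inside (body T) \<union> body T"
  shows "inside (body T') \<subseteq> inside (body T)"
proof -
  have "outside (body T) \<inter> body T' = {}" using sub cycle_regions(9,10)[OF T] by blast
  then have "outside (body T) \<subseteq> inside (body T') \<union> outside (body T')" using cycle_regions(10)[OF T'] by blast
  moreover have "\<not> outside (body T) \<subseteq> inside (body T')"
    using cycle_regions(6)[OF T] cycle_regions(3)[OF T'] bounded_subset by blast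
  ultimately have "outside (body T) \<inter> inside (body T') = {}"
    using connectedD[OF cycle_regions(5)[OF T] cycle_regions(1,4)[OF T']] cycle_regions(9)[OF T'] by blast
  moreover have "body T \<inter> inside (body T') = {}"
  proof -
    have "body T \<subseteq> closure (outside (body T))" using cycle_regions(8)[OF T] by (auto simp: frontier_def)
    moreover have "inside (body T') \<inter> closure (outside (body T)) = {}"
      using calculation(1) \<open>outside (body T) \<inter> inside (body T') = {}\<close> cycle_regions(1)[OF T']
      by (simp add: open_Int_closure_eq_empty Int_commute)
    ultimately show ?thesis by blast
  qed
  ultimately show ?thesis using cycle_regions(10)[OF T] by blast
qed

section \<open>Uncrossing of shortest enclosing cycles\<close>

text \<open>Breaks ties: different shortest cycles around one point may cross. Insides are compared
  instead of edge sets, because the disks depend on the insides.\<close>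

definition innermost :: "(real \<Rightarrow> complex) set \<Rightarrow> complex \<Rightarrow> bool" where
  "innermost T x \<longleftrightarrow> is_min T x \<and>
     (\<forall>T'. is_min T' x \<longrightarrow> inside (body T') \<subseteq> inside (body T) \<longrightarrow> inside (body T') = inside (body T))"

lemma innermost_exists:
  assumes "T \<in> cycles" "x \<in> inside (body T)"
  obtains T' where "innermost T' x" "weight T' \<le> weight T"
proof -
  let ?C = "{T \<in> cycles. x \<in> inside (body T)}"
  have "finite ?C" "?C \<noteq> {}" using finite_cycles assms by auto
  note C = this
  define T0 where "T0 = arg_min_on weight ?C"
  have T0: "T0 \<in> ?C" "\<And>T. T \<in> ?C \<Longrightarrow> weight T0 \<le> weight T"
    unfolding T0_def using arg_min_if_finite(1)[OF C] arg_min_least[OF C] by blast+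
  then have m0: "is_min T0 x" by (auto simp: is_min_def)
  let ?I = "(\<lambda>T. inside (body T)) ` {T. is_min T x}"
  have "{T. is_min T x} \<subseteq> cycles" by (auto simp: is_min_def)
  then have "finite ?I" using finite_cycles finite_subset by blast
  then obtain R where R: "R \<in> ?I" "\<And>R'. R' \<in> ?I \<Longrightarrow> R' \<subseteq> R \<Longrightarrow> R = R'"
    using finite_has_minimal[of ?I] m0 by blast
  then obtain T' where T': "is_min T' x" "R = inside (body T')" by auto
  then have "innermost T' x" using R unfolding innermost_def by blast
  moreover have "weight T' \<le> weight T" using T' assms by (auto simp: is_min_def)
  ultimately show thesis by (rule that)
qed

text \<open>The union of the two insides contains \<open>x\<close>, so its cut weighs at least
  \<open>weight T1\<close>. By submodularity the cut of the intersection, which contains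
  \<open>y\<close>, weighs at most \<open>weight T2\<close>. It therefore contains a shortest cycle
  around \<open>y\<close> inside both, and the choice of \<open>T2\<close> makes its inside that of
  \<open>T2\<close>.\<close>

lemma innermost_nested:
  assumes 1: "innermost T1 x" and 2: "innermost T2 y" and x: "x \<notin> points" and y: "y \<notin> points"
    and yin: "y \<in> inside (body T1)"
  shows "inside (body T2) \<subseteq> inside (body T1)"
proof -
  let ?X = "points"
  have m: "is_min T1 x" "is_min T2 y" using 1 2 by (auto simp: innermost_def)
  then have C: "T1 \<in> cycles" "T2 \<in> cycles" and xy: "x \<in> inside (body T1)" "y \<in> inside (body T2)"
    by (auto simp: is_min_def)
  define U1 U2 where "U1 = inside (body T1) - ?X" and "U2 = inside (body T2) - ?X"
  have r: "region U1" "region U2" unfolding U1_def U2_def using cycle_region(1) C by auto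
  have "weight (cut (U1 \<inter> U2)) + weight (cut (U1 \<union> U2)) \<le> weight T1 + weight T2"
    using cut_submodular[of U1 U2] weight_cut_cycle[OF C(1)] weight_cut_cycle[OF C(2)] unfolding U1_def U2_def by linarith
  moreover have "weight T1 \<le> weight (cut (U1 \<union> U2))"
    using is_min_le_cut[OF m(1) region_Un[OF r]] x xy by (simp add: U1_def)
  ultimately have le: "weight (cut (U1 \<inter> U2)) \<le> weight T2" by linarith
  have "y \<in> U1 \<inter> U2" using y yin xy by (simp add: U1_def U2_def)
  then obtain T3 where T3: "T3 \<in> cycles" "T3 \<subseteq> cut (U1 \<inter> U2)" "y \<in> inside (body T3)" "weight T3 \<le> weight (cut (U1 \<inter> U2))"
    using region_cycle[OF region_Int[OF r]] by blast
  have t: "g \<in> touched (U1 \<inter> U2)" if "g \<in> T3" for g using that T3(2) by (auto simp: cut_def)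
  have "body T3 \<subseteq> inside (body T1) \<union> body T1" "body T3 \<subseteq> inside (body T2) \<union> body T2"
    using touched_inside_edge[OF C(1) t] touched_inside_edge[OF C(2) t] unfolding body_def[of T3] U1_def U2_def by blast+
  then have sub: "inside (body T3) \<subseteq> inside (body T1)" "inside (body T3) \<subseteq> inside (body T2)"
    using inside_subset_inside C T3(1) by auto
  have "is_min T3 y" using m(2) T3 le unfolding is_min_def by (metis order_trans)
  then have "inside (body T3) = inside (body T2)" using 2 sub(2) unfolding innermost_def by blast
  then show ?thesis using sub(1) by simp
qed

text \<open>Uncrossing by differences: each point remains in its own difference, so posimodularity
  yields a shortest cycle around \<open>x\<close> in the cut of \<open>U1 - U2\<close>, with the
  same inside as \<open>T1\<close>. None of its edges enters the inside of \<open>T2\<close>, which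
  is therefore contained in the inside of \<open>T1\<close> or disjoint from it; the point
  \<open>y\<close> rules out the former.\<close>

lemma innermost_disjoint:
  assumes 1: "innermost T1 x" and 2: "innermost T2 y" and x: "x \<notin> points" and y: "y \<notin> points"
    and out: "y \<notin> inside (body T1)" "x \<notin> inside (body T2)"
  shows "inside (body T1) \<inter> inside (body T2) = {}"
proof -
  let ?X = "points"
  have m: "is_min T1 x" "is_min T2 y" using 1 2 by (auto simp: innermost_def)
  then have C: "T1 \<in> cycles" "T2 \<in> cycles" and xy: "x \<in> inside (body T1)" "y \<in> inside (body T2)"
    by (auto simp: is_min_def)
  define U1 U2 where "U1 = inside (body T1) - ?X" and "U2 = inside (body T2) - ?X"
  have r: "region U1" "region U2" unfolding U1_def U2_def using cycle_region(1) C by auto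
  have "weight (cut (U1 - U2)) + weight (cut (U2 - U1)) \<le> weight T1 + weight T2"
    using cut_posimodular[OF r] weight_cut_cycle[OF C(1)] weight_cut_cycle[OF C(2)] unfolding U1_def U2_def by linarith
  moreover have "weight T2 \<le> weight (cut (U2 - U1))"
    using is_min_le_cut[OF m(2) region_Diff[OF r(2,1)]] y xy out by (simp add: U1_def U2_def)
  ultimately have le: "weight (cut (U1 - U2)) \<le> weight T1" by linarith
  have "x \<in> U1 - U2" using x out xy by (simp add: U1_def U2_def)
  then obtain T3 where T3: "T3 \<in> cycles" "T3 \<subseteq> cut (U1 - U2)" "x \<in> inside (body T3)" "weight T3 \<le> weight (cut (U1 - U2))"
    using region_cycle[OF region_Diff[OF r]] by blast
  have t: "g \<in> touched (U1 - U2)" "g \<in> edges G" if "g \<in> T3" for g using that T3(2) cut_edges by (auto simp: cut_def)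
  have "U1 - U2 \<subseteq> inside (body T1)" by (auto simp: U1_def)
  then have "body T3 \<subseteq> inside (body T1) \<union> body T1"
    using touched_inside_edge[OF C(1) t(1)] unfolding body_def[of T3] by blast
  then have sub: "inside (body T3) \<subseteq> inside (body T1)"
    using inside_subset_inside C T3(1) by auto
  have "is_min T3 x" using m(1) T3 le unfolding is_min_def by (metis order_trans)
  then have eq: "inside (body T3) = inside (body T1)" using 1 sub unfolding innermost_def by blast
  have "path_image g \<inter> inside (body T2) = {}" if g: "g \<in> T3" for g
  proof -
    have "inside (body T2) \<inter> closure (U1 - U2) = {}"
    proof -
      have "inside (body T2) \<inter> (U1 - U2) = {}" by (auto simp: U1_def U2_def)
      then show ?thesis using cycle_regions(1)[OF C(2)] by (simp add: open_Int_closure_eq_empty)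
    qed
    then have nsub: "\<not> g ` {0<..<1} \<subseteq> inside (body T2)" using t(1)[OF g] by (auto simp: touched_def)
    have "g ` {0<..<1} \<inter> inside (body T2) = {}"
    proof (cases "g \<in> T2")
      case True
      then have "g ` {0<..<1} \<subseteq> body T2" using path_image_eq_open[of g] by (auto simp: body_def)
      then show ?thesis using cycle_regions(10)[OF C(2)] by blast
    next
      case False
      then show ?thesis using edge_open_inside_or_outside[OF C(2) t(2)[OF g] False] nsub cycle_regions(9)[OF C(2)] by blast
    qed
    then have "inside (body T2) \<inter> closure (g ` {0<..<1}) = {}"
      using cycle_regions(1)[OF C(2)] by (simp add: open_Int_closure_eq_empty Int_commute)
    moreover note edge_in_closure[OF t(2)[OF g]]
    ultimately show ?thesis by blast
  qed
  then have "inside (body T2) \<inter> body T3 = {}" by (auto simp: body_def[of T3])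
  then have "inside (body T2) \<subseteq> inside (body T3) \<union> outside (body T3)" using cycle_regions(10)[OF T3(1)] by blast
  then have "inside (body T2) \<inter> inside (body T3) = {} \<or> inside (body T2) \<subseteq> inside (body T3)"
    using connectedD[OF cycle_regions(2)[OF C(2)] cycle_regions(1,4)[OF T3(1)]] cycle_regions(9)[OF T3(1)] by blast
  then show ?thesis using eq xy out by blast
qed

subsection \<open>The packing\<close>

text \<open>The insides of innermost cycles form a finite laminar family, so its maximal members are
  disjoint and still cover all points of \<open>Q\<close> off the graph.\<close>

lemma packing_from_cycles:
  assumes \<epsilon>: "0 < \<epsilon>" "\<epsilon> \<le> 1 / 100" and dil: "dilation G \<le> ennreal ((1 + \<epsilon>\<^sup>2) * (pi / 2))"
    and Q: "convex Q" "closed Q" "interior Q \<noteq> {}"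
    and enc: "\<And>x. x \<in> Q - points \<Longrightarrow> \<exists>T\<in>cycles. x \<in> inside (body T) \<and> weight T \<le> 6"
  obtains D where "disk_packing D" "\<forall>(c, r)\<in>D. r \<le> 1" "Q \<subseteq> (\<Union>(c, r)\<in>D. cball c ((1 + 3 * \<epsilon>) * r))"
proof -
  let ?X = "points"
  define F where "F = {inside (body T) | T x. x \<in> Q - ?X \<and> innermost T x \<and> weight T \<le> 6}"
  have inC: "T \<in> cycles" "x \<in> inside (body T)" if "innermost T x" for T x
    using that by (auto simp: innermost_def is_min_def)
  have "F \<subseteq> (\<lambda>T. inside (body T)) ` cycles" using inC by (auto simp: F_def)
  then have finF: "finite F" using finite_cycles finite_subset by blast
  have cover: "\<exists>R\<in>F. x \<in> R" if x: "x \<in> Q - ?X" for x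
  proof -
    obtain T where T: "T \<in> cycles" "x \<in> inside (body T)" "weight T \<le> 6" using enc[OF x] by blast
    obtain T' where "innermost T' x" "weight T' \<le> weight T" by (rule innermost_exists[OF T(1,2)])
    then show ?thesis using x T(3) inC(2) unfolding F_def by fastforce
  qed
  have laminar: "R \<subseteq> S \<or> S \<subseteq> R \<or> R \<inter> S = {}" if RS: "R \<in> F" "S \<in> F" for R S
  proof -
    obtain T x where T: "R = inside (body T)" "x \<notin> ?X" "innermost T x" using RS(1) by (auto simp: F_def)
    obtain T' y where T': "S = inside (body T')" "y \<notin> ?X" "innermost T' y" using RS(2) by (auto simp: F_def)
    show ?thesis
      using innermost_nested[OF T(3) T'(3) T(2) T'(2)] innermost_nested[OF T'(3) T(3) T'(2) T(2)]
        innermost_disjoint[OF T(3) T'(3) T(2) T'(2)] unfolding T(1) T'(1) by blast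
  qed
  have "\<exists>z \<rho>. 0 < \<rho> \<and> \<rho> \<le> 1 \<and> ball z \<rho> \<subseteq> R \<and> R \<subseteq> cball z ((1 + 3 * \<epsilon>) * \<rho>)" if R: "R \<in> F" for R
  proof -
    obtain T x where T: "R = inside (body T)" "x \<notin> ?X" "innermost T x" "weight T \<le> 6" using R by (auto simp: F_def)
    have min: "is_min T x" using T(3) by (simp add: innermost_def)
    obtain z \<rho> where z: "0 < \<rho>" "\<rho> \<le> weight T / (2 * pi * (1 + \<epsilon>\<^sup>2))" "ball z \<rho> \<subseteq> inside (body T)"
      "inside (body T) \<subseteq> cball z ((1 + 3 * \<epsilon>) * \<rho>)"
      by (rule min_cycle_near_circle[OF min T(2) \<epsilon> dil])
    \<comment> \<open>The bound 6 on the weights is chosen below 2 pi, which makes the radii at most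
      1.\<close>
    have "6 * 1 \<le> 2 * pi * (1 + \<epsilon>\<^sup>2)" using pi_gt3 by (intro mult_mono) auto
    then have "weight T / (2 * pi * (1 + \<epsilon>\<^sup>2)) \<le> 1" using T(4) by (simp add: divide_le_eq_1)
    then show ?thesis using z T(1) by (intro exI[of _ z] exI[of _ \<rho>]) auto
  qed
  then obtain z \<rho> where z: "\<And>R. R \<in> F \<Longrightarrow> 0 < \<rho> R" "\<And>R. R \<in> F \<Longrightarrow> \<rho> R \<le> (1::real)"
    "\<And>R. R \<in> F \<Longrightarrow> ball (z R) (\<rho> R) \<subseteq> R" "\<And>R. R \<in> F \<Longrightarrow> R \<subseteq> cball (z R) ((1 + 3 * \<epsilon>) * \<rho> R)"
    by metis
  define M where "M = {R \<in> F. \<forall>S\<in>F. R \<subseteq> S \<longrightarrow> R = S}"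
  have M: "M \<subseteq> F" "finite M" using finF by (auto simp: M_def)
  have maxi: "\<exists>S\<in>M. R \<subseteq> S" if "R \<in> F" for R
    using finite_has_maximal2[OF finF that] unfolding M_def by blast
  have disj: "R \<inter> S = {}" if "R \<in> M" "S \<in> M" "R \<noteq> S" for R S
    using laminar[of R S] that unfolding M_def by blast
  define D where "D = (\<lambda>R. (z R, \<rho> R)) ` M"
  have "disk_packing D"
    unfolding disk_packing_def
  proof (intro conjI)
    show "\<forall>(c, r)\<in>D. 0 < r" using z(1) M(1) by (auto simp: D_def)
    show "\<forall>(c, r)\<in>D. \<forall>(c', r')\<in>D. (c, r) \<noteq> (c', r') \<longrightarrow> interior (cball c r) \<inter> interior (cball c' r') = {}"
    proof (clarsimp simp: D_def interior_cball)
      fix R S assume RS: "R \<in> M" "S \<in> M" "z R = z S \<longrightarrow> \<rho> R \<noteq> \<rho> S"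
      then have "R \<inter> S = {}" using disj[of R S] by auto
      then show "ball (z R) (\<rho> R) \<inter> ball (z S) (\<rho> S) = {}" using z(3)[of R] z(3)[of S] RS(1,2) M(1) by blast
    qed
  qed
  moreover have "\<forall>(c, r)\<in>D. r \<le> 1" using z(2) M(1) by (auto simp: D_def)
  moreover have "Q \<subseteq> (\<Union>(c, r)\<in>D. cball c ((1 + 3 * \<epsilon>) * r))"
  proof -
    have eq: "(\<Union>(c, r)\<in>D. cball c ((1 + 3 * \<epsilon>) * r)) = (\<Union>R\<in>M. cball (z R) ((1 + 3 * \<epsilon>) * \<rho> R))"
      by (simp add: D_def)
    have "Q - ?X \<subseteq> (\<Union>R\<in>M. cball (z R) ((1 + 3 * \<epsilon>) * \<rho> R))"
    proof
      fix x assume "x \<in> Q - ?X"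
      then obtain S where "S \<in> M" "x \<in> S" using cover maxi by blast
      then show "x \<in> (\<Union>R\<in>M. cball (z R) ((1 + 3 * \<epsilon>) * \<rho> R))" using z(4)[of S] M(1) by blast
    qed
    then have sub: "closure (Q - ?X) \<subseteq> (\<Union>R\<in>M. cball (z R) ((1 + 3 * \<epsilon>) * \<rho> R))"
      using M(2) by (intro closure_minimal closed_UN) auto
    \<comment> \<open>Points of \<open>Q\<close> on the graph are limits of points of
      \<open>Q\<close> off it. Since finitely many closed disks have a closed union, covering the
      latter is enough.\<close>
    have "interior Q \<subseteq> closure (interior Q \<inter> - ?X)"
      using open_Int_closure_subset[of "interior Q" "- ?X"] closure_complement by simp
    also have "\<dots> \<subseteq> closure (Q - ?X)" using interior_subset by (intro closure_mono) blast
    finally have "closure (interior Q) \<subseteq> closure (Q - ?X)" by (rule closure_minimal) simp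
    then have "Q \<subseteq> closure (Q - ?X)" using convex_closure_interior[OF Q(1,3)] Q(2) by simp
    then show ?thesis unfolding eq using sub by blast
  qed
  ultimately show thesis by (rule that)
qed

end

section \<open>Enclosing a point by six paths around a hexagon\<close>

fun joins :: "(nat \<Rightarrow> real \<Rightarrow> complex) \<Rightarrow> nat \<Rightarrow> real \<Rightarrow> complex" where
  "joins s 0 = s 0"
| "joins s (Suc n) = joins s n +++ s (Suc n)"

lemma joins_props:
  assumes "\<And>k. k \<le> n \<Longrightarrow> path (s k)" "\<And>k. k < n \<Longrightarrow> pathfinish (s k) = pathstart (s (Suc k))"
    "\<And>k. k \<le> n \<Longrightarrow> x \<notin> path_image (s k)"
  shows "path (joins s n) \<and> pathstart (joins s n) = pathstart (s 0) \<and> pathfinish (joins s n) = pathfinish (s n)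
    \<and> path_image (joins s n) = (\<Union>k\<le>n. path_image (s k))
    \<and> winding_number (joins s n) x = (\<Sum>k\<le>n. winding_number (s k) x)"
  using assms
proof (induction n)
  case (Suc n)
  have IH: "path (joins s n)" "pathstart (joins s n) = pathstart (s 0)" "pathfinish (joins s n) = pathstart (s (Suc n))"
    "path_image (joins s n) = (\<Union>k\<le>n. path_image (s k))"
    "winding_number (joins s n) x = (\<Sum>k\<le>n. winding_number (s k) x)"
    using Suc.IH Suc.prems by auto
  have x: "x \<notin> path_image (joins s n)" "x \<notin> path_image (s (Suc n))" "path (s (Suc n))"
    using IH(4) Suc.prems by auto
  show ?case
    using IH x winding_number_join[OF IH(1) x(1) x(3) x(2) IH(3)]
    by (simp add: path_image_join atMost_Suc Un_commute)
qed simp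

lemma dist_sum_le_curve_length:
  assumes "t \<in> {0..1}"
  shows "ennreal (dist (g 0) (g t) + dist (g t) (g 1)) \<le> curve_length g"
  using plen_le_curve_length[of "[0, t, 1]" g] assms by (simp add: partitions_def)

text \<open>A path of length at most \<open>d\<close> between consecutive corners stays in the
  ellipse \<open>E k\<close> with these foci, which is convex and misses \<open>x\<close>. It can
  thus be deformed linearly to the straight side without passing \<open>x\<close>. The condition
  \<open>pos\<close> puts \<open>x\<close> strictly to the left of each side, so all winding
  contributions are positive.\<close>

lemma inside_polygon_of_paths:
  fixes p :: "nat \<Rightarrow> complex"
  assumes s: "\<And>k. k \<le> n \<Longrightarrow> path (s k) \<and> pathstart (s k) = p k \<and> pathfinish (s k) = p (Suc k)
        \<and> curve_length (s k) \<le> ennreal d"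
    and loop: "p (Suc n) = p 0"
    and x: "\<And>k. k \<le> n \<Longrightarrow> d < dist (p k) x + dist x (p (Suc k))"
    and pos: "\<And>k. k \<le> n \<Longrightarrow> 0 < Im ((p (Suc k) - p k) * cnj (p (Suc k) - x))"
  shows "x \<in> inside (\<Union>k\<le>n. path_image (s k))"
proof -
  define E where "E k = {z. dist (p k) z + dist z (p (Suc k)) \<le> d}" for k
  have cE: "convex (E k)" for k
  proof -
    have f: "convex_on UNIV (\<lambda>z. dist (p k) z + dist z (p (Suc k)))"
      unfolding dist_commute[of _ "p (Suc k)"] by (intro convex_on_add convex_on_dist) auto
    show ?thesis
      unfolding convex_alt E_def
    proof (clarify, goal_cases)
      case (1 a b u)
      have "dist (p k) ((1 - u) *\<^sub>R a + u *\<^sub>R b) + dist ((1 - u) *\<^sub>R a + u *\<^sub>R b) (p (Suc k))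
          \<le> (1 - u) * (dist (p k) a + dist a (p (Suc k))) + u * (dist (p k) b + dist b (p (Suc k)))"
        using convex_onD[OF f, of u a b] 1 by auto
      also have "\<dots> \<le> (1 - u) * d + u * d" using 1 by (intro add_mono mult_left_mono) auto
      finally show ?case by (simp add: algebra_simps)
    qed
  qed
  have sE: "path_image (s k) \<subseteq> E k" if k: "k \<le> n" for k
  proof
    fix z assume "z \<in> path_image (s k)"
    then obtain t where t: "t \<in> {0..1}" "z = s k t" by (auto simp: path_image_def)
    have le: "ennreal (dist (p k) z + dist z (p (Suc k))) \<le> ennreal d"
      using dist_sum_le_curve_length[OF t(1), of "s k"] s[OF k] t(2)
      by (auto simp: pathstart_def pathfinish_def intro: order_trans)
    \<comment> \<open>\<open>ennreal\<close> sends a negative \<open>d\<close> to 0; a positive left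
      side excludes this case.\<close>
    moreover have "0 < dist (p k) z + dist z (p (Suc k))"
    proof -
      have "p k \<noteq> p (Suc k)" using pos[OF k] by auto
      then have "0 < dist (p k) (p (Suc k))" by simp
      then show ?thesis using dist_triangle[of "p k" "p (Suc k)" z] by linarith
    qed
    ultimately have "dist (p k) z + dist z (p (Suc k)) \<le> d"
      using le unfolding ennreal_le_iff2 by linarith
    then show "z \<in> E k" by (simp add: E_def)
  qed
  have xE: "x \<notin> E k" if "k \<le> n" for k using x[OF that] by (simp add: E_def)
  have w: "0 < Re (winding_number (s k) x)" if k: "k \<le> n" for k
  proof -
    have "p k \<in> E k" "p (Suc k) \<in> E k"
      using sE[OF k] s[OF k] pathstart_in_path_image pathfinish_in_path_image by (metis subsetD)+
    then have seg: "path_image (linepath (p k) (p (Suc k))) \<subseteq> E k"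
      unfolding path_image_linepath by (intro closed_segment_subset cE)
    have "homotopic_paths (E k) (s k) (linepath (p k) (p (Suc k)))"
    proof (rule homotopic_paths_linear)
      fix t :: real assume "t \<in> {0..1}"
      then have "s k t \<in> E k" "linepath (p k) (p (Suc k)) t \<in> E k"
        using sE[OF k] seg unfolding path_image_def by blast+
      then show "closed_segment (s k t) (linepath (p k) (p (Suc k)) t) \<subseteq> E k"
        using cE by (intro closed_segment_subset)
    qed (use s[OF k] in auto)
    then have "homotopic_paths (- {x}) (s k) (linepath (p k) (p (Suc k)))"
      by (rule homotopic_paths_subset) (use xE[OF k] in auto)
    then have "winding_number (s k) x = winding_number (linepath (p k) (p (Suc k))) x"
      by (rule winding_number_homotopic_paths)
    then show ?thesis using winding_number_linepath_pos_lt[OF pos[OF k]] by simp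
  qed
  have xs: "x \<notin> path_image (s k)" if "k \<le> n" for k using sE[OF that] xE[OF that] by blast
  have J: "path (joins s n)" "pathstart (joins s n) = p 0" "pathfinish (joins s n) = p 0"
    "path_image (joins s n) = (\<Union>k\<le>n. path_image (s k))"
    "winding_number (joins s n) x = (\<Sum>k\<le>n. winding_number (s k) x)"
    using joins_props[of n s x] s xs loop by auto
  have "0 < (\<Sum>k\<le>n. Re (winding_number (s k) x))" by (intro sum_pos) (auto intro: w)
  then have "winding_number (joins s n) x \<noteq> 0" unfolding J(5) by (metis Re_sum less_irrefl zero_complex.sel(1))
  then have "x \<notin> outside (path_image (joins s n))"
    using winding_number_zero_in_outside[of "joins s n" x] J(1-3) by auto
  moreover have "x \<notin> path_image (joins s n)" using xs unfolding J(4) by auto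
  ultimately show ?thesis unfolding J(4)[symmetric] using inside_Un_outside[of "path_image (joins s n)"] by blast
qed

text \<open>A regular hexagon with circumradius 1/2, which is also its side length. The index runs
  over all naturals, so corner 6 is corner 0 again.\<close>

definition hexagon :: "complex \<Rightarrow> nat \<Rightarrow> complex" where
  "hexagon c k = c + cis (real k * (pi / 3)) / 2"

lemma hexagon_6: "hexagon c (Suc 5) = hexagon c 0"
  by (simp add: hexagon_def)

lemma hexagon_side: "dist (hexagon c k) (hexagon c (Suc k)) = 1 / 2"
proof -
  have "cis (real (Suc k) * (pi / 3)) = cis (real k * (pi / 3)) * cis (pi / 3)"
    unfolding cis_mult by (simp add: add_divide_distrib algebra_simps)
  then have eq: "hexagon c k - hexagon c (Suc k) = cis (real k * (pi / 3)) * ((1 - cis (pi / 3)) / 2)"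
    by (simp add: hexagon_def field_simps)
  have one: "cmod (1 - cis (pi / 3)) = 1"
    by (simp add: cmod_def cos_60 sin_60 power2_eq_square)
  show ?thesis unfolding dist_norm eq norm_mult norm_divide one by simp
qed

text \<open>A detour through \<open>x\<close> has length at least 2 (1/2 - 1/50) = 0.96. For the
  centre itself the imaginary part is sqrt 3 / 8, and moving by at most 1/50 changes it by at most
  1/100.\<close>

lemma hexagon_position:
  assumes "dist x c \<le> 1 / 50"
  shows "8 / 10 < dist (hexagon c k) x + dist x (hexagon c (Suc k))"
    and "0 < Im ((hexagon c (Suc k) - hexagon c k) * cnj (hexagon c (Suc k) - x))"
proof -
  have h: "dist (hexagon c k) c = 1 / 2" for k
    by (simp add: hexagon_def dist_norm norm_divide)
  have "1 / 2 \<le> dist (hexagon c k) x + 1 / 50" for k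
    using dist_triangle[of "hexagon c k" c x] h[of k] assms by simp
  from this[of k] this[of "Suc k"] show "8 / 10 < dist (hexagon c k) x + dist x (hexagon c (Suc k))"
    by (simp add: dist_commute)
  define a where "a = cis (real k * (pi / 3))"
  have b: "cis (real (Suc k) * (pi / 3)) = a * cis (pi / 3)"
    unfolding a_def cis_mult by (simp add: add_divide_distrib algebra_simps)
  have hk: "hexagon c k = c + a / 2" "hexagon c (Suc k) = c + a * cis (pi / 3) / 2"
    unfolding hexagon_def b by (simp_all add: a_def)
  define e where "e = hexagon c (Suc k) - hexagon c k"
  have e: "e = a * (cis (pi / 3) - 1) / 2" by (simp add: e_def hk field_simps)
  have "hexagon c (Suc k) - x = a * cis (pi / 3) / 2 + (c - x)" by (simp add: hk)
  then have "e * cnj (hexagon c (Suc k) - x) = e * cnj (a * cis (pi / 3) / 2) + e * cnj (c - x)"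
    by (simp only: complex_cnj_add distrib_left)
  moreover have "e * cnj (a * cis (pi / 3) / 2) = (a * cnj a) * ((cis (pi / 3) - 1) * cnj (cis (pi / 3)) / 4)"
    unfolding e by simp
  ultimately have eq: "(hexagon c (Suc k) - hexagon c k) * cnj (hexagon c (Suc k) - x)
      = (a * cnj a) * ((cis (pi / 3) - 1) * cnj (cis (pi / 3)) / 4) + (hexagon c (Suc k) - hexagon c k) * cnj (c - x)"
    unfolding e_def by simp
  have aa: "a * cnj a = 1" by (simp add: a_def complex_norm_square[symmetric])
  have im: "Im ((cis (pi / 3) - 1) * cnj (cis (pi / 3)) / 4) = sqrt 3 / 8"
    by (simp add: cos_60 sin_60 algebra_simps)
  have "\<bar>Im ((hexagon c (Suc k) - hexagon c k) * cnj (c - x))\<bar> \<le> 1 / 2 * (1 / 50)"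
  proof -
    have "\<bar>Im ((hexagon c (Suc k) - hexagon c k) * cnj (c - x))\<bar> \<le> cmod (hexagon c (Suc k) - hexagon c k) * cmod (c - x)"
      using abs_Im_le_cmod[of "(hexagon c (Suc k) - hexagon c k) * cnj (c - x)"] by (simp only: norm_mult complex_mod_cnj)
    also have "cmod (hexagon c (Suc k) - hexagon c k) = 1 / 2" using hexagon_side[of c k] by (simp add: dist_norm norm_minus_commute)
    also have "cmod (c - x) \<le> 1 / 50" using assms by (simp add: dist_norm norm_minus_commute)
    finally show ?thesis by simp
  qed
  moreover have "1 \<le> sqrt 3" by simp
  ultimately show "0 < Im ((hexagon c (Suc k) - hexagon c k) * cnj (hexagon c (Suc k) - x))"
    unfolding eq aa mult_1 plus_complex.sel im by linarith
qed

text \<open>Mesh 1/100 on the square with corners 0 and 4 + 4i. Rounding down moves each coordinate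
  by at most 1/100, which gives the distance 1/50 of \<open>grid_near\<close>.\<close>

definition grid :: "complex set" where
  "grid = (\<lambda>(i, j). Complex (real i / 100) (real j / 100)) ` ({..400} \<times> {..400})"

definition hexagons :: "complex set" where
  "hexagons = (\<lambda>(c, k). hexagon c k) ` (grid \<times> {..5})"

lemma finite_hexagons: "finite hexagons"
  by (simp add: hexagons_def grid_def)

lemma hexagon_in_hexagons: "c \<in> grid \<Longrightarrow> k \<le> 6 \<Longrightarrow> hexagon c k \<in> hexagons"
proof -
  assume c: "c \<in> grid" and "k \<le> 6"
  then consider "k \<le> 5" | "k = Suc 5" by linarith
  then show ?thesis
  proof cases
    case 2
    then show ?thesis using c hexagon_6[of c] by (auto simp: hexagons_def)
  qed (use c in \<open>auto simp: hexagons_def\<close>)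
qed

lemma grid_near:
  assumes "x \<in> cbox 0 (Complex 4 4)"
  obtains c where "c \<in> grid" "dist x c \<le> 1 / 50"
proof -
  have x: "0 \<le> Re x" "Re x \<le> 4" "0 \<le> Im x" "Im x \<le> 4" using assms by (auto simp: in_cbox_complex_iff)
  have *: "nat \<lfloor>100 * u\<rfloor> \<le> 400 \<and> \<bar>u - real (nat \<lfloor>100 * u\<rfloor>) / 100\<bar> \<le> 1 / 100" if "0 \<le> u" "u \<le> 4" for u :: real
  proof -
    have n: "0 \<le> \<lfloor>100 * u\<rfloor>" "\<lfloor>100 * u\<rfloor> \<le> 400" using that by (auto simp: floor_le_iff)
    then have eq: "real (nat \<lfloor>100 * u\<rfloor>) = of_int \<lfloor>100 * u\<rfloor>" by simp
    have "of_int \<lfloor>100 * u\<rfloor> \<le> 100 * u" "100 * u < of_int \<lfloor>100 * u\<rfloor> + 1" by linarith+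
    then have "\<bar>u - of_int \<lfloor>100 * u\<rfloor> / 100\<bar> \<le> 1 / 100" by linarith
    moreover have "nat \<lfloor>100 * u\<rfloor> \<le> 400" using n by linarith
    ultimately show ?thesis unfolding eq by blast
  qed
  define c where "c = Complex (real (nat \<lfloor>100 * Re x\<rfloor>) / 100) (real (nat \<lfloor>100 * Im x\<rfloor>) / 100)"
  have "c \<in> grid" using *[OF x(1,2)] *[OF x(3,4)] by (auto simp: grid_def c_def)
  moreover have "dist x c \<le> \<bar>Re (x - c)\<bar> + \<bar>Im (x - c)\<bar>" unfolding dist_norm by (rule cmod_le)
  then have "dist x c \<le> 1 / 50" using *[OF x(1,2)] *[OF x(3,4)] by (simp add: c_def)
  ultimately show thesis by (rule that)
qed

text \<open>Neighbouring corners at distance 1/2 are joined by paths of length at most 0.8, which is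
  too short for the detour through \<open>x\<close>; six of them have total length at most
  4.8.\<close>

lemma (in plane_graph) cycle_around_point:
  assumes P: "hexagons \<subseteq> points" and dil: "dilation G < ennreal (16 / 10)"
    and x: "x \<in> cbox 0 (Complex 4 4) - points"
  shows "\<exists>T\<in>cycles. x \<in> inside (body T) \<and> weight T \<le> 6"
proof -
  obtain c where c: "c \<in> grid" "dist x c \<le> 1 / 50" using grid_near x by blast
  have "\<exists>s. path s \<and> path_image s \<subseteq> points \<and> pathstart s = hexagon c k \<and> pathfinish s = hexagon c (Suc k)
      \<and> curve_length s \<le> ennreal (8 / 10)" if k: "k \<le> 5" for k
  proof -
    let ?p = "hexagon c k" and ?q = "hexagon c (Suc k)"
    have pq: "?p \<in> points" "?q \<in> points" "?p \<noteq> ?q"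
      using P hexagon_in_hexagons[OF c(1)] k hexagon_side[of c k] by auto
    then have "graph_dist G ?p ?q / ennreal (dist ?p ?q) \<le> dilation G"
      unfolding dilation_def by (intro SUP_upper2[of "(?p, ?q)"]) auto
    then have lt: "graph_dist G ?p ?q / ennreal (1 / 2) < ennreal (16 / 10)"
      unfolding hexagon_side using dil by (rule le_less_trans)
    \<comment> \<open>Strictness matters: the graph distance is an infimum, and an actual path is to
      be picked below 0.8.\<close>
    have "graph_dist G ?p ?q < ennreal (8 / 10)"
    proof (rule ccontr)
      assume "\<not> ?thesis"
      then have "ennreal (8 / 10) / ennreal (1 / 2) \<le> graph_dist G ?p ?q / ennreal (1 / 2)"
        by (intro divide_right_mono_ennreal) simp
      moreover have "ennreal (8 / 10) / ennreal (1 / 2) = ennreal (16 / 10)" by (subst divide_ennreal) auto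
      ultimately show False using lt by simp
    qed
    then obtain s where "path s" "path_image s \<subseteq> points" "pathstart s = ?p" "pathfinish s = ?q"
      "curve_length s < ennreal (8 / 10)"
      unfolding graph_dist_def INF_less_iff by auto
    then show ?thesis by (intro exI[of _ s]) auto
  qed
  then obtain s where s: "\<And>k. k \<le> 5 \<Longrightarrow> path (s k) \<and> path_image (s k) \<subseteq> points \<and> pathstart (s k) = hexagon c k
      \<and> pathfinish (s k) = hexagon c (Suc k) \<and> curve_length (s k) \<le> ennreal (8 / 10)"
    by metis
  have "x \<in> inside (\<Union>k\<le>5. path_image (s k))"
    using s hexagon_6 hexagon_position[OF c(2)]
    by (intro inside_polygon_of_paths[where p = "hexagon c" and d = "8/10"]) auto
  then obtain T where T: "T \<in> cycles" "x \<in> inside (body T)" "ennreal (weight T) \<le> (\<Sum>k\<le>5. curve_length (s k))"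
    using inside_paths_cycle[of "{..5}" s x] s x by auto
  note T(3)
  also have "(\<Sum>k\<le>5. curve_length (s k)) \<le> (\<Sum>k\<le>(5::nat). ennreal (8 / 10))"
    using s by (intro sum_mono) auto
  also have "\<dots> = ennreal (48 / 10)" by (subst sum_ennreal) auto
  finally have "weight T \<le> 48 / 10" by (subst (asm) ennreal_le_iff) auto
  then show ?thesis using T by (intro bexI[of _ T]) auto
qed

text \<open>The corners of all hexagons serve as the finite point set; a graph through them with too
  small dilation would produce a packing that contradicts \<open>DP\<close>.\<close>

lemma dilation_lower_bound:
  assumes \<Lambda>: "1 < \<Lambda>" "\<Lambda> \<le> 1.03" and DP: "DP \<Lambda>"
  shows "\<Delta> \<ge> ennreal ((1 + ((\<Lambda> - 1) / 3)\<^sup>2) * (pi / 2))"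
proof (rule ccontr)
  define \<epsilon> where "\<epsilon> = (\<Lambda> - 1) / 3"
  have \<epsilon>: "0 < \<epsilon>" "\<epsilon> \<le> 1 / 100" "\<Lambda> = 1 + 3 * \<epsilon>" using \<Lambda> by (auto simp: \<epsilon>_def field_simps)
  let ?b = "(1 + \<epsilon>\<^sup>2) * (pi / 2)"
  assume "\<not> ?thesis"
  then have "\<Delta> < ennreal ?b" by (simp add: \<epsilon>_def not_le)
  moreover have "(INF G\<in>{G. finite_plane_graph G \<and> hexagons \<subseteq> graph_points G}. dilation G) \<le> \<Delta>"
    unfolding min_dilation_def using finite_hexagons by (intro SUP_upper2[of hexagons]) auto
  ultimately have "(INF G\<in>{G. finite_plane_graph G \<and> hexagons \<subseteq> graph_points G}. dilation G) < ennreal ?b"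
    by (rule le_less_trans[rotated])
  then obtain G where Gp: "finite_plane_graph G" "hexagons \<subseteq> graph_points G" "dilation G < ennreal ?b"
    unfolding INF_less_iff by auto
  interpret plane_graph G using Gp(1) by unfold_locales
  \<comment> \<open>For \<epsilon> \<le> 1/100 the bound is about 1.571, so the coarse value 1.6 of
    the hexagon argument applies to the same graph.\<close>
  have "?b \<le> 16 / 10"
  proof -
    have "\<epsilon>\<^sup>2 \<le> (1 / 100)\<^sup>2" using \<epsilon> by (intro power_mono) auto
    then have "(1 + \<epsilon>\<^sup>2) * (pi / 2) \<le> (1 + (1 / 100)\<^sup>2) * (315 / 200)"
      using pi_approx by (intro mult_mono) auto
    also have "\<dots> \<le> 16 / 10" by (simp add: power2_eq_square)
    finally show ?thesis .
  qed
  then have dil: "dilation G < ennreal (16 / 10)" using Gp(3) by (meson ennreal_leI less_le_trans)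
  let ?Q = "cbox 0 (Complex 4 4)"
  have "interior ?Q \<noteq> {}" by (auto simp: interior_cbox box_ne_empty Basis_complex_def inner_complex_def)
  then obtain D where D: "disk_packing D" "\<forall>(c, r)\<in>D. r \<le> 1" "?Q \<subseteq> (\<Union>(c, r)\<in>D. cball c ((1 + 3 * \<epsilon>) * r))"
    using packing_from_cycles[OF \<epsilon>(1,2) less_imp_le[OF Gp(3)] convex_box(1) closed_cbox _ cycle_around_point[OF Gp(2) dil]]
    by blast
  have "is_square 4 ?Q"
    unfolding is_square_def
  proof (intro exI conjI)
    show "norm (1::complex) = 1" "norm \<i> = 1" "inner (1::complex) \<i> = 0" by (auto simp: inner_complex_def)
    show "?Q = {0 + x *\<^sub>R 1 + y *\<^sub>R \<i> | x y. x \<in> {0..4} \<and> y \<in> {0..4}}"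
    proof (intro set_eqI iffI)
      fix z assume "z \<in> ?Q"
      then have "z = 0 + Re z *\<^sub>R 1 + Im z *\<^sub>R \<i>" "Re z \<in> {0..4}" "Im z \<in> {0..4}"
        by (auto simp: in_cbox_complex_iff complex_eq_iff)
      then show "z \<in> {0 + x *\<^sub>R 1 + y *\<^sub>R \<i> | x y. x \<in> {0..4} \<and> y \<in> {0..4}}" by blast
    qed (auto simp: in_cbox_complex_iff)
  qed
  then show False using DP D unfolding DP_def \<epsilon>(3) by blast
qed

theorem theorem2:
  shows "(\<forall>\<Lambda>::real. 1 < \<Lambda> \<and> \<Lambda> \<le> 1.03 \<and> DP \<Lambda> \<longrightarrow>
            \<Delta> \<ge> ennreal ((1 + ((\<Lambda> - 1) / 3)\<^sup>2) * (pi / 2))) \<and>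
         (DP 1.00001 \<longrightarrow>
            \<Delta> \<ge> ennreal ((1 + (1 / 10 ^ 10) / 9) * (pi / 2)) \<and>
            ennreal ((1 + (1 / 10 ^ 10) / 9) * (pi / 2)) > ennreal ((1 + 1 / 10 ^ 11) * (pi / 2)))"
proof (intro conjI allI impI)
  fix \<Lambda> :: real
  assume "1 < \<Lambda> \<and> \<Lambda> \<le> 1.03 \<and> DP \<Lambda>"
  then show "\<Delta> \<ge> ennreal ((1 + ((\<Lambda> - 1) / 3)\<^sup>2) * (pi / 2))"
    using dilation_lower_bound by blast
next
  assume "DP 1.00001"
  then have "\<Delta> \<ge> ennreal ((1 + ((1.00001 - 1) / 3)\<^sup>2) * (pi / 2))"
    by (intro dilation_lower_bound) auto
  moreover have "((1.00001 - 1) / 3)\<^sup>2 = (1 / 10 ^ 10) / (9::real)"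
    by (simp add: power2_eq_square)
  ultimately show "\<Delta> \<ge> ennreal ((1 + (1 / 10 ^ 10) / 9) * (pi / 2))" by metis
  \<comment> \<open>Amounts to 1/9 > 1/10.\<close>
  show "ennreal ((1 + (1 / 10 ^ 10) / 9) * (pi / 2)) > ennreal ((1 + 1 / 10 ^ 11) * (pi / 2))"
    by (intro ennreal_lessI mult_strict_right_mono) auto
qed

end
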